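(* Let $n_1 \geq 3$ and $m_2 \geq 1$ be integers such that, with $j=j_{n_1,m_2}$, $k=k_{n_1,m_2}$ and $r=r_{n_1,m_2}$ as in the context, $k \geq 1$ and $j < \lfloor (m_2-1)/2 \rfloor$. Then there is a function $\epsilon(m_1) = \Theta(m_1/\log m_1)$ such that, for all sufficiently large $m_1$ and all positive integers $n_2$, the graph $K_{m_1(n_1), m_2(n_2)}$ has a distinguishing partition if and only if $n_2 \leq r m_1 + \epsilon(m_1)$.
   Context: $K_{m_1(n_1),m_2(n_2)}$ denotes the complete multipartite graph whose parts are $m_1$ sets of size $n_1$ and $m_2$ sets of size $n_2$. For a graph $X$ with automorphism group $\mathrm{aut}(X)$ and a partition $P=\{P_1,\dots,P_t\}$ of $V(X)$, put $\gamma(P)=\{\gamma(P_1),\dots,\gamma(P_t)\}$; $P$ is a distinguishing partition if $\gamma(P)\neq P$ for every nontrivial $\gamma\in\mathrm{aut}(X)$. For $n_1 \geq 3$, $j=j_{n_1,m_2}\ge0$ and $k=k_{n_1,m_2}\ge0$ are the integers with $n_1 = 2 + \sum_{i=0}^{j}\binom{m_2}{i} + k$ and either ($j < \lfloor (m_2-1)/2 \rfloor$ and $0 \leq k < \binom{m_2}{j+1}$) or ($j = \lfloor (m_2-1)/2 \rfloor$ and $k \geq 0$). If $j < \lfloor (m_2-1)/2 \rfloor$, $r = 1 + \sum_{i=0}^{j}\frac{m_2-i}{m_2}\binom{m_2}{i} + \frac{m_2 - j - 1}{m_2}k$; otherwise $r = 1 + \sum_{i=0}^{j}\frac{m_2-i}{m_2}\binom{m_2}{i}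 + \frac{k}{2}$. *)

theory Defs
  imports
    Complex_Main
    "HOL-Library.Landau_Symbols"
    "HOL-Library.Disjoint_Sets"
    "HOL-Combinatorics.Permutations"
begin

section \<open>Simple graphs, automorphisms and distinguishing partitions\<close>

text \<open>A simple graph is a pair of a vertex set and a set of two-element edges.\<close>

type_synonym 'a graph = "'a set \<times> 'a set set"

abbreviation verts :: "'a graph \<Rightarrow> 'a set" where
  "verts X \<equiv> fst X"

abbreviation edges :: "'a graph \<Rightarrow> 'a set set" where
  "edges X \<equiv> snd X"

text \<open>Automorphisms are functions on the whole vertex type that are the identity outside the
  vertex set, so the trivial automorphism is exactly \<^term>\<open>id\<close>.\<close>

definition aut :: "'a graph \<Rightarrow> ('a \<Rightarrow> 'a) set" where
  "aut X = {\<gamma>. \<gamma> permutes verts X \<and>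
     (\<forall>u\<in>verts X. \<forall>v\<in>verts X. {\<gamma> u, \<gamma> v} \<in> edges X \<longleftrightarrow> {u, v} \<in> edges X)}"

definition distinguishing_partition :: "'a graph \<Rightarrow> 'a set set \<Rightarrow> bool" where
  "distinguishing_partition X P \<longleftrightarrow>
     partition_on (verts X) P \<and> (\<forall>\<gamma>\<in>aut X. \<gamma> \<noteq> id \<longrightarrow> (\<lambda>B. \<gamma> ` B) ` P \<noteq> P)"

definition complete_multipartite :: "'i set \<Rightarrow> ('i \<Rightarrow> 'b set) \<Rightarrow> ('i \<times> 'b) graph" where
  "complete_multipartite I A =
     (Sigma I A, {{u, v} | u v. u \<in> Sigma I A \<and> v \<in> Sigma I A \<and> fst u \<noteq> fst v})"

text \<open>The graph $K_{m_1(n_1), m_2(n_2)}$: the first \<open>m1\<close> parts have size \<open>n1\<close>, the remaining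
  \<open>m2\<close> parts have size \<open>n2\<close>.\<close>

definition K_mult :: "nat \<Rightarrow> nat \<Rightarrow> nat \<Rightarrow> nat \<Rightarrow> (nat \<times> nat) graph" where
  "K_mult m1 n1 m2 n2 =
     complete_multipartite {..<m1 + m2} (\<lambda>i. if i < m1 then {..<n1} else {..<n2})"


section \<open>The parameters $j$, $k$ and $r$\<close>

text \<open>\<open>jk_params n1 m2 j k\<close> says that $j = j_{n_1,m_2}$ and $k = k_{n_1,m_2}$; the lemma below shows
  that these are well defined. For \<open>m2 \<ge> 1\<close> the truncated subtraction is harmless, and \<open>div\<close> is the
  floor of the quotient.\<close>

definition jk_params :: "nat \<Rightarrow> nat \<Rightarrow> nat \<Rightarrow> nat \<Rightarrow> bool" where
  "jk_params n1 m2 j k \<longleftrightarrow>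
     n1 = 2 + (\<Sum>i=0..j. m2 choose i) + k \<and>
     (j < (m2 - 1) div 2 \<and> k < (m2 choose (j + 1)) \<or> j = (m2 - 1) div 2)"

definition r_param :: "nat \<Rightarrow> nat \<Rightarrow> nat \<Rightarrow> real" where
  "r_param m2 j k =
     1 + (\<Sum>i=0..j. (real m2 - real i) / real m2 * real (m2 choose i)) +
     (if j < (m2 - 1) div 2 then (real m2 - real j - 1) / real m2 * real k else real k / 2)"

lemma jk_params_ex1:
  assumes "n1 \<ge> 3"
  shows "\<exists>!(j, k). jk_params n1 m2 j k"
proof -
  define S where "S j = (\<Sum>i=0..j. m2 choose i)" for j
  define M where "M = (m2 - 1) div 2"
  have S_Suc: "S (Suc j) = S j + (m2 choose (j + 1))" for j
    by (simp add: S_def)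
  have S_mono: "S i \<le> S j" if "i \<le> j" for i j
    unfolding S_def using that by (intro sum_mono2) auto
  have jk: "jk_params n1 m2 j k \<longleftrightarrow>
      n1 = 2 + S j + k \<and> (j < M \<and> k < (m2 choose (j + 1)) \<or> j = M)" for j k
    by (simp add: jk_params_def S_def M_def)
  define J where "J = Max {j. j \<le> M \<and> 2 + S j \<le> n1}"
  have fin: "finite {j. j \<le> M \<and> 2 + S j \<le> n1}"
    by simp
  have "0 \<in> {j. j \<le> M \<and> 2 + S j \<le> n1}"
    using assms by (simp add: S_def)
  then have "J \<in> {j. j \<le> M \<and> 2 + S j \<le> n1}"
    unfolding J_def by (intro Max_in[OF fin]) blast
  then have J: "J \<le> M" "2 + S J \<le> n1"
    by auto
  have "n1 < 2 + S (Suc J)" if "J < M"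
  proof (rule ccontr)
    assume "\<not> n1 < 2 + S (Suc J)"
    with that have "Suc J \<in> {j. j \<le> M \<and> 2 + S j \<le> n1}"
      by simp
    from Max_ge[OF fin this] show False
      unfolding J_def[symmetric] by simp
  qed
  with J have ex: "jk_params n1 m2 J (n1 - 2 - S J)"
    unfolding jk S_Suc by auto
  have no: False if "jk_params n1 m2 j k" "jk_params n1 m2 j' k'" "j < j'" for j k j' k'
    using that S_mono[of "Suc j" j'] S_Suc[of j] unfolding jk by auto
  have uniq: "j = j' \<and> k = k'" if "jk_params n1 m2 j k" "jk_params n1 m2 j' k'" for j k j' k'
  proof -
    have "j = j'"
      using no that by (meson linorder_neqE_nat)
    then show ?thesis
      using that unfolding jk by auto
  qed
  show ?thesis
    using ex uniq by (auto intro!: ex1I[of _ "(J, n1 - 2 - S J)"])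
qed

end

theory Submission
  imports Defs "HOL-Real_Asymp.Real_Asymp"
begin

text \<open>A partition is recorded by the family of sets of parts met by its blocks; it is distinguishing
  iff this family is rigid. View the parts of size \<open>n1\<close> as points and each block as a hyperedge on
  the points it meets, labelled by the set of large parts it meets. The number of incidences with
  large parts is at most \<open>m2 r m1\<close> plus a constant times the number of tree components. Rigidity forces
  the tree components to be pairwise non-isomorphic, and there are only exponentially many labelled
  trees of a given size, so there are \<open>O(m1 / log m1)\<close> of them. Conversely, about \<open>m1 / log m1\<close>
  labelled paths of logarithmic length with pairwise different codes attain this order, and variants
  of the same construction realise every smaller \<open>n2\<close>. Between this lower bound and the maximum one
  descends step by step: there are many tree components without empty labels, and almost every way of
  replacing a full label in them by the empty one keeps the family rigid.\<close>

section \<open>Distinguishing partitions as rigid set families\<close>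

text \<open>Put \<open>d = m2 - j - 1\<close>. A point inside a path spends two of its
  \<open>n1\<close> incidences on edges and the others on blocks of its own. The best labels for
  these are all sets of more than \<open>d\<close> large parts and \<open>k\<close> sets of size
  \<open>d\<close>; with one full edge label per point they give \<open>m2 * r\<close> incidences
  per point. Cutting a path trades a full edge label for two labels of size \<open>d\<close>, a gain
  of \<open>mu = 2 * d - m2 = m2 - 2 * j - 2\<close>, which is positive by the bound on
  \<open>j\<close>. So the optimum has as many tree components as rigidity permits. That
  \<open>k\<close> is at least 1 and below \<open>m2 choose (j + 1)\<close> leaves a choice among
  the sets of size \<open>d\<close>, so that equally heavy paths can carry different codes. The
  obstacle is that realisability is not visibly monotone in \<open>n2\<close>: dropping an incidence
  may create a symmetry. Beyond the range of the construction nothing is known about the family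
  except its weight. But then the weight inequality is nearly tight, which limits the empty labels
  and the points without a full block of their own to \<open>O(m1 / log m1)\<close>, while the tree
  components without empty labels still cover a number of points linear in
  \<open>m1\<close>.\<close>

definition rigid_family :: "'a set \<Rightarrow> 'a set set \<Rightarrow> bool" where
  "rigid_family I \<B> \<longleftrightarrow> (\<forall>\<sigma>. \<sigma> permutes I \<longrightarrow> (`) \<sigma> ` \<B> = \<B> \<longrightarrow> \<sigma> = id)"

lemma involution_permutes:
  assumes "\<And>u. f (f u) = u" "\<And>u. u \<notin> A \<Longrightarrow> f u = u"
  shows "f permutes A"
  unfolding permutes_def using assms by metis

lemma complete_multipartite_edge_iff:
  assumes "u \<in> Sigma I A" "v \<in> Sigma I A"
  shows "{u, v} \<in> edges (complete_multipartite I A) \<longleftrightarrow> fst u \<noteq> fst v"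
proof
  assume "{u, v} \<in> edges (complete_multipartite I A)"
  then show "fst u \<noteq> fst v"
    by (auto simp: complete_multipartite_def doubleton_eq_iff)
next
  assume "fst u \<noteq> fst v"
  then show "{u, v} \<in> edges (complete_multipartite I A)"
    using assms unfolding complete_multipartite_def snd_conv
    by (intro CollectI exI[of _ u] exI[of _ v] conjI refl)
qed

lemma verts_complete_multipartite: "verts (complete_multipartite I A) = Sigma I A"
  by (simp add: complete_multipartite_def)

lemma aut_complete_multipartite_iff:
  "\<gamma> \<in> aut (complete_multipartite I A) \<longleftrightarrow> \<gamma> permutes Sigma I A \<and>
     (\<forall>u\<in>Sigma I A. \<forall>v\<in>Sigma I A. fst (\<gamma> u) = fst (\<gamma> v) \<longleftrightarrow> fst u = fst v)"
proof -
  have "{\<gamma> u, \<gamma> v} \<in> edges (complete_multipartite I A) \<longleftrightarrow> fst (\<gamma> u) \<noteq> fst (\<gamma> v)"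
    if "\<gamma> permutes Sigma I A" "u \<in> Sigma I A" "v \<in> Sigma I A" for u v
    using that by (intro complete_multipartite_edge_iff) (auto simp: permutes_in_image)
  then show ?thesis
    unfolding aut_def verts_complete_multipartite mem_Collect_eq
    using complete_multipartite_edge_iff[of _ I A] by (intro conj_cong refl) simp
qed

text \<open>Every set containing \<open>i\<close> receives its own vertex of part \<open>i\<close>,
  so the blocks meet each part at most once. An automorphism preserving the partition induces a
  permutation \<open>\<sigma>\<close> of the parts that preserves the family; rigidity makes
  \<open>\<sigma>\<close> trivial, so every block is mapped to itself and every vertex is fixed.
  Positive part sizes make \<open>\<sigma>\<close> well defined on all of \<open>I\<close>.\<close>

lemma distinguishing_partition_of_rigid_family:
  fixes n :: "'i \<Rightarrow> nat"
  assumes "finite I" "\<B> \<subseteq> Pow I" "\<And>i. i \<in> I \<Longrightarrow> card {B \<in> \<B>. i \<in> B} = n i"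
    and pos: "\<And>i. i \<in> I \<Longrightarrow> n i > 0" and rigid: "rigid_family I \<B>"
  shows "\<exists>P. distinguishing_partition (complete_multipartite I (\<lambda>i. {..<n i})) P"
proof -
  let ?V = "Sigma I (\<lambda>i. {..<n i})"
  have finB: "finite \<B>"
    using assms(1,2) by (rule finite_subset[rotated, OF finite_Pow_iff[THEN iffD2]])
  have "\<exists>\<phi>. bij_betw \<phi> {B \<in> \<B>. i \<in> B} {..<n i}" if "i \<in> I" for i
    using assms(3)[OF that] finB by (intro finite_same_card_bij) auto
  then obtain \<phi> where \<phi>: "\<And>i. i \<in> I \<Longrightarrow> bij_betw (\<phi> i) {B \<in> \<B>. i \<in> B} {..<n i}"
    by metis
  define blk where "blk B = (\<lambda>i. (i, \<phi> i B)) ` B" for B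
  \<comment> \<open>The empty set may belong to the family but would yield an empty block.\<close>
  define P where "P = blk ` (\<B> - {{}})"
  have fst_blk: "fst ` blk B = B" for B
    unfolding blk_def image_image by simp
  have mem_blk: "u \<in> blk B \<longleftrightarrow> fst u \<in> B \<and> snd u = \<phi> (fst u) B" for u B
    unfolding blk_def by (cases u) auto
  have ex_blk: "\<exists>B\<in>\<B>. u \<in> blk B" if "u \<in> ?V" for u
  proof -
    have "snd u \<in> \<phi> (fst u) ` {B \<in> \<B>. fst u \<in> B}"
      using \<phi>[of "fst u"] that by (auto simp: bij_betw_def)
    then show ?thesis by (auto simp: mem_blk)
  qed
  have blk_sub: "blk B \<subseteq> ?V" if "B \<in> \<B>" for B
  proof
    fix u assume "u \<in> blk B"
    then have u: "fst u \<in> B" "snd u = \<phi> (fst u) B" by (auto simp: mem_blk)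
    then have "fst u \<in> I" using assms(2) that by auto
    moreover have "\<phi> (fst u) B \<in> {..<n (fst u)}"
      using \<phi>[OF \<open>fst u \<in> I\<close>] u that unfolding bij_betw_def by blast
    ultimately show "u \<in> ?V" using u(2) by (cases u) auto
  qed
  have blk_unique: "B = B'" if "B \<in> \<B>" "B' \<in> \<B>" "u \<in> blk B" "u \<in> blk B'" for u B B'
  proof -
    have u: "fst u \<in> B" "fst u \<in> B'" "\<phi> (fst u) B = \<phi> (fst u) B'"
      using that(3,4) by (auto simp: mem_blk)
    have "fst u \<in> I" using u(1) that(1) assms(2) by auto
    from \<phi>[OF this] show ?thesis
      using u that by (auto simp: bij_betw_def inj_on_def)
  qed
  have "partition_on ?V P"
  proof (rule partition_onI)
    show "\<Union>P = ?V"
    proof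
      show "\<Union>P \<subseteq> ?V" using blk_sub by (auto simp: P_def)
      show "?V \<subseteq> \<Union>P"
      proof
        fix u assume "u \<in> ?V"
        then obtain B where "B \<in> \<B>" "u \<in> blk B" using ex_blk by blast
        then show "u \<in> \<Union>P" unfolding P_def by (auto simp: mem_blk)
      qed
    qed
    show "disjnt p q" if "p \<in> P" "q \<in> P" "p \<noteq> q" for p q
      using that blk_unique unfolding P_def disjnt_def by blast
    show "{} \<notin> P"
      unfolding P_def blk_def by auto
  qed
  moreover have "\<gamma> = id"
    if aut: "\<gamma> \<in> aut (complete_multipartite I (\<lambda>i. {..<n i}))" and P: "(\<lambda>B. \<gamma> ` B) ` P = P" for \<gamma>
  proof -
    have perm: "\<gamma> permutes ?V"
      and same: "\<And>u v. u \<in> ?V \<Longrightarrow> v \<in> ?V \<Longrightarrow> fst (\<gamma> u) = fst (\<gamma> v) \<longleftrightarrow> fst u = fst v"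
      using aut unfolding aut_complete_multipartite_iff by blast+
    define \<sigma> where "\<sigma> i = (if i \<in> I then fst (\<gamma> (i, 0)) else i)" for i
    have \<sigma>_fst: "\<sigma> (fst u) = fst (\<gamma> u)" if "u \<in> ?V" for u
    proof -
      have u: "fst u \<in> I" "(fst u, 0) \<in> ?V" using that pos by auto
      then show ?thesis
        using same[OF u(2) that] by (simp add: \<sigma>_def)
    qed
    have \<gamma>_mem: "\<gamma> u \<in> ?V" if "u \<in> ?V" for u
      using permutes_in_image[OF perm] that by blast
    have zero: "(i, 0) \<in> ?V" if "i \<in> I" for i
      using that pos[OF that] by auto
    have "inj_on \<sigma> I"
    proof (rule inj_onI)
      fix i i' assume ii: "i \<in> I" "i' \<in> I" "\<sigma> i = \<sigma> i'"
      then show "i = i'"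
        using same[OF zero[OF ii(1)] zero[OF ii(2)]] by (simp add: \<sigma>_def)
    qed
    moreover have "\<sigma> ` I \<subseteq> I"
      using \<gamma>_mem[OF zero] by (fastforce simp: \<sigma>_def)
    ultimately have "bij_betw \<sigma> I I"
      using \<open>finite I\<close> endo_inj_surj[of I \<sigma>] by (simp add: bij_betw_def)
    then have perm\<sigma>: "\<sigma> permutes I"
      by (rule bij_imp_permutes) (simp add: \<sigma>_def)
    have img: "\<exists>B'\<in>\<B>. \<gamma> ` blk B = blk B' \<and> \<sigma> ` B = B'" if "B \<in> \<B>" for B
    proof (cases "B = {}")
      case True
      then show ?thesis using that by (intro bexI[of _ "{}"]) (auto simp: blk_def)
    next
      case False
      then have "\<gamma> ` blk B \<in> P" using P that by (auto simp: P_def)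
      then obtain B' where B': "B' \<in> \<B>" "\<gamma> ` blk B = blk B'" by (auto simp: P_def)
      have "\<sigma> ` B = \<sigma> ` fst ` blk B" by (simp add: fst_blk)
      also have "\<dots> = fst ` \<gamma> ` blk B"
        unfolding image_image using \<sigma>_fst blk_sub[OF that] by (intro image_cong refl) auto
      also have "\<dots> = B'" by (simp add: B' fst_blk)
      finally show ?thesis using B' by blast
    qed
    have "(`) \<sigma> ` \<B> \<subseteq> \<B>" using img by blast
    moreover have "inj_on ((`) \<sigma>) \<B>"
      using permutes_inj[OF perm\<sigma>] by (simp add: inj_on_def inj_image_eq_iff)
    ultimately have "(`) \<sigma> ` \<B> = \<B>"
      using finB by (simp add: endo_inj_surj)
    then have "\<sigma> = id"
      using rigid perm\<sigma> unfolding rigid_family_def by blast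
    have "\<gamma> u = u" for u
    proof (cases "u \<in> ?V")
      case True
      then obtain B where B: "B \<in> \<B>" "u \<in> blk B" using ex_blk by blast
      then have "\<gamma> u \<in> blk B"
        using img[OF B(1)] \<open>\<sigma> = id\<close> by auto
      moreover have "fst (\<gamma> u) = fst u"
        using \<sigma>_fst[OF True] \<open>\<sigma> = id\<close> by simp
      ultimately show ?thesis
        using B(2) by (simp add: mem_blk prod_eq_iff)
    next
      case False
      then show ?thesis by (rule permutes_not_in[OF perm])
    qed
    then show ?thesis by auto
  qed
  ultimately show ?thesis
    unfolding distinguishing_partition_def verts_complete_multipartite by blast
qed

text \<open>Two vertices of one part in the same block, or two blocks meeting the same parts, could
  be exchanged by a nontrivial automorphism that preserves the partition. Hence blocks are partial
  transversals and are determined by the parts they meet, which turns vertex counts into degrees and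
  lets every symmetry of the family lift to the vertices.\<close>

lemma rigid_family_of_distinguishing_partition:
  fixes n :: "'i \<Rightarrow> nat"
  assumes pos: "\<And>i. i \<in> I \<Longrightarrow> n i > 0"
    and dist: "distinguishing_partition (complete_multipartite I (\<lambda>i. {..<n i})) P"
  shows "\<exists>\<B>\<subseteq>Pow I. (\<forall>i\<in>I. card {B \<in> \<B>. i \<in> B} = n i) \<and> rigid_family I \<B>"
proof -
  let ?V = "Sigma I (\<lambda>i. {..<n i})"
  have part: "partition_on ?V P"
    using dist unfolding distinguishing_partition_def verts_complete_multipartite by (rule conjunct1)
  have rig: "\<gamma> = id" if "\<gamma> permutes ?V" "(\<lambda>B. \<gamma> ` B) ` P = P"
      "\<And>u v. u \<in> ?V \<Longrightarrow> v \<in> ?V \<Longrightarrow> fst (\<gamma> u) = fst (\<gamma> v) \<longleftrightarrow> fst u = fst v" for \<gamma>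
  proof (rule ccontr)
    assume "\<gamma> \<noteq> id"
    have "\<gamma> \<in> aut (complete_multipartite I (\<lambda>i. {..<n i}))"
      unfolding aut_complete_multipartite_iff using that by simp
    then show False
      using dist \<open>\<gamma> \<noteq> id\<close> that(2) unfolding distinguishing_partition_def by blast
  qed
  have PV: "Q \<subseteq> ?V" if "Q \<in> P" for Q
    using partition_onD1[OF part] that by auto
  have dis: "Q = Q'" if "Q \<in> P" "Q' \<in> P" "u \<in> Q" "u \<in> Q'" for Q Q' u
    using partition_onD2[OF part] that by (auto simp: disjoint_def)
  have ex: "\<exists>Q\<in>P. u \<in> Q" if "u \<in> ?V" for u
    using partition_onD1[OF part] that by auto
  have ex1: "\<exists>!Q. Q \<in> P \<and> u \<in> Q" if u: "u \<in> ?V" for u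
  proof -
    obtain Q where Q: "Q \<in> P" "u \<in> Q" using ex[OF u] by blast
    show ?thesis
    proof (rule ex1I[of _ Q])
      fix R assume "R \<in> P \<and> u \<in> R"
      then show "R = Q" using dis[of R Q u] Q by simp
    qed (simp add: Q)
  qed
  have inj_fst: "inj_on fst Q" if Q: "Q \<in> P" for Q
  proof (rule inj_onI, rule ccontr)
    fix u v assume uv: "u \<in> Q" "v \<in> Q" "fst u = fst v" "u \<noteq> v"
    let ?t = "transpose u v"
    have uvV: "u \<in> ?V" "v \<in> ?V" using PV[OF Q] uv by auto
    have "?t ` R = R" if "R \<in> P" for R
    proof (cases "R = Q")
      case True
      then show ?thesis using uv by (intro transpose_image_eq) simp
    next
      case False
      then have "u \<notin> R" "v \<notin> R" using dis[OF Q that] uv by blast+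
      then show ?thesis by (simp add: transpose_image_eq)
    qed
    then have "(\<lambda>B. ?t ` B) ` P = P" by auto
    moreover have "?t permutes ?V"
      using uvV by (rule permutes_swap_id)
    moreover have "fst (?t w) = fst w" for w
      using uv(3) by (auto simp: transpose_def)
    ultimately have "?t = id" by (intro rig) auto
    then show False using uv(4) by (metis id_apply transpose_apply_first)
  qed
  define \<B> where "\<B> = (\<lambda>Q. fst ` Q) ` P"
  have inj_P: "inj_on (\<lambda>Q. fst ` Q) P"
  proof (rule inj_onI, rule ccontr)
    fix Q Q' assume Q: "Q \<in> P" "Q' \<in> P" "fst ` Q = fst ` Q'" "Q \<noteq> Q'"
    have disj: "Q \<inter> Q' = {}" using dis Q by blast
    define f where "f = the_inv_into Q' fst"
    define g where "g = the_inv_into Q fst"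
    have f: "f (fst u) \<in> Q'" "fst (f (fst u)) = fst u" if "u \<in> Q" for u
    proof -
      have "fst u \<in> fst ` Q'" using that Q(3) by blast
      from the_inv_into_into[OF inj_fst[OF Q(2)] this order_refl] f_the_inv_into_f[OF inj_fst[OF Q(2)] this]
      show "f (fst u) \<in> Q'" "fst (f (fst u)) = fst u" by (simp_all add: f_def)
    qed
    have g: "g (fst u) \<in> Q" "fst (g (fst u)) = fst u" if "u \<in> Q'" for u
    proof -
      have "fst u \<in> fst ` Q" using that Q(3) by blast
      from the_inv_into_into[OF inj_fst[OF Q(1)] this order_refl] f_the_inv_into_f[OF inj_fst[OF Q(1)] this]
      show "g (fst u) \<in> Q" "fst (g (fst u)) = fst u" by (simp_all add: g_def)
    qed
    \<comment> \<open>\<open>\<gamma>\<close> exchanges \<open>Q\<close> and \<open>Q'\<close>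
      inside each part, so it is an automorphism.\<close>
    define \<gamma> where "\<gamma> u = (if u \<in> Q then f (fst u) else if u \<in> Q' then g (fst u) else u)" for u
    have fst\<gamma>: "fst (\<gamma> u) = fst u" for u
      using f g by (auto simp: \<gamma>_def)
    have inv: "\<gamma> (\<gamma> u) = u" for u
    proof -
      consider "u \<in> Q" | "u \<in> Q'" | "u \<notin> Q" "u \<notin> Q'" by blast
      then show ?thesis
      proof cases
        case 1
        then have m: "\<gamma> u \<in> Q'" using f by (simp add: \<gamma>_def)
        then have "\<gamma> u \<notin> Q" using disj by blast
        then have "\<gamma> (\<gamma> u) = g (fst (\<gamma> u))" using m by (subst \<gamma>_def) simp
        then have "\<gamma> (\<gamma> u) \<in> Q" using g(1)[OF m] by simp
        then show ?thesis
          using 1 inj_onD[OF inj_fst[OF Q(1)], of "\<gamma> (\<gamma> u)" u] fst\<gamma>[of "\<gamma> u"] fst\<gamma>[of u] by simp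
      next
        case 2
        then have "u \<notin> Q" using disj by blast
        then have "\<gamma> u = g (fst u)" using 2 by (subst \<gamma>_def) simp
        then have m: "\<gamma> u \<in> Q" using g(1)[OF 2] by simp
        then have "\<gamma> (\<gamma> u) = f (fst (\<gamma> u))" by (subst \<gamma>_def) simp
        then have "\<gamma> (\<gamma> u) \<in> Q'" using f(1)[OF m] by simp
        then show ?thesis
          using 2 inj_onD[OF inj_fst[OF Q(2)], of "\<gamma> (\<gamma> u)" u] fst\<gamma>[of "\<gamma> u"] fst\<gamma>[of u] by simp
      next
        case 3
        then show ?thesis by (simp add: \<gamma>_def)
      qed
    qed
    have \<gamma>1: "\<gamma> u \<in> Q'" if "u \<in> Q" for u
      using f(1)[OF that] that by (simp add: \<gamma>_def)
    have \<gamma>2: "\<gamma> u \<in> Q" if "u \<in> Q'" for u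
      using g(1)[OF that] that disj by (subst \<gamma>_def) auto
    have \<gamma>Q: "\<gamma> ` Q \<subseteq> Q'" "\<gamma> ` Q' \<subseteq> Q"
      using \<gamma>1 \<gamma>2 by blast+
    have \<gamma>\<gamma>: "\<gamma> ` \<gamma> ` R = R" for R
      by (simp only: image_image inv image_ident)
    have "Q' \<subseteq> \<gamma> ` Q"
      using image_mono[OF \<gamma>Q(2), of \<gamma>] by (simp only: \<gamma>\<gamma>)
    moreover have "Q \<subseteq> \<gamma> ` Q'"
      using image_mono[OF \<gamma>Q(1), of \<gamma>] by (simp only: \<gamma>\<gamma>)
    ultimately have \<gamma>Q_eq: "\<gamma> ` Q = Q'" "\<gamma> ` Q' = Q"
      using \<gamma>Q by (simp_all only: subset_antisym)
    have other: "\<gamma> ` R = R" if "R \<in> P" "R \<noteq> Q" "R \<noteq> Q'" for R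
    proof -
      have "\<gamma> u = u" if "u \<in> R" for u
        using dis[OF \<open>R \<in> P\<close> Q(1) that] dis[OF \<open>R \<in> P\<close> Q(2) that] \<open>R \<noteq> Q\<close> \<open>R \<noteq> Q'\<close>
        by (auto simp: \<gamma>_def)
      then show ?thesis by simp
    qed
    have "\<gamma> ` R \<in> P" if "R \<in> P" for R
      using \<gamma>Q_eq other[OF that] Q that by (cases "R = Q"; cases "R = Q'") auto
    then have sub: "(\<lambda>B. \<gamma> ` B) ` P \<subseteq> P" by blast
    have "(\<lambda>B. \<gamma> ` B) ` P = P"
    proof
      show "P \<subseteq> (\<lambda>B. \<gamma> ` B) ` P"
      proof
        fix R assume "R \<in> P"
        then have "\<gamma> ` R \<in> P" using sub by blast
        moreover have "\<gamma> ` \<gamma> ` R = R" by (simp add: image_image inv)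
        ultimately show "R \<in> (\<lambda>B. \<gamma> ` B) ` P" by (metis image_eqI)
      qed
    qed (rule sub)
    moreover have "\<gamma> permutes ?V"
    proof (rule involution_permutes[OF inv])
      show "\<gamma> u = u" if "u \<notin> ?V" for u
        using that PV Q by (auto simp: \<gamma>_def)
    qed
    ultimately have "\<gamma> = id" using fst\<gamma> by (intro rig) auto
    moreover have "Q \<noteq> {}" using Q(1) partition_onD3[OF part] by blast
    ultimately show False using \<gamma>Q(1) disj by auto
  qed
  have card: "card {B \<in> \<B>. i \<in> B} = n i" if "i \<in> I" for i
  proof -
    have iV: "(i, a) \<in> ?V \<longleftrightarrow> a < n i" for a using that by auto
    define h where "h a = (THE Q. Q \<in> P \<and> (i, a) \<in> Q)" for a
    have h: "h a \<in> P \<and> (i, a) \<in> h a" if "a < n i" for a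
      unfolding h_def by (rule theI'[OF ex1]) (simp only: iV that)
    have "inj_on h {..<n i}"
    proof (rule inj_onI)
      fix a b assume "a \<in> {..<n i}" "b \<in> {..<n i}" "h a = h b"
      then have "h a \<in> P" "(i, a) \<in> h a" "(i, b) \<in> h a" using h[of a] h[of b] by auto
      then show "a = b" using inj_onD[OF inj_fst, of "h a" "(i, a)" "(i, b)"] by auto
    qed
    moreover have "h ` {..<n i} = {Q \<in> P. i \<in> fst ` Q}"
    proof
      show "h ` {..<n i} \<subseteq> {Q \<in> P. i \<in> fst ` Q}" using h by force
      show "{Q \<in> P. i \<in> fst ` Q} \<subseteq> h ` {..<n i}"
      proof
        fix Q assume "Q \<in> {Q \<in> P. i \<in> fst ` Q}"
        then obtain a where a: "Q \<in> P" "(i, a) \<in> Q" by auto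
        then have "a < n i" using PV iV by blast
        with a dis[of "h a" Q "(i, a)"] h[of a] show "Q \<in> h ` {..<n i}" by auto
      qed
    qed
    ultimately have "card {Q \<in> P. i \<in> fst ` Q} = n i"
      by (metis card_image card_lessThan)
    moreover have "{B \<in> \<B>. i \<in> B} = (\<lambda>Q. fst ` Q) ` {Q \<in> P. i \<in> fst ` Q}"
      by (auto simp: \<B>_def)
    moreover have "inj_on (\<lambda>Q. fst ` Q) {Q \<in> P. i \<in> fst ` Q}"
      using inj_P by (rule inj_on_subset) auto
    ultimately show ?thesis by (simp add: card_image)
  qed
  have "rigid_family I \<B>"
    unfolding rigid_family_def
  proof (intro allI impI)
    fix \<sigma> assume perm: "\<sigma> permutes I" and \<sigma>: "(`) \<sigma> ` \<B> = \<B>"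
    have ex_img: "\<exists>Q'\<in>P. fst ` Q' = \<sigma> ` fst ` Q" if "Q \<in> P" for Q
    proof -
      have "\<sigma> ` fst ` Q \<in> (`) \<sigma> ` \<B>" using that by (simp add: \<B>_def)
      then have "\<sigma> ` fst ` Q \<in> \<B>" by (simp only: \<sigma>)
      then obtain Q' where "\<sigma> ` fst ` Q = fst ` Q'" "Q' \<in> P"
        unfolding \<B>_def by (rule imageE)
      then show ?thesis by (intro bexI[of _ Q']) simp_all
    qed
    then obtain F where F: "\<And>Q. Q \<in> P \<Longrightarrow> F Q \<in> P \<and> fst ` F Q = \<sigma> ` fst ` Q"
      by metis
    define blk where "blk u = (THE Q. Q \<in> P \<and> u \<in> Q)" for u
    have blk: "blk u \<in> P \<and> u \<in> blk u" if "u \<in> ?V" for u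
      unfolding blk_def by (rule theI'[OF ex1[OF that]])
    have blk_eq: "blk u = Q" if "Q \<in> P" "u \<in> Q" for u Q
      using blk[of u] dis[OF that(1) _ that(2)] PV[OF that(1)] that(2) by blast
    \<comment> \<open>The lift sends \<open>u\<close> to the only vertex of the image block that
      lies in part \<open>\<sigma> (fst u)\<close>.\<close>
    define \<gamma> where "\<gamma> u = (if u \<in> ?V then the_inv_into (F (blk u)) fst (\<sigma> (fst u)) else u)" for u
    have \<gamma>: "\<gamma> u \<in> F (blk u)" "fst (\<gamma> u) = \<sigma> (fst u)" if u: "u \<in> ?V" for u
    proof -
      have "blk u \<in> P" "u \<in> blk u" using blk[OF u] by auto
      then have m: "\<sigma> (fst u) \<in> fst ` F (blk u)" and F': "F (blk u) \<in> P"
        using F by auto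
      show "\<gamma> u \<in> F (blk u)"
        using u the_inv_into_into[OF inj_fst[OF F'] m order_refl] by (simp add: \<gamma>_def)
      show "fst (\<gamma> u) = \<sigma> (fst u)"
        using u f_the_inv_into_f[OF inj_fst[OF F'] m] by (simp add: \<gamma>_def)
    qed
    have injF: "Q = Q'" if "Q \<in> P" "Q' \<in> P" "F Q = F Q'" for Q Q'
    proof -
      have "\<sigma> ` fst ` Q = \<sigma> ` fst ` Q'" using F that by metis
      then have "fst ` Q = fst ` Q'" using permutes_inj[OF perm] by (simp add: inj_image_eq_iff)
      then show ?thesis using inj_P that by (auto dest: inj_onD)
    qed
    have inj: "inj_on \<gamma> ?V"
    proof (rule inj_onI)
      fix u v assume uv: "u \<in> ?V" "v \<in> ?V" "\<gamma> u = \<gamma> v"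
      have "F (blk u) = F (blk v)"
        using dis[of "F (blk u)" "F (blk v)" "\<gamma> u"] \<gamma>(1)[OF uv(1)] \<gamma>(1)[OF uv(2)] uv F blk by auto
      then have "blk u = blk v" using injF blk uv by blast
      moreover have "fst u = fst v"
        using \<gamma>(2) uv permutes_inj[OF perm] by (metis injD)
      ultimately show "u = v"
        using inj_onD[OF inj_fst, of "blk u" u v] blk uv by auto
    qed
    have \<gamma>_img: "\<gamma> ` Q = F Q" if Q: "Q \<in> P" for Q
    proof
      show "\<gamma> ` Q \<subseteq> F Q"
        using \<gamma>(1) blk_eq[OF Q] PV[OF Q] by fastforce
      show "F Q \<subseteq> \<gamma> ` Q"
      proof
        fix w assume w: "w \<in> F Q"
        then have "fst w \<in> \<sigma> ` fst ` Q" using conjunct2[OF F[OF Q]] by (metis image_eqI)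
        then obtain u where u: "u \<in> Q" "fst w = \<sigma> (fst u)" by auto
        have "u \<in> ?V" using u PV[OF Q] by auto
        then have "\<gamma> u \<in> F Q" "fst (\<gamma> u) = fst w" using \<gamma> blk_eq[OF Q u(1)] u by auto
        then have "\<gamma> u = w" using inj_onD[OF inj_fst, of "F Q" "\<gamma> u" w] F[OF Q] w by auto
        then show "w \<in> \<gamma> ` Q" using u by auto
      qed
    qed
    have sub: "(\<lambda>B. \<gamma> ` B) ` P \<subseteq> P" using \<gamma>_img F by auto
    have P: "(\<lambda>B. \<gamma> ` B) ` P = P"
    proof
      show "P \<subseteq> (\<lambda>B. \<gamma> ` B) ` P"
      proof
        fix R assume R: "R \<in> P"
        then have "fst ` R \<in> (`) \<sigma> ` \<B>" using \<sigma> by (auto simp: \<B>_def)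
        then obtain Q where Q: "Q \<in> P" "fst ` R = \<sigma> ` fst ` Q" by (auto simp: \<B>_def)
        then have "F Q = R" using inj_onD[OF inj_P, of "F Q" R] F R by auto
        then show "R \<in> (\<lambda>B. \<gamma> ` B) ` P" using \<gamma>_img Q by blast
      qed
    qed (rule sub)
    have "\<gamma> ` ?V = ?V"
      using P partition_onD1[OF part] by (metis image_Union)
    then have "\<gamma> permutes ?V"
      using inj by (intro bij_imp_permutes) (auto simp: bij_betw_def \<gamma>_def)
    then have "\<gamma> = id"
    proof (rule rig[OF _ P])
      show "fst (\<gamma> u) = fst (\<gamma> v) \<longleftrightarrow> fst u = fst v" if "u \<in> ?V" "v \<in> ?V" for u v
        using \<gamma>(2) that permutes_inj[OF perm] by (simp add: inj_eq)
    qed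
    have "\<sigma> i = i" for i
    proof (cases "i \<in> I")
      case True
      then have "(i, 0) \<in> ?V" using pos by auto
      from \<gamma>(2)[OF this] show ?thesis using \<open>\<gamma> = id\<close> by simp
    qed (use perm in \<open>auto simp: permutes_not_in\<close>)
    then show "\<sigma> = id" by auto
  qed
  moreover have "\<B> \<subseteq> Pow I" using PV by (fastforce simp: \<B>_def)
  ultimately show ?thesis using card by blast
qed

section \<open>Codes of trees\<close>

text \<open>\<open>Join c d\<close> hangs the rooted tree of \<open>d\<close> below the root of the
  tree of \<open>c\<close>, so the leaves of a code are the vertices of the tree. Reordering the
  children of a vertex changes the code; this is harmless, as only equal codes have to yield
  isomorphic trees.\<close>

datatype 'l code = Leaf 'l | Join "'l code" "'l code"

primrec leaves :: "'l code \<Rightarrow> nat" where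
  "leaves (Leaf a) = 1"
| "leaves (Join c d) = leaves c + leaves d"

primrec leaf_labels :: "'l code \<Rightarrow> 'l set" where
  "leaf_labels (Leaf a) = {a}"
| "leaf_labels (Join c d) = leaf_labels c \<union> leaf_labels d"

text \<open>Polish notation is prefix-free, so that counting codes reduces to counting words.\<close>

primrec polish :: "'l code \<Rightarrow> 'l option list" where
  "polish (Leaf a) = [Some a]"
| "polish (Join c d) = None # polish c @ polish d"

lemma length_polish: "length (polish c) < 2 * leaves c"
  by (induction c) auto

lemma set_polish: "set (polish c) \<subseteq> insert None (Some ` leaf_labels c)"
  by (induction c) auto

lemma polish_append_eq: "polish c @ xs = polish d @ ys \<Longrightarrow> c = d \<and> xs = ys"
proof (induction c arbitrary: d xs ys)
  case (Leaf a)
  then show ?case by (cases d) auto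
next
  case (Join c1 c2)
  show ?case
  proof (cases d)
    case (Join d1 d2)
    then have "polish c1 @ (polish c2 @ xs) = polish d1 @ (polish d2 @ ys)"
      using Join.prems by simp
    then have "c1 = d1 \<and> polish c2 @ xs = polish d2 @ ys"
      by (rule Join.IH(1))
    then show ?thesis
      using Join.IH(2)[of xs d2 ys] Join by simp
  qed (use Join.prems in simp)
qed

lemma inj_polish: "inj polish"
  by (metis injI polish_append_eq)

lemma finite_card_codes:
  assumes "finite A"
  shows "finite {c. leaf_labels c \<subseteq> A \<and> leaves c \<le> n}"
    and "card {c. leaf_labels c \<subseteq> A \<and> leaves c \<le> n} \<le> (card A + 2) ^ (2 * n)"
proof -
  let ?B = "insert None (Some ` A)"
  let ?L = "{xs. set xs \<subseteq> ?B \<and> length xs \<le> 2 * n}"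
  have fin: "finite ?L"
    using assms by (intro finite_lists_length_le) auto
  have sub: "polish ` {c. leaf_labels c \<subseteq> A \<and> leaves c \<le> n} \<subseteq> ?L"
  proof safe
    fix c x assume c: "leaf_labels c \<subseteq> A" "leaves c \<le> n"
    { assume "x \<in> set (polish c)" "x \<notin> Some ` A"
      then show "x = None" using c set_polish[of c] by blast }
    show "length (polish c) \<le> 2 * n"
      using c length_polish[of c] by linarith
  qed
  show "finite {c. leaf_labels c \<subseteq> A \<and> leaves c \<le> n}"
    using finite_subset[OF sub fin] by (rule finite_imageD) (rule inj_on_subset[OF inj_polish subset_UNIV])
  \<comment> \<open>The words of length at most \<open>m\<close> over \<open>q\<close> letters are
    bounded by the words of length \<open>m\<close> with one extra letter. This is why the base is
    \<open>card A + 2\<close>: the letter \<open>None\<close> already accounts for the first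
    additional 1.\<close>
  have sum: "(\<Sum>i\<le>m. q ^ i) \<le> (q + 1) ^ m" for q m :: nat
  proof (induction m)
    case (Suc m)
    have "q * q ^ m \<le> q * (q + 1) ^ m"
      by (intro mult_left_mono power_mono) auto
    from add_mono[OF Suc this] show ?case by simp
  qed simp
  have "card {c. leaf_labels c \<subseteq> A \<and> leaves c \<le> n} \<le> card ?L"
    by (rule card_inj_on_le[OF inj_on_subset[OF inj_polish subset_UNIV] sub fin])
  also have "\<dots> = (\<Sum>i\<le>2 * n. card ?B ^ i)"
    using assms by (intro card_lists_length_le) auto
  also have "card ?B = card A + 1"
    using assms by (simp add: card_image image_iff)
  also have "(\<Sum>i\<le>2 * n. (card A + 1) ^ i) \<le> (card A + 2) ^ (2 * n)"
    using sum[of "card A + 1" "2 * n"] by simp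
  finally show "card {c. leaf_labels c \<subseteq> A \<and> leaves c \<le> n} \<le> (card A + 2) ^ (2 * n)" .
qed

section \<open>Trees in a graph and their rooted codes\<close>

text \<open>This says that the subgraph induced on the set is a tree. Joining at arbitrary vertices
  is the form that arises when an edge is added to a forest; since \<open>E\<close> is any set of
  sets, a loop has to be excluded explicitly.\<close>

inductive tree_on :: "'v set set \<Rightarrow> 'v set \<Rightarrow> bool" for E where
  single: "{v} \<notin> E \<Longrightarrow> tree_on E {v}"
| join: "tree_on E S \<Longrightarrow> tree_on E T \<Longrightarrow> S \<inter> T = {} \<Longrightarrow> v \<in> S \<Longrightarrow> w \<in> T \<Longrightarrow>
    (\<And>a b. a \<in> S \<Longrightarrow> b \<in> T \<Longrightarrow> {a, b} \<in> E \<longleftrightarrow> a = v \<and> b = w) \<Longrightarrow> tree_on E (S \<union> T)"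

text \<open>Here the joining edge must run between the two roots, so that a code leaves no freedom
  for the position of that edge.\<close>

inductive rooted_code :: "'v set set \<Rightarrow> ('v \<Rightarrow> 'l) \<Rightarrow> 'v set \<Rightarrow> 'v \<Rightarrow> 'l code \<Rightarrow> bool"
  for E lab where
  single: "{v} \<notin> E \<Longrightarrow> rooted_code E lab {v} v (Leaf (lab v))"
| join: "rooted_code E lab S v c \<Longrightarrow> rooted_code E lab T w d \<Longrightarrow> S \<inter> T = {} \<Longrightarrow>
    (\<And>a b. a \<in> S \<Longrightarrow> b \<in> T \<Longrightarrow> {a, b} \<in> E \<longleftrightarrow> a = v \<and> b = w) \<Longrightarrow>
    rooted_code E lab (S \<union> T) v (Join c d)"

lemma rooted_code_facts:
  assumes "rooted_code E lab S v c"
  shows "v \<in> S" "finite S" "leaves c = card S" "leaf_labels c = lab ` S"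
proof -
  have "v \<in> S \<and> finite S \<and> leaves c = card S \<and> leaf_labels c = lab ` S"
    using assms by induction (auto simp: card_Un_disjoint)
  then show "v \<in> S" "finite S" "leaves c = card S" "leaf_labels c = lab ` S"
    by auto
qed

lemma tree_on_nonempty: "tree_on E S \<Longrightarrow> S \<noteq> {}"
  by (induction rule: tree_on.induct) auto

lemma tree_on_cong:
  assumes "tree_on E S" "\<And>e. e \<subseteq> S \<Longrightarrow> e \<in> E \<longleftrightarrow> e \<in> E'"
  shows "tree_on E' S"
  using assms
proof (induction rule: tree_on.induct)
  case (single v)
  then show ?case by (intro tree_on.single) auto
next
  case (join S T v w)
  show ?case
  proof (rule tree_on.join[of _ S T v w])
    fix a b assume "a \<in> S" "b \<in> T"
    then show "{a, b} \<in> E' \<longleftrightarrow> a = v \<and> b = w"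
      using join.hyps(6)[of a b] join.prems[of "{a, b}"] by auto
  next
    show "tree_on E' S" "tree_on E' T"
      using join.IH join.prems by (meson le_supI1 le_supI2)+
  qed (use join.hyps in auto)
qed

lemma tree_on_connected:
  assumes "tree_on E S" "\<And>e. e \<in> E \<Longrightarrow> e \<subseteq> S \<Longrightarrow> e \<inter> U \<noteq> {} \<Longrightarrow> e \<subseteq> U" "S \<inter> U \<noteq> {}"
  shows "S \<subseteq> U"
  using assms
proof (induction rule: tree_on.induct)
  case (join S T v w)
  have vw: "{v, w} \<in> E"
    using join.hyps(4-6) by blast
  have iff: "v \<in> U \<longleftrightarrow> w \<in> U"
    using join.prems(1)[OF vw] join.hyps(4,5) by auto
  have S: "S \<subseteq> U" if "S \<inter> U \<noteq> {}"
    using join.IH(1)[OF _ that] join.prems(1) by (meson le_supI1)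
  have T: "T \<subseteq> U" if "T \<inter> U \<noteq> {}"
    using join.IH(2)[OF _ that] join.prems(1) by (meson le_supI2)
  show ?case
    using S T iff join.hyps(4,5) join.prems(2) by blast
qed auto

text \<open>The new edge may start at any vertex \<open>v\<close>, whereas codes join at roots only.
  Descending into the half that contains \<open>v\<close> reaches a one-vertex tree, where
  \<open>v\<close> is the root and a join is possible; the outer joins are rebuilt around
  it.\<close>

lemma rooted_code_attach:
  assumes "rooted_code E lab S u c" "rooted_code E lab T w d" "S \<inter> T = {}" "v \<in> S"
    and "\<And>a b. a \<in> S \<Longrightarrow> b \<in> T \<Longrightarrow> {a, b} \<in> E \<longleftrightarrow> a = v \<and> b = w"
  shows "\<exists>c'. rooted_code E lab (S \<union> T) u c'"
  using assms
proof (induction rule: rooted_code.induct)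
  case (single u)
  then have "rooted_code E lab ({u} \<union> T) u (Join (Leaf (lab u)) d)"
    by (intro rooted_code.join[where w = w]) (auto intro: rooted_code.single)
  then show ?case ..
next
  case (join A a ca B b cb)
  note w = rooted_code_facts(1)[OF \<open>rooted_code E lab T w d\<close>]
  show ?case
  proof (cases "v \<in> A")
    case True
    have "\<exists>c'. rooted_code E lab (A \<union> T) a c'"
      using join.prems True by (intro join.IH(1)) auto
    then obtain c' where c': "rooted_code E lab (A \<union> T) a c'" ..
    have "rooted_code E lab ((A \<union> T) \<union> B) a (Join c' cb)"
    proof (rule rooted_code.join[OF c' join.hyps(2)])
      show "(A \<union> T) \<inter> B = {}"
        using join.prems(2) join.hyps(3) by blast
      fix x y assume xy: "x \<in> A \<union> T" "y \<in> B"
      show "{x, y} \<in> E \<longleftrightarrow> x = a \<and> y = b"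
      proof (cases "x \<in> A")
        case True
        then show ?thesis using join.hyps(4) xy by auto
      next
        case F: False
        then have "{y, x} \<notin> E"
          using join.prems(4)[of y x] xy True join.hyps(3) by auto
        moreover have "x \<noteq> a"
          using F rooted_code_facts(1)[OF join.hyps(1)] by auto
        ultimately show ?thesis by (simp add: insert_commute)
      qed
    qed
    then show ?thesis by (metis Un_assoc Un_commute)
  next
    case False
    then have vB: "v \<in> B" using join.prems by auto
    have "\<exists>c'. rooted_code E lab (B \<union> T) b c'"
      using join.prems vB by (intro join.IH(2)) auto
    then obtain c' where c': "rooted_code E lab (B \<union> T) b c'" ..
    have "rooted_code E lab (A \<union> (B \<union> T)) a (Join ca c')"
    proof (rule rooted_code.join[OF join.hyps(1) c'])
      show "A \<inter> (B \<union> T) = {}"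
        using join.prems(2) join.hyps(3) by blast
      fix x y assume xy: "x \<in> A" "y \<in> B \<union> T"
      show "{x, y} \<in> E \<longleftrightarrow> x = a \<and> y = b"
      proof (cases "y \<in> B")
        case True
        then show ?thesis using join.hyps(4) xy by auto
      next
        case F: False
        then have "{x, y} \<notin> E"
          using join.prems(4)[of x y] xy False by auto
        moreover have "y \<noteq> b"
          using F rooted_code_facts(1)[OF join.hyps(2)] by auto
        ultimately show ?thesis by simp
      qed
    qed
    then show ?thesis by (metis Un_assoc)
  qed
qed

text \<open>The half containing \<open>u\<close> is coded from \<open>u\<close>, the other one from
  its end of the joining edge, and the second is attached to the first.\<close>

lemma tree_on_imp_rooted_code:
  assumes "tree_on E S" "u \<in> S"
  shows "\<exists>c. rooted_code E lab S u c"
  using assms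
proof (induction arbitrary: u rule: tree_on.induct)
  case (single v)
  then show ?case by (auto intro: rooted_code.single)
next
  case (join S T v w)
  show ?case
  proof (cases "u \<in> S")
    case True
    then obtain c d where "rooted_code E lab S u c" "rooted_code E lab T w d"
      using join by blast
    then show ?thesis
      using join.hyps by (intro rooted_code_attach) auto
  next
    case False
    then obtain c d where cd: "rooted_code E lab T u c" "rooted_code E lab S v d"
      using join by blast
    have "\<exists>c'. rooted_code E lab (T \<union> S) u c'"
    proof (rule rooted_code_attach[OF cd])
      fix a b assume "a \<in> T" "b \<in> S"
      then show "{a, b} \<in> E \<longleftrightarrow> a = w \<and> b = v"
        using join.hyps(6)[of b a] by (auto simp: insert_commute)
    qed (use join.hyps in auto)
    then show ?thesis by (simp add: Un_commute)
  qed
qed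

text \<open>By inversion both trees split in the same way, and the only edge between the halves
  connects the roots; isomorphisms of the halves that respect roots therefore glue.\<close>

lemma rooted_code_iso:
  assumes "rooted_code E lab S v c" "rooted_code E lab S' v' c"
  shows "\<exists>f. bij_betw f S S' \<and> f v = v' \<and> (\<forall>a\<in>S. lab (f a) = lab a) \<and>
    (\<forall>a\<in>S. \<forall>b\<in>S. {f a, f b} \<in> E \<longleftrightarrow> {a, b} \<in> E)"
  using assms
proof (induction arbitrary: S' v' rule: rooted_code.induct)
  case (single v)
  from single.prems single.hyps show ?case
    by cases (auto intro!: exI[of _ "\<lambda>_. v'"])
next
  case (join S v c T w d)
  from join.prems obtain S1 T1 w1 where S': "S' = S1 \<union> T1" "rooted_code E lab S1 v' c"
    "rooted_code E lab T1 w1 d" "S1 \<inter> T1 = {}"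
    and E1: "\<And>a b. a \<in> S1 \<Longrightarrow> b \<in> T1 \<Longrightarrow> {a, b} \<in> E \<longleftrightarrow> a = v' \<and> b = w1"
    by cases blast
  from join.IH(1)[OF S'(2)] obtain f where f: "bij_betw f S S1" "f v = v'"
    "\<forall>a\<in>S. lab (f a) = lab a" "\<forall>a\<in>S. \<forall>b\<in>S. {f a, f b} \<in> E \<longleftrightarrow> {a, b} \<in> E" by blast
  from join.IH(2)[OF S'(3)] obtain g where g: "bij_betw g T T1" "g w = w1"
    "\<forall>a\<in>T. lab (g a) = lab a" "\<forall>a\<in>T. \<forall>b\<in>T. {g a, g b} \<in> E \<longleftrightarrow> {a, b} \<in> E" by blast
  define h where "h x = (if x \<in> S then f x else g x)" for x
  have hS: "h x = f x" if "x \<in> S" for x using that by (simp add: h_def)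
  have hT: "h x = g x" if "x \<in> T" for x using that join.hyps(3) by (auto simp: h_def)
  have "bij_betw h (S \<union> T) (S1 \<union> T1)"
    using f(1) g(1) S'(4) hS hT by (intro bij_betw_combine) (auto cong: bij_betw_cong)
  moreover have "h v = v'"
    using rooted_code_facts(1)[OF join.hyps(1)] hS f(2) by simp
  moreover have "\<forall>a\<in>S \<union> T. lab (h a) = lab a"
    using f(3) g(3) hS hT by auto
  moreover have cross: "{h a, h b} \<in> E \<longleftrightarrow> {a, b} \<in> E" if ab: "a \<in> S" "b \<in> T" for a b
  proof -
    have "f a \<in> S1" "g b \<in> T1"
      using f(1) g(1) ab by (auto simp: bij_betw_def)
    then have "{h a, h b} \<in> E \<longleftrightarrow> f a = v' \<and> g b = w1"
      using E1 hS[OF ab(1)] hT[OF ab(2)] by simp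
    also have "\<dots> \<longleftrightarrow> a = v \<and> b = w"
      using ab f g rooted_code_facts(1)[OF join.hyps(1)] rooted_code_facts(1)[OF join.hyps(2)]
      by (auto simp: bij_betw_def inj_on_def)
    also have "\<dots> \<longleftrightarrow> {a, b} \<in> E"
      using join.hyps(4)[OF ab] by simp
    finally show ?thesis .
  qed
  have "{h a, h b} \<in> E \<longleftrightarrow> {a, b} \<in> E" if "a \<in> S \<union> T" "b \<in> S \<union> T" for a b
    using that cross[of a b] cross[of b a] f(4) g(4) hS hT by (auto simp: insert_commute)
  ultimately show ?case
    using S'(1) by blast
qed

text \<open>Induction on the edges: a new edge either merges two of the trees or spoils at most one of
  them, so it costs at most one tree.\<close>

lemma forest_lemma:
  assumes "finite V" "finite E" "\<And>e. e \<in> E \<Longrightarrow> \<exists>u\<in>V. \<exists>v\<in>V. u \<noteq> v \<and> e = {u, v}"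
  shows "\<exists>\<G>. disjoint \<G> \<and> finite \<G> \<and> \<Union>\<G> \<subseteq> V \<and>
    (\<forall>C\<in>\<G>. tree_on E C \<and> (\<forall>e\<in>E. e \<inter> C \<noteq> {} \<longrightarrow> e \<subseteq> C)) \<and> card V \<le> card \<G> + card E"
  using assms(2,3)
proof (induction rule: finite_induct)
  case empty
  let ?G = "(\<lambda>v. {v}) ` V"
  have "card ?G = card V"
    by (simp add: card_image)
  then show ?case
    using \<open>finite V\<close> by (intro exI[of _ ?G]) (auto simp: disjoint_def intro: tree_on.single)
next
  case (insert e E)
  have "\<exists>\<G>. disjoint \<G> \<and> finite \<G> \<and> \<Union>\<G> \<subseteq> V \<and>
    (\<forall>C\<in>\<G>. tree_on E C \<and> (\<forall>e\<in>E. e \<inter> C \<noteq> {} \<longrightarrow> e \<subseteq> C)) \<and> card V \<le> card \<G> + card E"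
    using insert.prems by (intro insert.IH) auto
  then obtain \<G> where "disjoint \<G> \<and> finite \<G> \<and> \<Union>\<G> \<subseteq> V \<and>
    (\<forall>C\<in>\<G>. tree_on E C \<and> (\<forall>e\<in>E. e \<inter> C \<noteq> {} \<longrightarrow> e \<subseteq> C)) \<and> card V \<le> card \<G> + card E" ..
  then have G: "disjoint \<G>" "finite \<G>" "\<Union>\<G> \<subseteq> V" "card V \<le> card \<G> + card E"
    and tree: "\<And>C. C \<in> \<G> \<Longrightarrow> tree_on E C"
    and closed: "\<And>C f. C \<in> \<G> \<Longrightarrow> f \<in> E \<Longrightarrow> f \<inter> C \<noteq> {} \<Longrightarrow> f \<subseteq> C" by simp_all
  obtain u v where uv: "u \<in> V" "v \<in> V" "u \<noteq> v" "e = {u, v}"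
    using insert.prems by blast
  have dis: "C \<inter> D = {}" if "C \<in> \<G>" "D \<in> \<G>" "C \<noteq> D" for C D
    using G(1) that by (auto simp: disjoint_def)
  have keep: "tree_on (insert e E) C \<and> (\<forall>f\<in>insert e E. f \<inter> C \<noteq> {} \<longrightarrow> f \<subseteq> C)"
    if "C \<in> \<G>" "u \<notin> C" "v \<notin> C" for C
    using tree[OF that(1)] closed[OF that(1)] that uv(4)
    by (auto intro: tree_on_cong)
  show ?case
  proof (cases "\<exists>C D. C \<in> \<G> \<and> D \<in> \<G> \<and> u \<in> C \<and> v \<in> D \<and> C \<noteq> D")
    case True
    then obtain C D where CD: "C \<in> \<G>" "D \<in> \<G>" "u \<in> C" "v \<in> D" "C \<noteq> D" by blast
    let ?G = "insert (C \<union> D) (\<G> - {C, D})"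
    have CDi: "C \<inter> D = {}" using dis CD by auto
    have "tree_on (insert e E) (C \<union> D)"
    proof (rule tree_on.join[of _ C D u v])
      have "v \<notin> C" "u \<notin> D"
        using CDi CD(3,4) by auto
      then have "\<not> e \<subseteq> C" "\<not> e \<subseteq> D"
        using uv(4) by auto
      then show "tree_on (insert e E) C" "tree_on (insert e E) D"
        using tree_on_cong[OF tree[OF CD(1)], of "insert e E"]
          tree_on_cong[OF tree[OF CD(2)], of "insert e E"] by blast+
      fix a b assume ab: "a \<in> C" "b \<in> D"
      have "{a, b} \<notin> E"
        using closed[OF CD(1), of "{a, b}"] ab CDi by auto
      moreover have "{a, b} = e \<longleftrightarrow> a = u \<and> b = v"
        using ab CD(3,4) CDi uv(4) by (auto simp: doubleton_eq_iff)
      ultimately show "{a, b} \<in> insert e E \<longleftrightarrow> a = u \<and> b = v" by simp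
    qed (use CD CDi in auto)
    moreover have "\<forall>f\<in>insert e E. f \<inter> (C \<union> D) \<noteq> {} \<longrightarrow> f \<subseteq> C \<union> D"
      using closed CD uv(4) by blast
    moreover have "B \<in> \<G> - {C, D} \<Longrightarrow> u \<notin> B \<and> v \<notin> B" for B
      using dis CD by blast
    moreover have "disjoint ?G"
    proof (rule disjointI)
      fix A B assume AB: "A \<in> ?G" "B \<in> ?G" "A \<noteq> B"
      have out: "(C \<union> D) \<inter> M = {}" if "M \<in> \<G> - {C, D}" for M
        using dis[of C M] dis[of D M] that CD(1,2) by auto
      show "A \<inter> B = {}"
      proof (cases "A = C \<union> D \<or> B = C \<union> D")
        case True
        then show ?thesis using out AB by (metis Int_commute insertE)
      next
        case False
        then show ?thesis using AB dis by simp
      qed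
    qed
    moreover have "C \<union> D \<notin> \<G> - {C, D}"
      using dis[of C "C \<union> D"] CD by auto
    then have "card ?G = card \<G> - 2 + 1"
      using CD G(2) by (simp add: card_Diff_subset)
    moreover have "card \<G> \<ge> 2"
      using card_mono[OF G(2), of "{C, D}"] CD by auto
    ultimately show ?thesis
      using G(2,3,4) CD keep insert.hyps by (intro exI[of _ ?G]) auto
  next
    case False
    \<comment> \<open>No two different trees contain \<open>u\<close> and \<open>v\<close>
      respectively, so at most one tree meets the new edge. It is dropped: either the edge closes a
      cycle in it, or the other end lies among vertices already given up.\<close>
    let ?G = "{C \<in> \<G>. u \<notin> C \<and> v \<notin> C}"
    have "\<exists>B. \<G> - ?G \<subseteq> {B}"
    proof (cases "\<exists>B. B \<in> \<G> \<and> (u \<in> B \<or> v \<in> B)")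
      case True
      then obtain B where B: "B \<in> \<G>" "u \<in> B \<or> v \<in> B" by blast
      have "C = B" if "C \<in> \<G>" "u \<in> C \<or> v \<in> C" for C
        using False B that dis[of B C] by blast
      then show ?thesis by blast
    qed auto
    then obtain B where B: "\<G> - ?G \<subseteq> {B}" ..
    have "\<G> \<subseteq> insert B ?G" using B by blast
    then have "card \<G> \<le> card (insert B ?G)"
      using G(2) by (intro card_mono) auto
    also have "\<dots> \<le> card ?G + 1"
      using G(2) by (simp add: card_insert_if)
    finally have "card V \<le> card ?G + card (insert e E)"
      using G(4) insert.hyps by simp
    moreover have "disjoint ?G"
      using G(1) by (auto simp: disjoint_def)
    ultimately show ?thesis
      using G(2,3) keep by (intro exI[of _ ?G]) auto
  qed
qed

section \<open>Separating small and large parts\<close>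

text \<open>A pair \<open>(D, T)\<close> stands for a block of the partition: \<open>D\<close> is the set of parts of size \<open>n1\<close> and
  \<open>T\<close> the set of parts of size \<open>n2\<close> that it meets. In a distinguishing partition a block meets every
  part at most once and distinct blocks meet distinct sets of parts.\<close>

definition pair_conf :: "nat \<Rightarrow> nat \<Rightarrow> nat \<Rightarrow> nat \<Rightarrow> (nat set \<times> nat set) set \<Rightarrow> bool" where
  "pair_conf m1 n1 m2 n2 \<C> \<longleftrightarrow>
     \<C> \<subseteq> Pow {..<m1} \<times> Pow {..<m2} \<and>
     (\<forall>e<m1. card {c \<in> \<C>. e \<in> fst c} = n1) \<and> (\<forall>i<m2. card {c \<in> \<C>. i \<in> snd c} = n2) \<and>
     (\<forall>\<sigma> \<pi>. \<sigma> permutes {..<m1} \<longrightarrow> \<pi> permutes {..<m2} \<longrightarrow>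
        map_prod ((`) \<sigma>) ((`) \<pi>) ` \<C> = \<C> \<longrightarrow> \<sigma> = id \<and> \<pi> = id)"

lemma pair_conf_finite: "pair_conf m1 n1 m2 n2 \<C> \<Longrightarrow> finite \<C>"
  unfolding pair_conf_def by (meson finite_Pow_iff finite_SigmaI finite_lessThan finite_subset)

lemma pair_conf_sub:
  assumes "pair_conf m1 n1 m2 n2 \<C>" "c \<in> \<C>"
  shows "fst c \<subseteq> {..<m1}" "snd c \<subseteq> {..<m2}"
proof -
  have "c \<in> Pow {..<m1} \<times> Pow {..<m2}"
    using assms unfolding pair_conf_def by blast
  then show "fst c \<subseteq> {..<m1}" "snd c \<subseteq> {..<m2}"
    by (simp_all add: mem_Times_iff)
qed

lemma inj_map_prod_image:
  assumes "inj \<sigma>" "inj \<pi>"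
  shows "inj (map_prod ((`) \<sigma>) ((`) \<pi>))"
  using assms by (intro prod.inj_map) (simp_all add: inj_def inj_image_eq_iff)

text \<open>A finite family mapped into itself by an injection is mapped onto itself, so it is
  enough to check that pairs go to pairs.\<close>

lemma pair_conf_rigid:
  assumes "pair_conf m1 n1 m2 n2 \<C>" "\<sigma> permutes {..<m1}" "\<pi> permutes {..<m2}"
    and "\<And>c. c \<in> \<C> \<Longrightarrow> (\<sigma> ` fst c, \<pi> ` snd c) \<in> \<C>"
  shows "\<sigma> = id" "\<pi> = id"
proof -
  have "map_prod ((`) \<sigma>) ((`) \<pi>) ` \<C> \<subseteq> \<C>"
    using assms(4) by force
  then have "map_prod ((`) \<sigma>) ((`) \<pi>) ` \<C> = \<C>"
    using inj_map_prod_image[OF permutes_inj[OF assms(2)] permutes_inj[OF assms(3)]]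
      pair_conf_finite[OF assms(1)]
    by (intro endo_inj_surj) (auto intro: inj_on_subset)
  then have "\<sigma> = id \<and> \<pi> = id"
    using assms(1-3) unfolding pair_conf_def by blast
  then show "\<sigma> = id" "\<pi> = id" by auto
qed

lemma K_mult_eq:
  "K_mult m1 n1 m2 n2 =
     complete_multipartite {..<m1 + m2} (\<lambda>i. {..<(if i < m1 then n1 else n2)})"
proof -
  have "(\<lambda>i. if i < m1 then {..<n1} else {..<n2}) = (\<lambda>i. {..<(if i < m1 then n1 else n2)})"
    by (intro ext) simp
  then show ?thesis unfolding K_mult_def by simp
qed

text \<open>Each set of parts is split at \<open>m1\<close>. Permutations \<open>\<sigma>\<close>
  and \<open>\<pi>\<close> of the two sides glue to one permutation \<open>\<tau>\<close> of all
  parts, so rigidity under all permutations includes rigidity under these pairs.\<close>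

lemma pair_conf_of_distinguishing_partition:
  assumes "n1 > 0" "n2 > 0" "distinguishing_partition (K_mult m1 n1 m2 n2) P"
  shows "\<exists>\<C>. pair_conf m1 n1 m2 n2 \<C>"
proof -
  let ?n = "\<lambda>i. if i < m1 then n1 else n2"
  have "\<exists>\<B>\<subseteq>Pow {..<m1 + m2}. (\<forall>i\<in>{..<m1 + m2}. card {B \<in> \<B>. i \<in> B} = ?n i) \<and>
      rigid_family {..<m1 + m2} \<B>"
    using assms(3) unfolding K_mult_eq
    by (rule rigid_family_of_distinguishing_partition[rotated]) (use assms(1,2) in simp)
  then obtain \<B> where B: "\<B> \<subseteq> Pow {..<m1 + m2}"
      "\<And>i. i < m1 + m2 \<Longrightarrow> card {B \<in> \<B>. i \<in> B} = ?n i"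
    and rigid: "rigid_family {..<m1 + m2} \<B>"
    by (elim exE conjE) simp
  define sp where "sp B = (B \<inter> {..<m1}, {i. m1 + i \<in> B})" for B
  have inj_sp: "B = B'" if "sp B = sp B'" for B B'
  proof (intro set_eqI)
    fix p
    have 1: "B \<inter> {..<m1} = B' \<inter> {..<m1}" and 2: "{i. m1 + i \<in> B} = {i. m1 + i \<in> B'}"
      using that by (simp_all add: sp_def)
    show "p \<in> B \<longleftrightarrow> p \<in> B'"
    proof (cases "p < m1")
      case True
      then show ?thesis using 1 by auto
    next
      case False
      then have "p = m1 + (p - m1)" by simp
      then show ?thesis using 2 by (metis mem_Collect_eq)
    qed
  qed
  have inj: "inj_on sp A" for A using inj_sp by (auto intro: inj_onI)
  have "pair_conf m1 n1 m2 n2 (sp ` \<B>)"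
    unfolding pair_conf_def
  proof (intro conjI allI impI)
    show "sp ` \<B> \<subseteq> Pow {..<m1} \<times> Pow {..<m2}"
      using B(1) by (fastforce simp: sp_def)
  next
    fix e assume "e < m1"
    then have "e \<in> fst (sp B) \<longleftrightarrow> e \<in> B" for B by (simp add: sp_def)
    moreover have "{c \<in> sp ` \<B>. e \<in> fst c} = sp ` {B \<in> \<B>. e \<in> fst (sp B)}" by blast
    ultimately have "{c \<in> sp ` \<B>. e \<in> fst c} = sp ` {B \<in> \<B>. e \<in> B}" by simp
    then show "card {c \<in> sp ` \<B>. e \<in> fst c} = n1"
      using B(2)[of e] \<open>e < m1\<close> inj by (simp add: card_image)
  next
    fix i assume "i < m2"
    have "i \<in> snd (sp B) \<longleftrightarrow> m1 + i \<in> B" for B by (simp add: sp_def)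
    moreover have "{c \<in> sp ` \<B>. i \<in> snd c} = sp ` {B \<in> \<B>. i \<in> snd (sp B)}" by blast
    ultimately have "{c \<in> sp ` \<B>. i \<in> snd c} = sp ` {B \<in> \<B>. m1 + i \<in> B}" by simp
    then show "card {c \<in> sp ` \<B>. i \<in> snd c} = n2"
      using B(2)[of "m1 + i"] \<open>i < m2\<close> inj by (simp add: card_image)
  next
    fix \<sigma> \<pi>
    assume \<sigma>: "\<sigma> permutes {..<m1}" and \<pi>: "\<pi> permutes {..<m2}"
      and eq: "map_prod ((`) \<sigma>) ((`) \<pi>) ` sp ` \<B> = sp ` \<B>"
    define \<tau> where "\<tau> p = (if p < m1 then \<sigma> p else m1 + \<pi> (p - m1))" for p
    have \<sigma>lt: "\<sigma> p < m1 \<longleftrightarrow> p < m1" for p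
      using permutes_in_image[OF \<sigma>, of p] by simp
    have \<tau>lt: "\<tau> p < m1 \<longleftrightarrow> p < m1" for p
      using \<sigma>lt by (simp add: \<tau>_def)
    have inj\<tau>: "inj \<tau>"
    proof (rule injI)
      fix p q assume pq: "\<tau> p = \<tau> q"
      then have iff: "p < m1 \<longleftrightarrow> q < m1" using \<tau>lt by metis
      show "p = q"
      proof (cases "p < m1")
        case True
        then show ?thesis using pq iff permutes_inj[OF \<sigma>] by (simp add: \<tau>_def inj_eq)
      next
        case False
        then have "p - m1 = q - m1"
          using pq iff permutes_inj[OF \<pi>] by (simp add: \<tau>_def inj_eq)
        then show ?thesis using False iff by simp
      qed
    qed
    have out: "\<tau> p = p" if "p \<notin> {..<m1 + m2}" for p
      using that permutes_not_in[OF \<pi>, of "p - m1"] by (simp add: \<tau>_def)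
    have "\<tau> p < m1 + m2" if "p < m1 + m2" for p
    proof (cases "p < m1")
      case True
      then show ?thesis using \<tau>lt[of p] by simp
    next
      case False
      then have "\<pi> (p - m1) < m2"
        using permutes_in_image[OF \<pi>, of "p - m1"] that by auto
      then show ?thesis using False by (simp add: \<tau>_def)
    qed
    then have "\<tau> ` {..<m1 + m2} \<subseteq> {..<m1 + m2}" by auto
    then have "\<tau> ` {..<m1 + m2} = {..<m1 + m2}"
      using inj\<tau> by (intro endo_inj_surj) (auto intro: inj_on_subset)
    then have perm: "\<tau> permutes {..<m1 + m2}"
      using inj\<tau> out by (intro bij_imp_permutes) (auto simp: bij_betw_def intro: inj_on_subset)
    have sp\<tau>: "sp (\<tau> ` B) = map_prod ((`) \<sigma>) ((`) \<pi>) (sp B)" for B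
    proof -
      have "\<tau> ` B \<inter> {..<m1} = \<sigma> ` (B \<inter> {..<m1})"
        using \<tau>lt \<sigma>lt by (auto simp: \<tau>_def image_iff)
      moreover have "{i. m1 + i \<in> \<tau> ` B} = \<pi> ` {i. m1 + i \<in> B}"
      proof (intro set_eqI iffI)
        fix i assume "i \<in> {i. m1 + i \<in> \<tau> ` B}"
        then obtain p where p: "p \<in> B" "m1 + i = \<tau> p" by auto
        then have "\<not> p < m1" using \<tau>lt[of p] by auto
        then have "i = \<pi> (p - m1)" "m1 + (p - m1) \<in> B" using p by (auto simp: \<tau>_def)
        then show "i \<in> \<pi> ` {i. m1 + i \<in> B}" by blast
      next
        fix i assume "i \<in> \<pi> ` {i. m1 + i \<in> B}"
        then obtain h where h: "m1 + h \<in> B" "i = \<pi> h" by auto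
        then have "m1 + i = \<tau> (m1 + h)" by (simp add: \<tau>_def)
        then show "i \<in> {i. m1 + i \<in> \<tau> ` B}" using h by blast
      qed
      ultimately show ?thesis by (simp add: sp_def)
    qed
    have "sp ` (`) \<tau> ` \<B> = sp ` \<B>"
      using eq by (simp add: image_image sp\<tau>)
    then have "(`) \<tau> ` \<B> = \<B>"
      using inj[of UNIV] by (simp add: inj_image_eq_iff)
    then have id: "\<tau> = id" using rigid perm unfolding rigid_family_def by blast
    have "\<sigma> p = p" for p
    proof (cases "p < m1")
      case True
      then show ?thesis using fun_cong[OF id, of p] by (simp add: \<tau>_def)
    qed (use \<sigma> in \<open>simp add: permutes_not_in\<close>)
    moreover have "\<pi> p = p" for p
      using fun_cong[OF id, of "m1 + p"] by (simp add: \<tau>_def)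
    ultimately show "\<sigma> = id" "\<pi> = id" by auto
  qed
  then show ?thesis by blast
qed

text \<open>Rigidity of pairs only concerns permutations that keep small and large parts apart, so
  an arbitrary symmetry must be shown to do so. Degrees achieve this if
  \<open>n1 \<noteq> n2\<close>. Otherwise block sizes do: blocks of more than \<open>q\<close>
  parts contain small parts only, and every small part lies in such a block.\<close>

lemma distinguishing_partition_of_pair_conf:
  assumes pos: "n1 > 0" "n2 > 0" and conf: "pair_conf m1 n1 m2 n2 \<C>"
    and sep: "n1 \<noteq> n2 \<or>
      (\<forall>e<m1. \<exists>c\<in>\<C>. e \<in> fst c \<and> q < card (fst c) + card (snd c)) \<and>
      (\<forall>c\<in>\<C>. snd c \<noteq> {} \<longrightarrow> card (fst c) + card (snd c) \<le> q)"
  shows "\<exists>P. distinguishing_partition (K_mult m1 n1 m2 n2) P"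
proof -
  let ?I = "{..<m1 + m2}"
  let ?n = "\<lambda>i. if i < m1 then n1 else n2"
  define gl where "gl c = fst c \<union> (+) m1 ` snd c" for c
  define \<B> where "\<B> = gl ` \<C>"
  have sub: "\<C> \<subseteq> Pow {..<m1} \<times> Pow {..<m2}"
    and deg1: "\<And>e. e < m1 \<Longrightarrow> card {c \<in> \<C>. e \<in> fst c} = n1"
    and deg2: "\<And>i. i < m2 \<Longrightarrow> card {c \<in> \<C>. i \<in> snd c} = n2"
    using conf unfolding pair_conf_def by auto
  have fin: "finite \<C>" using conf by (rule pair_conf_finite)
  note csub = pair_conf_sub[OF conf]
  have small: "e \<in> gl c \<longleftrightarrow> e \<in> fst c" if "c \<in> \<C>" "e < m1" for c e
    using that by (auto simp: gl_def)
  have large: "m1 + i \<in> gl c \<longleftrightarrow> i \<in> snd c" if "c \<in> \<C>" for c i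
    using that csub(1)[OF that] by (auto simp: gl_def)
  have inj: "inj_on gl \<C>"
  proof (rule inj_onI)
    fix c d assume cd: "c \<in> \<C>" "d \<in> \<C>" "gl c = gl d"
    have "fst c = fst d"
      using small[OF cd(1)] small[OF cd(2)] cd(3) csub(1)[OF cd(1)] csub(1)[OF cd(2)] by blast
    moreover have "snd c = snd d"
      using large[OF cd(1)] large[OF cd(2)] cd(3) by auto
    ultimately show "c = d" by (rule prod_eqI)
  qed
  have BI: "\<B> \<subseteq> Pow ?I" using sub by (fastforce simp: \<B>_def gl_def)
  have card: "card {B \<in> \<B>. i \<in> B} = ?n i" if "i \<in> ?I" for i
  proof -
    have *: "card {B \<in> \<B>. i \<in> B} = card {c \<in> \<C>. i \<in> gl c}"
    proof -
      have "{B \<in> \<B>. i \<in> B} = gl ` {c \<in> \<C>. i \<in> gl c}" unfolding \<B>_def by blast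
      then show ?thesis using inj by (simp add: card_image inj_on_subset)
    qed
    show ?thesis
    proof (cases "i < m1")
      case True
      then have "{c \<in> \<C>. i \<in> gl c} = {c \<in> \<C>. i \<in> fst c}" using small by auto
      then show ?thesis using * deg1[OF True] True by simp
    next
      case False
      then obtain h where h: "i = m1 + h" by (metis le_add_diff_inverse not_less)
      then have "{c \<in> \<C>. i \<in> gl c} = {c \<in> \<C>. h \<in> snd c}" using large by auto
      then show ?thesis using * deg2[of h] that h by simp
    qed
  qed
  have "rigid_family ?I \<B>"
    unfolding rigid_family_def
  proof (intro allI impI)
    fix \<tau> assume perm: "\<tau> permutes ?I" and \<tau>: "(`) \<tau> ` \<B> = \<B>"
    have inj\<tau>: "inj \<tau>" using perm by (rule permutes_inj)
    have img: "\<exists>d\<in>\<C>. \<tau> ` gl c = gl d" if "c \<in> \<C>" for c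
    proof -
      have "\<tau> ` gl c \<in> (`) \<tau> ` \<B>" using that by (simp add: \<B>_def)
      then have "\<tau> ` gl c \<in> \<B>" by (simp only: \<tau>)
      then show ?thesis unfolding \<B>_def by blast
    qed
    have less1: "\<tau> p < m1" if p: "p < m1" for p
    proof (cases "n1 = n2")
      case False
      have "{B \<in> \<B>. \<tau> p \<in> B} = (`) \<tau> ` {B \<in> \<B>. p \<in> B}"
      proof -
        have "{B \<in> \<B>. \<tau> p \<in> B} = {B \<in> (`) \<tau> ` \<B>. \<tau> p \<in> B}" using \<tau> by simp
        also have "\<dots> = (`) \<tau> ` {B \<in> \<B>. \<tau> p \<in> \<tau> ` B}" by blast
        finally show ?thesis by (simp only: inj_image_mem_iff[OF inj\<tau>])
      qed
      then have "card {B \<in> \<B>. \<tau> p \<in> B} = card {B \<in> \<B>. p \<in> B}"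
        using inj\<tau> by (simp add: card_image inj_on_def inj_image_eq_iff)
      moreover have "\<tau> p \<in> ?I" using permutes_in_image[OF perm, of p] p by simp
      ultimately show ?thesis using card[of p] card[of "\<tau> p"] p False by (simp split: if_splits)
    next
      case True
      then obtain c where c: "c \<in> \<C>" "p \<in> fst c" "q < card (fst c) + card (snd c)"
        using sep p by blast
      have cardgl: "card (gl d) = card (fst d) + card (snd d)" if "d \<in> \<C>" for d
      proof -
        have "finite (fst d)" "finite (snd d)" "fst d \<inter> (+) m1 ` snd d = {}"
          using csub[OF that] by (auto intro: finite_subset)
        then show ?thesis by (simp add: gl_def card_Un_disjoint card_image)
      qed
      obtain d where d: "d \<in> \<C>" "\<tau> ` gl c = gl d" using img[OF c(1)] by blast
      then have "q < card (fst d) + card (snd d)"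
        using cardgl[OF c(1)] cardgl[OF d(1)] c(3) inj\<tau>
        by (metis card_image inj_on_subset subset_UNIV)
      then have "snd d = {}" using sep True d(1) by (meson not_less)
      then have "gl d \<subseteq> {..<m1}" using csub(1)[OF d(1)] by (auto simp: gl_def)
      moreover have "\<tau> p \<in> gl d" using c(2) d(2) by (auto simp: gl_def)
      ultimately show ?thesis by auto
    qed
    then have "\<tau> ` {..<m1} \<subseteq> {..<m1}" by auto
    then have img1: "\<tau> ` {..<m1} = {..<m1}"
      using inj\<tau> by (intro endo_inj_surj) (auto intro: inj_on_subset)
    have lt: "\<tau> p < m1 \<longleftrightarrow> p < m1" for p
      using img1 inj\<tau> by (metis inj_image_mem_iff lessThan_iff)
    define \<sigma> where "\<sigma> p = (if p < m1 then \<tau> p else p)" for p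
    define \<pi> where "\<pi> i = (if i < m2 then \<tau> (m1 + i) - m1 else i)" for i
    have \<tau>\<pi>: "\<tau> (m1 + i) = m1 + \<pi> i" if "i < m2" for i
      using lt[of "m1 + i"] that by (simp add: \<pi>_def)
    have \<sigma>: "\<sigma> permutes {..<m1}"
    proof (rule bij_imp_permutes)
      show "bij_betw \<sigma> {..<m1} {..<m1}"
        unfolding bij_betw_def
      proof
        show "inj_on \<sigma> {..<m1}"
          by (rule inj_onI) (simp add: \<sigma>_def inj_eq[OF inj\<tau>])
        have "\<sigma> ` {..<m1} = \<tau> ` {..<m1}"
          by (rule image_cong) (simp_all add: \<sigma>_def)
        then show "\<sigma> ` {..<m1} = {..<m1}" using img1 by simp
      qed
    qed (simp add: \<sigma>_def)
    have \<pi>_lt: "\<pi> i < m2" if "i < m2" for i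
      using \<tau>\<pi>[OF that] permutes_in_image[OF perm, of "m1 + i"] that by simp
    have "inj_on \<pi> {..<m2}"
    proof (rule inj_onI)
      fix a b assume "a \<in> {..<m2}" "b \<in> {..<m2}" "\<pi> a = \<pi> b"
      then have "\<tau> (m1 + a) = \<tau> (m1 + b)" using \<tau>\<pi>[of a] \<tau>\<pi>[of b] by simp
      then show "a = b" using injD[OF inj\<tau>] by fastforce
    qed
    moreover from this have "\<pi> ` {..<m2} = {..<m2}"
      using \<pi>_lt by (intro endo_inj_surj) auto
    ultimately have "bij_betw \<pi> {..<m2} {..<m2}"
      by (simp only: bij_betw_def)
    then have \<pi>: "\<pi> permutes {..<m2}"
      by (rule bij_imp_permutes) (simp add: \<pi>_def)
    have "(\<sigma> ` fst c, \<pi> ` snd c) \<in> \<C>" if c: "c \<in> \<C>" for c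
    proof -
      have csb: "fst c \<subseteq> {..<m1}" "snd c \<subseteq> {..<m2}" using csub[OF c] .
      have "\<tau> ` gl c = \<sigma> ` fst c \<union> (+) m1 ` \<pi> ` snd c"
      proof -
        have "\<tau> ` fst c = \<sigma> ` fst c"
          by (rule image_cong[OF refl]) (use csb(1) in \<open>auto simp: \<sigma>_def\<close>)
        moreover have "\<tau> ` (+) m1 ` snd c = (+) m1 ` \<pi> ` snd c"
          unfolding image_image by (rule image_cong[OF refl]) (use csb(2) \<tau>\<pi> in auto)
        ultimately show ?thesis by (simp add: gl_def image_Un)
      qed
      moreover obtain d where d: "d \<in> \<C>" "\<tau> ` gl c = gl d"
        using img[OF c] by blast
      ultimately have eq: "gl d = gl (\<sigma> ` fst c, \<pi> ` snd c)" by (simp add: gl_def)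
      have s: "\<sigma> ` fst c \<subseteq> {..<m1}" "\<pi> ` snd c \<subseteq> {..<m2}"
        using csb \<pi>_lt lt by (auto simp: \<sigma>_def)
      have "fst d = gl d \<inter> {..<m1}" using csub(1)[OF d(1)] by (auto simp: gl_def)
      also have "\<dots> = \<sigma> ` fst c" unfolding eq using s by (auto simp: gl_def)
      finally have 1: "fst d = \<sigma> ` fst c" .
      have "snd d = {i. m1 + i \<in> gl d}" using large[OF d(1)] by auto
      also have "\<dots> = \<pi> ` snd c" unfolding eq using s by (auto simp: gl_def)
      finally show ?thesis using 1 d(1) by (metis prod.collapse)
    qed
    from pair_conf_rigid[OF conf \<sigma> \<pi> this] have id: "\<sigma> = id" "\<pi> = id" by auto
    have "\<tau> p = p" for p
    proof (cases "p < m1 + m2")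
      case True
      show ?thesis
      proof (cases "p < m1")
        case True
        then show ?thesis using fun_cong[OF id(1), of p] by (simp add: \<sigma>_def)
      next
        case False
        then show ?thesis using \<tau>\<pi>[of "p - m1"] id(2) \<open>p < m1 + m2\<close> by simp
      qed
    qed (use perm in \<open>simp add: permutes_not_in\<close>)
    then show "\<tau> = id" by auto
  qed
  from distinguishing_partition_of_rigid_family[OF _ BI card _ this] show ?thesis
    unfolding K_mult_eq using pos by simp
qed

section \<open>Tree components\<close>

text \<open>Connectivity refers to the bipartite incidence graph between the parts of size \<open>n1\<close> and the
  blocks.\<close>

definition union_of_components :: "('a set \<times> 'b) set \<Rightarrow> 'a set \<Rightarrow> bool" where
  "union_of_components \<C> U \<longleftrightarrow> (\<forall>c\<in>\<C>. fst c \<inter> U = {} \<or> fst c \<subseteq> U)"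

text \<open>Extended by the identity, or by its inverse on \<open>C'\<close> if the two sets are
  disjoint, \<open>\<psi>\<close> becomes a symmetry of the whole family. For disjoint
  \<open>C\<close> and \<open>C'\<close> the conclusion is contradictory, so distinct components are
  never isomorphic.\<close>

lemma component_iso_trivial:
  assumes conf: "pair_conf m1 n1 m2 n2 \<C>"
    and C: "C \<subseteq> {..<m1}" "union_of_components \<C> C"
    and C': "C' \<subseteq> {..<m1}" "union_of_components \<C> C'" "C = C' \<or> C \<inter> C' = {}"
    and bij: "bij_betw \<psi> C C'"
    and to: "\<And>D T. (D, T) \<in> \<C> \<Longrightarrow> D \<noteq> {} \<Longrightarrow> D \<subseteq> C \<Longrightarrow> (\<psi> ` D, T) \<in> \<C>"
    and from_: "\<And>D T. (\<psi> ` D, T) \<in> \<C> \<Longrightarrow> D \<noteq> {} \<Longrightarrow> D \<subseteq> C \<Longrightarrow> (D, T) \<in> \<C>"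
    and x: "x \<in> C"
  shows "\<psi> x = x"
proof (cases "C = C'")
  case True
  define \<sigma> where "\<sigma> y = (if y \<in> C then \<psi> y else y)" for y
  have bij\<sigma>: "bij_betw \<sigma> C C"
    using bij True by (auto simp: \<sigma>_def cong: bij_betw_cong)
  have "\<sigma> permutes C"
    by (rule bij_imp_permutes[OF bij\<sigma>]) (simp add: \<sigma>_def)
  then have perm: "\<sigma> permutes {..<m1}"
    using C(1) by (rule permutes_subset)
  have "(\<sigma> ` fst c, id ` snd c) \<in> \<C>" if c: "c \<in> \<C>" for c
  proof (cases "fst c \<subseteq> C \<and> fst c \<noteq> {}")
    case True
    then have "\<sigma> ` fst c = \<psi> ` fst c" by (auto simp: \<sigma>_def)
    then show ?thesis using to[of "fst c" "snd c"] c True by simp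
  next
    case False
    then have "fst c \<inter> C = {}" using C(2) c by (auto simp: union_of_components_def)
    then have "\<sigma> ` fst c = fst c" by (auto simp: \<sigma>_def)
    then show ?thesis using c by simp
  qed
  from pair_conf_rigid(1)[OF conf perm permutes_id this] show ?thesis
    using x by (metis \<sigma>_def id_apply)
next
  case False
  then have disj: "C \<inter> C' = {}" using C'(3) by blast
  define \<sigma> where "\<sigma> y = (if y \<in> C then \<psi> y else if y \<in> C' then the_inv_into C \<psi> y else y)" for y
  have \<psi>: "\<psi> y \<in> C'" if "y \<in> C" for y using bij that by (auto simp: bij_betw_def)
  have inv: "the_inv_into C \<psi> y \<in> C" "\<psi> (the_inv_into C \<psi> y) = y" if "y \<in> C'" for y
    using bij that by (auto simp: bij_betw_def the_inv_into_into f_the_inv_into_f)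
  have invol: "\<sigma> (\<sigma> y) = y" for y
    using disj \<psi> inv bij by (auto simp: \<sigma>_def bij_betw_def the_inv_into_f_f)
  have perm: "\<sigma> permutes {..<m1}"
  proof (rule involution_permutes[OF invol])
    show "\<sigma> y = y" if "y \<notin> {..<m1}" for y
      using that C(1) C'(1) by (auto simp: \<sigma>_def)
  qed
  have "(\<sigma> ` fst c, id ` snd c) \<in> \<C>" if c: "c \<in> \<C>" for c
  proof -
    consider "fst c \<subseteq> C" "fst c \<noteq> {}" | "fst c \<subseteq> C'" "fst c \<noteq> {}" | "fst c \<inter> (C \<union> C') = {}"
      using C(2) C'(2) c by (auto simp: union_of_components_def)
    then show ?thesis
    proof cases
      case 1
      then have "\<sigma> ` fst c = \<psi> ` fst c" by (auto simp: \<sigma>_def)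
      then show ?thesis using to[of "fst c" "snd c"] c 1 by simp
    next
      case 2
      have "\<sigma> y \<in> C" "\<psi> (\<sigma> y) = y" if "y \<in> fst c" for y
        using 2 that disj inv by (auto simp: \<sigma>_def)
      then have "\<sigma> ` fst c \<subseteq> C" "\<psi> ` \<sigma> ` fst c = fst c" by (auto simp: image_image)
      then show ?thesis using from_[of "\<sigma> ` fst c" "snd c"] c 2 by simp
    next
      case 3
      then have "\<sigma> ` fst c = fst c" by (auto simp: \<sigma>_def)
      then show ?thesis using c by simp
    qed
  qed
  from pair_conf_rigid(1)[OF conf perm permutes_id this] show ?thesis
    using x by (metis \<sigma>_def id_apply)
qed

text \<open>A component with \<open>n\<close> points has at most \<open>(n1 + 1) * n\<close>
  vertices in the incidence graph. These carry \<open>2 ^ m2 + 1\<close> possible labels, one for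
  points and one for each set of large parts, so \<open>finite_card_codes\<close> bounds the number
  of codes by the \<open>n\<close>-th power of this number.\<close>

definition tree_base :: "nat \<Rightarrow> nat \<Rightarrow> nat" where
  "tree_base n1 m2 = (2 ^ m2 + 3) ^ (2 * (n1 + 1))"

text \<open>The forest lemma is applied to the incidence graph, which has
  \<open>m1 + card {c \<in> \<C>. fst c \<noteq> {}}\<close> vertices and \<open>m1 * n1\<close>
  edges. Two trees with the same code would be isomorphic components, so the number of small trees
  is bounded by the number of codes.\<close>

lemma tree_components:
  assumes conf: "pair_conf m1 n1 m2 n2 \<C>"
  shows "\<exists>\<G>. disjoint \<G> \<and> finite \<G> \<and>
    (\<forall>K\<in>\<G>. K \<subseteq> {..<m1} \<and> K \<noteq> {} \<and> union_of_components \<C> K \<and>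
      (\<forall>U. union_of_components \<C> U \<longrightarrow> K \<inter> U \<noteq> {} \<longrightarrow> K \<subseteq> U)) \<and>
    (\<forall>n. card {K \<in> \<G>. card K \<le> n} \<le> tree_base n1 m2 ^ n) \<and>
    m1 + card {c \<in> \<C>. fst c \<noteq> {}} \<le> card \<G> + m1 * n1"
proof -
  have fin: "finite \<C>" using conf by (rule pair_conf_finite)
  note csub = pair_conf_sub[OF conf]
  have deg1: "\<And>e. e < m1 \<Longrightarrow> card {c \<in> \<C>. e \<in> fst c} = n1"
    using conf unfolding pair_conf_def by auto
  \<comment> \<open>Blocks that meet no small part would be isolated vertices, hence trees without
    points; they are left out.\<close>
  define V :: "(nat + nat set \<times> nat set) set"
    where "V = Inl ` {..<m1} \<union> Inr ` {c \<in> \<C>. fst c \<noteq> {}}"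
  define E :: "(nat + nat set \<times> nat set) set set"
    where "E = (\<lambda>(e, c). {Inl e, Inr c}) ` (SIGMA e:{..<m1}. {c \<in> \<C>. e \<in> fst c})"
  have E_iff: "{Inl e, Inr c} \<in> E \<longleftrightarrow> c \<in> \<C> \<and> e \<in> fst c" for e c
    using csub(1)[of c] by (auto simp: E_def doubleton_eq_iff image_iff)
  have E_cases: "\<exists>e c. x = {Inl e, Inr c} \<and> c \<in> \<C> \<and> e \<in> fst c" if "x \<in> E" for x
    using that by (auto simp: E_def) blast
  have finV: "finite V" and finE: "finite E"
    using fin by (auto simp: V_def E_def)
  have cardV: "card V = m1 + card {c \<in> \<C>. fst c \<noteq> {}}"
    unfolding V_def using fin by (subst card_Un_disjoint) (auto simp: card_image)
  have cardE: "card E = m1 * n1"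
  proof -
    have "inj_on (\<lambda>(e, c). {Inl e, Inr c}) (SIGMA e:{..<m1}. {c \<in> \<C>. e \<in> fst c})"
      by (auto simp: inj_on_def doubleton_eq_iff)
    then have "card E = card (SIGMA e:{..<m1}. {c \<in> \<C>. e \<in> fst c})"
      unfolding E_def by (rule card_image)
    also have "\<dots> = (\<Sum>e<m1. n1)"
      using fin deg1 by (subst card_SigmaI) auto
    finally show ?thesis by simp
  qed
  have "\<exists>u\<in>V. \<exists>v\<in>V. u \<noteq> v \<and> x = {u, v}" if "x \<in> E" for x
  proof -
    from E_cases[OF that] obtain e c where "x = {Inl e, Inr c}" "c \<in> \<C>" "e \<in> fst c" by blast
    moreover have "e < m1" using csub(1)[OF \<open>c \<in> \<C>\<close>] \<open>e \<in> fst c\<close> by auto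
    ultimately show ?thesis
      by (intro bexI[of _ "Inl e"] bexI[of _ "Inr c"]) (auto simp: V_def)
  qed
  then have "\<exists>\<S>. disjoint \<S> \<and> finite \<S> \<and> \<Union>\<S> \<subseteq> V \<and>
      (\<forall>S\<in>\<S>. tree_on E S \<and> (\<forall>x\<in>E. x \<inter> S \<noteq> {} \<longrightarrow> x \<subseteq> S)) \<and> card V \<le> card \<S> + card E"
    by (rule forest_lemma[OF finV finE])
  then obtain \<S> where \<S>: "disjoint \<S>" "finite \<S>" "\<Union>\<S> \<subseteq> V"
    "card V \<le> card \<S> + card E"
    and tree: "\<And>S. S \<in> \<S> \<Longrightarrow> tree_on E S"
    and clos: "\<And>S x. S \<in> \<S> \<Longrightarrow> x \<in> E \<Longrightarrow> x \<inter> S \<noteq> {} \<Longrightarrow> x \<subseteq> S"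
    by (elim exE conjE) simp
  define pts :: "(nat + nat set \<times> nat set) set \<Rightarrow> nat set" where "pts S = Inl -` S" for S
  have mem_blk: "Inr c \<in> S \<longleftrightarrow> c \<in> \<C> \<and> fst c \<noteq> {} \<and> fst c \<subseteq> pts S" if "S \<in> \<S>" for S c
  proof
    assume c: "Inr c \<in> S"
    then have "c \<in> \<C>" "fst c \<noteq> {}" using \<S>(3) that by (auto simp: V_def)
    moreover have "fst c \<subseteq> pts S"
    proof
      fix e assume "e \<in> fst c"
      then have "{Inl e, Inr c} \<subseteq> S" using clos[OF that, of "{Inl e, Inr c}"] c \<open>c \<in> \<C>\<close> E_iff by auto
      then show "e \<in> pts S" by (auto simp: pts_def)
    qed
    ultimately show "c \<in> \<C> \<and> fst c \<noteq> {} \<and> fst c \<subseteq> pts S" by blast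
  next
    assume c: "c \<in> \<C> \<and> fst c \<noteq> {} \<and> fst c \<subseteq> pts S"
    then obtain e where e: "e \<in> fst c" by blast
    then have "{Inl e, Inr c} \<subseteq> S"
      using clos[OF that, of "{Inl e, Inr c}"] c E_iff by (auto simp: pts_def)
    then show "Inr c \<in> S" by auto
  qed
  have pts_ne: "pts S \<noteq> {}" if S: "S \<in> \<S>" for S
  proof -
    obtain u where "u \<in> S" using tree_on_nonempty[OF tree[OF S]] by blast
    then show ?thesis using mem_blk[OF S] by (cases u) (auto simp: pts_def)
  qed
  have pts_sub: "pts S \<subseteq> {..<m1}" if "S \<in> \<S>" for S
    using \<S>(3) that by (fastforce simp: pts_def V_def)
  have pts_disj: "pts S \<inter> pts S' = {}" if "S \<in> \<S>" "S' \<in> \<S>" "S \<noteq> S'" for S S'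
    using \<S>(1) that by (auto simp: pts_def disjoint_def)
  have inj_pts: "inj_on pts \<S>"
  proof (rule inj_onI, rule ccontr)
    fix S S' assume "S \<in> \<S>" "S' \<in> \<S>" "pts S = pts S'" "S \<noteq> S'"
    then show False using pts_disj[of S S'] pts_ne[of S] by simp
  qed
  have comp: "union_of_components \<C> (pts S)" if S: "S \<in> \<S>" for S
    unfolding union_of_components_def
  proof
    fix c assume c: "c \<in> \<C>"
    have "Inr c \<in> S" if "e \<in> fst c" "e \<in> pts S" for e
      using clos[OF S, of "{Inl e, Inr c}"] E_iff c that by (auto simp: pts_def)
    then show "fst c \<inter> pts S = {} \<or> fst c \<subseteq> pts S"
      using mem_blk[OF S] by blast
  qed
  have conn: "pts S \<subseteq> U" if S: "S \<in> \<S>" and U: "union_of_components \<C> U" "pts S \<inter> U \<noteq> {}" for S U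
  proof -
    let ?U = "Inl ` U \<union> Inr ` {c \<in> \<C>. fst c \<inter> U \<noteq> {}}"
    have "S \<subseteq> ?U"
    proof (rule tree_on_connected[OF tree[OF S]])
      fix x assume "x \<in> E" "x \<inter> ?U \<noteq> {}"
      then obtain e c where x: "x = {Inl e, Inr c}" "c \<in> \<C>" "e \<in> fst c" using E_cases by blast
      then have "e \<in> U \<or> fst c \<inter> U \<noteq> {}" using \<open>x \<inter> ?U \<noteq> {}\<close> by auto
      then have "fst c \<inter> U \<noteq> {}" using x by blast
      then have "fst c \<subseteq> U" using U(1) x by (auto simp: union_of_components_def)
      then show "x \<subseteq> ?U" using x by auto
    next
      show "S \<inter> ?U \<noteq> {}" using U(2) by (auto simp: pts_def)
    qed
    then show ?thesis by (auto simp: pts_def)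
  qed
  \<comment> \<open>The label \<open>None\<close> marks points, so that a label-preserving
    isomorphism maps points to points, and blocks to blocks with the same set of large
    parts.\<close>
  define lab :: "nat + nat set \<times> nat set \<Rightarrow> nat set option"
    where "lab u = (case u of Inl _ \<Rightarrow> None | Inr c \<Rightarrow> Some (snd c))" for u
  let ?A = "insert None (Some ` Pow {..<m2})"
  have cardA: "card ?A = 2 ^ m2 + 1"
    by (simp add: card_image card_Pow image_iff)
  have "\<exists>c u. rooted_code E lab S u c" if "S \<in> \<S>" for S
    using tree_on_imp_rooted_code[OF tree[OF that]] tree_on_nonempty[OF tree[OF that]] by blast
  then obtain code root where code: "\<And>S. S \<in> \<S> \<Longrightarrow> rooted_code E lab S (root S) (code S)"
    by metis
  \<comment> \<open>An isomorphism \<open>f\<close> of two trees restricts to a map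
    \<open>\<psi>\<close> of the points and sends a block to the block on the image of its points
    with the same label. Rigidity makes \<open>\<psi>\<close> the identity, so the trees share their
    points and coincide.\<close>
  have inj_code: "inj_on code \<S>"
  proof (rule inj_onI)
    fix S S' assume S: "S \<in> \<S>" "S' \<in> \<S>" "code S = code S'"
    have "rooted_code E lab S' (root S') (code S)" using code[OF S(2)] S(3) by simp
    from rooted_code_iso[OF code[OF S(1)] this] obtain f where f: "bij_betw f S S'"
      and lab_f: "\<And>a. a \<in> S \<Longrightarrow> lab (f a) = lab a"
      and adj_f: "\<And>a b. a \<in> S \<Longrightarrow> b \<in> S \<Longrightarrow> {f a, f b} \<in> E \<longleftrightarrow> {a, b} \<in> E" by blast
    have f_mem: "f a \<in> S'" if "a \<in> S" for a using f that by (auto simp: bij_betw_def)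
    have fl: "\<exists>y. f (Inl x) = Inl y" if "Inl x \<in> S" for x
      using lab_f[OF that] by (cases "f (Inl x)") (auto simp: lab_def)
    define \<psi> where "\<psi> x = projl (f (Inl x))" for x
    have \<psi>: "f (Inl x) = Inl (\<psi> x)" if "x \<in> pts S" for x
      using fl[of x] that by (auto simp: \<psi>_def pts_def)
    have blkf: "f (Inr c) = Inr (\<psi> ` fst c, snd c)" if cin: "Inr c \<in> S" for c
    proof -
      obtain d where d: "f (Inr c) = Inr d" "snd d = snd c"
        using lab_f[OF cin] by (cases "f (Inr c)") (auto simp: lab_def)
      have dS: "Inr d \<in> S'" using f_mem[OF cin] d by simp
      have cS: "fst c \<subseteq> pts S" using mem_blk[OF S(1)] cin by blast
      have "fst d = \<psi> ` fst c"
      proof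
        show "\<psi> ` fst c \<subseteq> fst d"
        proof
          fix y assume "y \<in> \<psi> ` fst c"
          then obtain x where x: "x \<in> fst c" "y = \<psi> x" by blast
          then have xS: "x \<in> pts S" "Inl x \<in> S" using cS by (auto simp: pts_def)
          have "{Inl x, Inr c} \<in> E" using x mem_blk[OF S(1)] cin E_iff by auto
          then have "{Inl y, Inr d} \<in> E" using adj_f[OF xS(2) cin] \<psi>[OF xS(1)] d x by simp
          then show "y \<in> fst d" using E_iff by auto
        qed
        show "fst d \<subseteq> \<psi> ` fst c"
        proof
          fix y assume y: "y \<in> fst d"
          then have "Inl y \<in> S'" using mem_blk[OF S(2)] dS by (auto simp: pts_def)
          then obtain a where a: "a \<in> S" "f a = Inl y" using f by (auto simp: bij_betw_def)
          then obtain x where x: "a = Inl x"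
            using lab_f[OF a(1)] by (cases a) (auto simp: lab_def)
          then have xS: "x \<in> pts S" using a by (auto simp: pts_def)
          have "{Inl y, Inr d} \<in> E" using y dS mem_blk[OF S(2)] E_iff by auto
          then have "{Inl x, Inr c} \<in> E" using adj_f[OF a(1) cin] a d x by simp
          moreover have "y = \<psi> x" using a x \<psi>[OF xS] by simp
          ultimately show "y \<in> \<psi> ` fst c" using E_iff by auto
        qed
      qed
      then show ?thesis using d by (metis prod.collapse)
    qed
    have bij\<psi>: "bij_betw \<psi> (pts S) (pts S')"
      unfolding bij_betw_def
    proof
      show "inj_on \<psi> (pts S)"
      proof (rule inj_onI)
        fix x y assume "x \<in> pts S" "y \<in> pts S" "\<psi> x = \<psi> y"
        then have "f (Inl x) = f (Inl y)" "Inl x \<in> S" "Inl y \<in> S" using \<psi> by (auto simp: pts_def)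
        then show "x = y" using f by (auto simp: bij_betw_def dest: inj_onD)
      qed
      show "\<psi> ` pts S = pts S'"
      proof
        show "\<psi> ` pts S \<subseteq> pts S'" using \<psi> f_mem by (fastforce simp: pts_def)
        show "pts S' \<subseteq> \<psi> ` pts S"
        proof
          fix y assume "y \<in> pts S'"
          then obtain a where a: "a \<in> S" "f a = Inl y" using f by (auto simp: bij_betw_def pts_def)
          then obtain x where x: "a = Inl x"
            using lab_f[OF a(1)] by (cases a) (auto simp: lab_def)
          then have "x \<in> pts S" using a by (auto simp: pts_def)
          then show "y \<in> \<psi> ` pts S" using \<psi>[of x] a x by auto
        qed
      qed
    qed
    have "\<psi> x = x" if "x \<in> pts S" for x
    proof (rule component_iso_trivial[OF conf pts_sub[OF S(1)] comp[OF S(1)] pts_sub[OF S(2)]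
          comp[OF S(2)] _ bij\<psi> _ _ that])
      show "pts S = pts S' \<or> pts S \<inter> pts S' = {}" using pts_disj S by blast
      fix D T assume D: "D \<noteq> {}" "D \<subseteq> pts S"
      { assume "(D, T) \<in> \<C>"
        then have "Inr (D, T) \<in> S" using mem_blk[OF S(1)] D by auto
        then have "Inr (\<psi> ` D, T) \<in> S'" using f_mem blkf by fastforce
        then show "(\<psi> ` D, T) \<in> \<C>" using mem_blk[OF S(2)] by blast }
      { assume "(\<psi> ` D, T) \<in> \<C>"
        moreover have "\<psi> ` D \<subseteq> pts S'" using D bij\<psi> by (auto simp: bij_betw_def)
        ultimately have "Inr (\<psi> ` D, T) \<in> S'" using mem_blk[OF S(2)] D by auto
        then obtain a where a: "a \<in> S" "f a = Inr (\<psi> ` D, T)" using f by (auto simp: bij_betw_def)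
        then obtain c where c: "a = Inr c" using lab_f[OF a(1)] by (cases a) (auto simp: lab_def)
        then have cC: "c \<in> \<C>" "fst c \<subseteq> pts S" using mem_blk[OF S(1)] a by auto
        have "(\<psi> ` fst c, snd c) = (\<psi> ` D, T)" using blkf[of c] a c by simp
        then have "fst c = D" "snd c = T"
          using inj_on_image_eq_iff[of \<psi> "pts S" "fst c" D] bij\<psi> D cC by (auto simp: bij_betw_def)
        then show "(D, T) \<in> \<C>" using cC by auto }
    qed
    then have "pts S' = pts S"
      using bij\<psi> by (auto simp: bij_betw_def)
    then show "S = S'" using inj_pts S by (auto dest: inj_onD)
  qed
  have size: "card S \<le> (n1 + 1) * card (pts S)" if S: "S \<in> \<S>" for S
  proof -
    have finp: "finite (pts S)" using pts_sub[OF S] finite_subset by blast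
    let ?R = "Inl ` pts S \<union> Inr ` (\<Union>e\<in>pts S. {c \<in> \<C>. e \<in> fst c})"
    have "S \<subseteq> ?R"
    proof
      fix u assume u: "u \<in> S"
      show "u \<in> ?R"
      proof (cases u)
        case (Inr c)
        then show ?thesis using u mem_blk[OF S, of c] by auto
      qed (use u in \<open>auto simp: pts_def\<close>)
    qed
    then have "card S \<le> card ?R" using finp fin by (intro card_mono) auto
    also have "\<dots> \<le> card (Inl ` pts S :: (nat + nat set \<times> nat set) set)
        + card (Inr ` (\<Union>e\<in>pts S. {c \<in> \<C>. e \<in> fst c}) :: (nat + nat set \<times> nat set) set)"
      by (rule card_Un_le)
    also have "\<dots> = card (pts S) + card (\<Union>e\<in>pts S. {c \<in> \<C>. e \<in> fst c})"
      by (simp add: card_image)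
    also have "card (\<Union>e\<in>pts S. {c \<in> \<C>. e \<in> fst c}) \<le> (\<Sum>e\<in>pts S. card {c \<in> \<C>. e \<in> fst c})"
      using finp by (rule card_UN_le)
    also have "\<dots> = (\<Sum>e\<in>pts S. n1)"
      using deg1 pts_sub[OF S] by (intro sum.cong) auto
    finally show ?thesis by (simp add: mult.commute)
  qed
  have count: "card {K \<in> pts ` \<S>. card K \<le> n} \<le> tree_base n1 m2 ^ n" for n
  proof -
    let ?S = "{S \<in> \<S>. card (pts S) \<le> n}"
    let ?Cd = "{c. leaf_labels c \<subseteq> ?A \<and> leaves c \<le> (n1 + 1) * n}"
    have "{K \<in> pts ` \<S>. card K \<le> n} = pts ` ?S" by auto
    then have "card {K \<in> pts ` \<S>. card K \<le> n} \<le> card ?S"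
      using \<S>(2) by (simp add: card_image_le)
    also have "code ` ?S \<subseteq> ?Cd"
    proof safe
      fix S assume S: "S \<in> \<S>" "card (pts S) \<le> n"
      have "leaves (code S) = card S" using rooted_code_facts(3)[OF code[OF S(1)]] .
      also have "\<dots> \<le> (n1 + 1) * card (pts S)" by (rule size[OF S(1)])
      also have "\<dots> \<le> (n1 + 1) * n" using S(2) by (rule mult_le_mono2)
      finally show "leaves (code S) \<le> (n1 + 1) * n" .
      fix y assume "y \<in> leaf_labels (code S)" "y \<notin> Some ` Pow {..<m2}"
      moreover have "leaf_labels (code S) = lab ` S" using rooted_code_facts(4)[OF code[OF S(1)]] .
      ultimately obtain u where u: "u \<in> S" "y = lab u" by auto
      show "y = None"
      proof (cases u)
        case (Inr c)
        then have "c \<in> \<C>" using mem_blk[OF S(1)] u by auto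
        then have "snd c \<in> Pow {..<m2}" using csub(2) by simp
        then show ?thesis using \<open>y \<notin> Some ` Pow {..<m2}\<close> u Inr by (auto simp: lab_def)
      qed (use u in \<open>simp add: lab_def\<close>)
    qed
    then have "card ?S \<le> card ?Cd"
      using finite_card_codes(1)[of ?A] inj_code
      by (intro card_inj_on_le[of code]) (auto intro: inj_on_subset)
    also have "\<dots> \<le> (card ?A + 2) ^ (2 * ((n1 + 1) * n))"
      by (intro finite_card_codes(2)) auto
    also have "\<dots> = tree_base n1 m2 ^ n"
    proof -
      have "card ?A + 2 = 2 ^ m2 + 3" unfolding cardA by simp
      then show ?thesis by (simp only: tree_base_def power_mult[symmetric] mult.assoc)
    qed
    finally show ?thesis .
  qed
  have "disjoint (pts ` \<S>)"
    using pts_disj by (auto simp: disjoint_def)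
  moreover have "card (pts ` \<S>) = card \<S>"
    using inj_pts by (rule card_image)
  ultimately show ?thesis
    using \<S>(2,4) pts_sub pts_ne comp conn count cardV cardE
    by (intro exI[of _ "pts ` \<S>"]) auto
qed

section \<open>The weight inequality\<close>

lemma sum_card_incidences:
  assumes "finite \<C>" "finite X" "\<And>c. c \<in> \<C> \<Longrightarrow> f c \<subseteq> X"
  shows "(\<Sum>c\<in>\<C>. card (f c)) = (\<Sum>i\<in>X. card {c \<in> \<C>. i \<in> f c})"
proof -
  have "(\<Sum>c\<in>\<C>. card {i \<in> X. i \<in> f c}) = (\<Sum>i\<in>X. card {c \<in> \<C>. i \<in> f c})"
    using assms(1,2) by (intro sum_multicount_gen) auto
  moreover have "{i \<in> X. i \<in> f c} = f c" if "c \<in> \<C>" for c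
    using assms(3)[OF that] by blast
  ultimately show ?thesis by simp
qed

lemma sum_Pow_card:
  fixes F :: "nat \<Rightarrow> 'a :: comm_semiring_1"
  assumes "finite X"
  shows "(\<Sum>T\<in>Pow X. F (card T)) = (\<Sum>s\<le>card X. of_nat (card X choose s) * F s)"
proof -
  have "(\<Sum>T\<in>Pow X. F (card T)) = (\<Sum>s\<le>card X. \<Sum>T\<in>{T \<in> Pow X. card T = s}. F (card T))"
    using assms by (intro sum.group[symmetric]) (auto simp: card_mono)
  also have "\<dots> = (\<Sum>s\<le>card X. of_nat (card X choose s) * F s)"
  proof (rule sum.cong[OF refl])
    fix s
    have "card {T \<in> Pow X. card T = s} = card X choose s"
      using n_subsets[OF assms, of s] by simp
    then show "(\<Sum>T\<in>{T \<in> Pow X. card T = s}. F (card T)) = of_nat (card X choose s) * F s"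
      by simp
  qed
  finally show ?thesis .
qed

text \<open>Taking complements turns sets with more than \<open>m - Suc j\<close> elements into sets
  with at most \<open>j\<close> elements.\<close>

lemma sum_large_subsets:
  fixes F :: "nat \<Rightarrow> 'a :: comm_semiring_1"
  assumes "j < m"
  shows "(\<Sum>T\<in>{T \<in> Pow {..<m}. m - Suc j < card T}. F (card T)) =
    (\<Sum>i=0..j. of_nat (m choose i) * F (m - i))"
proof -
  have "(\<Sum>T\<in>{T \<in> Pow {..<m}. m - Suc j < card T}. F (card T)) =
      (\<Sum>T\<in>Pow {..<m}. if m - Suc j < card T then F (card T) else 0)"
    by (rule sum.inter_filter) simp
  also have "\<dots> = (\<Sum>s\<le>m. of_nat (m choose s) * (if m - Suc j < s then F s else 0))"
    using sum_Pow_card[of "{..<m}" "\<lambda>s. if m - Suc j < s then F s else 0"] by simp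
  also have "\<dots> = (\<Sum>i\<le>m. of_nat (m choose (m - i)) * (if m - Suc j < m - i then F (m - i) else 0))"
    by (rule sum.reindex_bij_witness[of _ "\<lambda>i. m - i" "\<lambda>i. m - i"]) auto
  also have "\<dots> = (\<Sum>i\<in>{0..j}. of_nat (m choose (m - i)) * (if m - Suc j < m - i then F (m - i) else 0))"
    using assms by (intro sum.mono_neutral_right) auto
  also have "\<dots> = (\<Sum>i=0..j. of_nat (m choose i) * F (m - i))"
    using assms by (intro sum.cong refl) (auto simp: binomial_symmetric[symmetric])
  finally show ?thesis .
qed

text \<open>The weight \<open>card (snd c)\<close> of a block \<open>c\<close> is compared with \<open>d * card (fst c) - mu * (card (fst c) - 1)\<close>.
  The excess is at most \<open>0\<close> for blocks with two or more small parts, and the blocks that meet only one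
  fixed small part have distinct \<open>snd c\<close>, so their total excess is at most that of all sets of size
  greater than \<open>d\<close>. The factor of \<open>mu\<close> on the right is the Euler characteristic of the incidence
  graph, hence at most its number of tree components.\<close>

lemma weight_inequality:
  fixes d mu R :: int
  assumes conf: "pair_conf m1 n1 m2 n2 \<C>"
    and n1: "n1 = 2 + (\<Sum>i=0..j. m2 choose i) + k" and j: "2 * j + 2 \<le> m2"
    and d: "d = int m2 - int j - 1" and mu: "mu = int m2 - 2 * int j - 2"
    and R: "R = int m2 + (\<Sum>i=0..j. (int m2 - int i) * int (m2 choose i)) + d * int k"
  shows "int m2 * int n2 + d * int (card {c \<in> \<C>. fst c \<noteq> {} \<and> snd c = {}})
      + int (card {e. e < m1 \<and> ({e}, {..<m2}) \<notin> \<C>})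
    \<le> R * int m1 + mu * (int m1 + int (card {c \<in> \<C>. fst c \<noteq> {}}) - int m1 * int n1)
      + int m2 * 2 ^ m2"
proof -
  note csub = pair_conf_sub[OF conf]
  have fin: "finite \<C>" using conf by (rule pair_conf_finite)
  have deg1: "\<And>e. e < m1 \<Longrightarrow> card {c \<in> \<C>. e \<in> fst c} = n1"
    and deg2: "\<And>i. i < m2 \<Longrightarrow> card {c \<in> \<C>. i \<in> snd c} = n2"
    using conf unfolding pair_conf_def by auto
  have finf: "finite (fst c)" "finite (snd c)" if "c \<in> \<C>" for c
    using csub[OF that] by (auto intro: finite_subset)
  define C' where "C' = {c \<in> \<C>. fst c \<noteq> {}}"
  define S1 where "S1 = {c \<in> \<C>. card (fst c) = 1}"
  define S2 where "S2 = {c \<in> \<C>. 2 \<le> card (fst c)}"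
  define Y where "Y = {e. e < m1 \<and> ({e}, {..<m2}) \<notin> \<C>}"
  \<comment> \<open>\<open>z\<close> marks the blocks with empty label, which are charged an
    additional \<open>d\<close>; \<open>g\<close> is the excess of a block; \<open>A\<close> is the
    largest total excess at one point, attained by taking all labels of more than \<open>d\<close>
    elements.\<close>
  define z :: "nat set \<times> nat set \<Rightarrow> int" where "z c = (if snd c = {} then 1 else 0)" for c
  define A where "A = (\<Sum>i=0..j. (int j + 1 - int i) * int (m2 choose i))"
  define g where "g c = int (card (snd c)) + mu * (int (card (fst c)) - 1) - d * int (card (fst c))" for c :: "nat set \<times> nat set"
  have finC': "finite C'" using fin by (simp add: C'_def)
  have C'_split: "C' = S1 \<union> S2" "S1 \<inter> S2 = {}" "finite S1" "finite S2"
  proof -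
    have "fst c \<noteq> {} \<longleftrightarrow> card (fst c) = 1 \<or> 2 \<le> card (fst c)" if "c \<in> \<C>" for c
      using finf(1)[OF that] by (metis One_nat_def Suc_1 Suc_leI card_gt_0_iff le_neq_implies_less
          less_numeral_extra(3) zero_less_numeral leD one_neq_zero card.empty)
    then show "C' = S1 \<union> S2" by (auto simp: C'_def S1_def S2_def)
  qed (use fin in \<open>auto simp: S1_def S2_def\<close>)
  have A_eq: "(\<Sum>T\<in>{T \<in> Pow {..<m2}. m2 - Suc j < card T}. int (card T) - d) = A"
  proof -
    have "(\<Sum>T\<in>{T \<in> Pow {..<m2}. m2 - Suc j < card T}. int (card T) - d) =
        (\<Sum>i=0..j. int (m2 choose i) * (int (m2 - i) - d))"
      using j sum_large_subsets[of j m2 "\<lambda>s. int s - d"] by simp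
    also have "\<dots> = A"
      unfolding A_def using j by (intro sum.cong refl) (auto simp: d of_nat_diff)
    finally show ?thesis .
  qed
  \<comment> \<open>An empty label has excess \<open>- d\<close>, which exactly pays for the charge.
    A missing full label forfeits its excess \<open>j + 1\<close>, and the 1 counted for
    \<open>Y\<close> is part of that.\<close>
  have node: "(\<Sum>T\<in>\<T>. int (card T) - d + (if T = {} then d else 0)) + (if {..<m2} \<notin> \<T> then 1 else 0) \<le> A"
    if T: "\<T> \<subseteq> Pow {..<m2}" for \<T>
  proof -
    let ?h = "\<lambda>T. int (card T) - d + (if T = {} then d else 0)"
    let ?P = "{T \<in> Pow {..<m2}. m2 - Suc j < card T}"
    have finT: "finite \<T>" using T finite_subset by auto
    have d0: "d \<ge> 1" and dn: "int (m2 - Suc j) = d" using j d by auto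
    have h0: "?h T \<le> 0" if "\<not> m2 - Suc j < card T" for T
      using that dn d0 by auto
    have hP: "?h T = int (card T) - d" "?h T \<ge> 1" if "T \<in> ?P" for T
      using that dn d0 by auto
    have "(\<Sum>T\<in>\<T>. ?h T) \<le> (\<Sum>T\<in>\<T> \<inter> ?P. ?h T)"
    proof -
      have "(\<Sum>T\<in>\<T>. ?h T) = (\<Sum>T\<in>\<T> \<inter> ?P. ?h T) + (\<Sum>T\<in>\<T> - ?P. ?h T)"
        using finT by (metis (no_types, lifting) sum.Int_Diff)
      moreover have "(\<Sum>T\<in>\<T> - ?P. ?h T) \<le> 0"
      proof (rule sum_nonpos)
        fix T assume "T \<in> \<T> - ?P"
        then have "\<not> m2 - Suc j < card T" using T by auto
        then show "?h T \<le> 0" by (rule h0)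
      qed
      ultimately show ?thesis by simp
    qed
    also have "(\<Sum>T\<in>\<T> \<inter> ?P. ?h T) + (if {..<m2} \<notin> \<T> then 1 else 0) \<le> (\<Sum>T\<in>?P. ?h T)"
    proof (cases "{..<m2} \<in> \<T>")
      case True
      have "(\<Sum>T\<in>\<T> \<inter> ?P. ?h T) \<le> (\<Sum>T\<in>?P. ?h T)"
      proof (rule sum_mono2)
        fix T assume "T \<in> ?P - \<T> \<inter> ?P"
        then show "0 \<le> ?h T" using hP(2)[of T] by simp
      qed auto
      then show ?thesis using True by simp
    next
      case False
      have big: "{..<m2} \<in> ?P" using j by auto
      have "(\<Sum>T\<in>\<T> \<inter> ?P. ?h T) + ?h {..<m2} = (\<Sum>T\<in>insert {..<m2} (\<T> \<inter> ?P). ?h T)"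
        using False finT by simp
      also have "\<dots> \<le> (\<Sum>T\<in>?P. ?h T)"
      proof (rule sum_mono2)
        show "insert {..<m2} (\<T> \<inter> ?P) \<subseteq> ?P" using big by auto
        fix T assume "T \<in> ?P - insert {..<m2} (\<T> \<inter> ?P)"
        then show "0 \<le> ?h T" using hP(2)[of T] by simp
      qed auto
      finally show ?thesis using False hP(2)[OF big] by simp
    qed
    also have "(\<Sum>T\<in>?P. ?h T) = A"
      using hP(1) A_eq by simp
    finally show ?thesis by simp
  qed
  \<comment> \<open>The value \<open>mu = 2 * d - m2\<close> makes the excess of an edge with full
    label equal to 0; every further small part costs \<open>j + 1\<close>.\<close>
  have s2: "g c + d * z c \<le> 0" if "c \<in> S2" for c
  proof -
    have c: "c \<in> \<C>" "2 \<le> card (fst c)" using that by (auto simp: S2_def)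
    have "card (snd c) \<le> m2" using card_mono[OF _ csub(2)[OF c(1)]] by simp
    moreover have "g c = int (card (snd c)) - int m2 - (int (card (fst c)) - 2) * (int j + 1)"
      unfolding g_def mu d by (simp add: algebra_simps)
    moreover have "(int (card (fst c)) - 2) * (int j + 1) \<ge> 0" using c(2) by simp
    moreover have "d \<le> int m2" using d by simp
    ultimately show ?thesis by (auto simp: z_def)
  qed
  define \<T> where "\<T> e = {T. ({e}, T) \<in> \<C>}" for e
  have \<T>_sub: "\<T> e \<subseteq> Pow {..<m2}" for e
    using csub(2) by (fastforce simp: \<T>_def)
  have S1_eq: "S1 = (\<lambda>(e, T). ({e}, T)) ` (SIGMA e:{..<m1}. \<T> e)"
  proof
    show "S1 \<subseteq> (\<lambda>(e, T). ({e}, T)) ` (SIGMA e:{..<m1}. \<T> e)"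
    proof
      fix c assume "c \<in> S1"
      then obtain e where e: "fst c = {e}" "c \<in> \<C>" unfolding S1_def by (auto simp: card_1_singleton_iff)
      then have "e < m1" "c = ({e}, snd c)" using csub(1)[of c] by (auto simp: prod_eq_iff)
      then show "c \<in> (\<lambda>(e, T). ({e}, T)) ` (SIGMA e:{..<m1}. \<T> e)"
        using e(2) by (intro image_eqI[of _ _ "(e, snd c)"]) (auto simp: \<T>_def)
    qed
  qed (auto simp: S1_def \<T>_def)
  have s1: "(\<Sum>c\<in>S1. g c + d * z c) \<le> A * int m1 - int (card Y)"
  proof -
    have "(\<Sum>c\<in>S1. g c + d * z c) = (\<Sum>(e, T)\<in>(SIGMA e:{..<m1}. \<T> e). g ({e}, T) + d * z ({e}, T))"
      unfolding S1_eq by (subst sum.reindex) (auto simp: inj_on_def intro!: sum.cong)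
    also have "\<dots> = (\<Sum>e<m1. \<Sum>T\<in>\<T> e. g ({e}, T) + d * z ({e}, T))"
      using \<T>_sub by (subst sum.Sigma) (auto intro: finite_subset)
    also have "\<dots> \<le> (\<Sum>e<m1. A - (if e \<in> Y then 1 else 0))"
    proof (rule sum_mono)
      fix e assume e: "e \<in> {..<m1}"
      have "(\<Sum>T\<in>\<T> e. g ({e}, T) + d * z ({e}, T)) = (\<Sum>T\<in>\<T> e. int (card T) - d + (if T = {} then d else 0))"
        by (intro sum.cong refl) (auto simp: g_def z_def)
      moreover have "e \<in> Y \<longleftrightarrow> {..<m2} \<notin> \<T> e"
        using e by (auto simp: Y_def \<T>_def)
      ultimately show "(\<Sum>T\<in>\<T> e. g ({e}, T) + d * z ({e}, T)) \<le> A - (if e \<in> Y then 1 else 0)"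
        using node[OF \<T>_sub[of e]] by auto
    qed
    also have "\<dots> = A * int m1 - (\<Sum>e<m1. if e \<in> Y then 1 else 0)"
      by (simp add: sum_subtractf)
    also have "(\<Sum>e<m1. if e \<in> Y then 1 else 0) = int (card Y)"
    proof -
      have "{..<m1} \<inter> {e. e \<in> Y} = Y" by (auto simp: Y_def)
      then show ?thesis by (simp add: sum.If_cases)
    qed
    finally show ?thesis .
  qed
  have total: "(\<Sum>c\<in>C'. g c + d * z c) \<le> A * int m1 - int (card Y)"
  proof -
    have "(\<Sum>c\<in>C'. g c + d * z c) = (\<Sum>c\<in>S1. g c + d * z c) + (\<Sum>c\<in>S2. g c + d * z c)"
      using C'_split by (simp add: sum.union_disjoint)
    moreover have "(\<Sum>c\<in>S2. g c + d * z c) \<le> 0" using s2 by (rule sum_nonpos)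
    ultimately show ?thesis using s1 by simp
  qed
  have Zc: "(\<Sum>c\<in>C'. z c) = int (card {c \<in> \<C>. fst c \<noteq> {} \<and> snd c = {}})"
  proof -
    have "C' \<inter> {c. snd c = {}} = {c \<in> \<C>. fst c \<noteq> {} \<and> snd c = {}}" by (auto simp: C'_def)
    then show ?thesis using finC' by (simp add: z_def sum.If_cases)
  qed
  have sumfst: "(\<Sum>c\<in>C'. int (card (fst c))) = int m1 * int n1"
  proof -
    have "(\<Sum>c\<in>\<C>. card (fst c)) = (\<Sum>e<m1. card {c \<in> \<C>. e \<in> fst c})"
      by (rule sum_card_incidences[OF fin]) (use csub in auto)
    also have "\<dots> = m1 * n1" using deg1 by simp
    finally have "(\<Sum>c\<in>\<C>. card (fst c)) = m1 * n1" .
    moreover have "(\<Sum>c\<in>\<C>. card (fst c)) = (\<Sum>c\<in>C'. card (fst c))"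
      using fin by (intro sum.mono_neutral_right) (auto simp: C'_def)
    ultimately have "(\<Sum>c\<in>C'. card (fst c)) = m1 * n1" by simp
    then show ?thesis by (metis of_nat_mult of_nat_sum)
  qed
  \<comment> \<open>Blocks that meet no small part are distinct sets of large parts, so there are at
    most \<open>2 ^ m2\<close> of them with at most \<open>m2\<close> elements each.\<close>
  have sumsnd: "int m2 * int n2 \<le> (\<Sum>c\<in>C'. int (card (snd c))) + int m2 * 2 ^ m2"
  proof -
    have "(\<Sum>c\<in>\<C>. card (snd c)) = (\<Sum>i<m2. card {c \<in> \<C>. i \<in> snd c})"
      by (rule sum_card_incidences[OF fin]) (use csub in auto)
    also have "\<dots> = m2 * n2" using deg2 by simp
    finally have 1: "(\<Sum>c\<in>\<C>. card (snd c)) = m2 * n2" .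
    have "(\<Sum>c\<in>\<C>. card (snd c)) = (\<Sum>c\<in>C'. card (snd c)) + (\<Sum>c\<in>\<C> - C'. card (snd c))"
      using fin by (metis (no_types, lifting) C'_def add.commute mem_Collect_eq subsetI sum.subset_diff)
    moreover have "(\<Sum>c\<in>\<C> - C'. card (snd c)) \<le> m2 * 2 ^ m2"
    proof -
      have sub: "\<C> - C' \<subseteq> Pair {} ` Pow {..<m2}"
      proof
        fix c assume "c \<in> \<C> - C'"
        then have "c = ({}, snd c)" "snd c \<subseteq> {..<m2}" using csub(2) by (auto simp: C'_def prod_eq_iff)
        then show "c \<in> Pair {} ` Pow {..<m2}" by (metis PowI image_eqI)
      qed
      have "(\<Sum>c\<in>\<C> - C'. card (snd c)) \<le> (\<Sum>c\<in>\<C> - C'. m2)"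
        using card_mono[OF _ csub(2)] by (intro sum_mono) fastforce
      also have "\<dots> = m2 * card (\<C> - C')" by simp
      also have "card (\<C> - C') \<le> card (Pair ({} :: nat set) ` Pow {..<m2})"
        using sub by (intro card_mono) auto
      also have "\<dots> = 2 ^ m2" by (simp add: card_image card_Pow inj_on_def)
      finally show ?thesis by simp
    qed
    ultimately have "m2 * n2 \<le> (\<Sum>c\<in>C'. card (snd c)) + m2 * 2 ^ m2" using 1 by simp
    then have "int (m2 * n2) \<le> int ((\<Sum>c\<in>C'. card (snd c)) + m2 * 2 ^ m2)" by (simp only: of_nat_le_iff)
    then show ?thesis by simp
  qed
  have "(\<Sum>c\<in>C'. g c + d * z c) = (\<Sum>c\<in>C'. int (card (snd c))) + mu * (int m1 * int n1 - int (card C'))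
      - d * (int m1 * int n1) + d * int (card {c \<in> \<C>. fst c \<noteq> {} \<and> snd c = {}})"
    unfolding g_def sum.distrib sum_subtractf sum_distrib_left[symmetric] Zc sumfst by simp
  \<comment> \<open>The summand 2 of \<open>n1\<close> contributes \<open>2 * d = m2 + mu\<close>,
    where \<open>m2\<close> belongs to \<open>R\<close>.\<close>
  moreover have "A + d * int n1 = R + mu"
  proof -
    have "A + d * (\<Sum>i=0..j. int (m2 choose i)) = (\<Sum>i=0..j. (int m2 - int i) * int (m2 choose i))"
      unfolding A_def sum_distrib_left sum.distrib[symmetric] d
      by (intro sum.cong refl) (simp add: algebra_simps)
    then show ?thesis unfolding R n1 mu d by (simp add: algebra_simps)
  qed
  then have "A * int m1 + d * (int m1 * int n1) = R * int m1 + mu * int m1"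
    by (metis (no_types, opaque_lifting) distrib_right mult.assoc mult.left_commute mult.commute)
  ultimately show ?thesis
    using total sumsnd unfolding Y_def C'_def by (simp add: algebra_simps)
qed

section \<open>Decreasing the size of the large parts by one\<close>

text \<open>Replacing the block \<open>({e}, {..<m2})\<close> by \<open>({e}, {})\<close> lowers the size of every large part by one.
  If this creates a symmetry \<open>(\<sigma>, \<pi>)\<close>, then \<open>\<sigma>\<close> moves the component of \<open>e\<close> onto one with a block of empty
  label at \<open>\<sigma> e\<close>, and as components are pairwise non-isomorphic and rigid, \<open>e\<close> is determined by
  \<open>\<sigma> e\<close> and \<open>\<pi>\<close>.\<close>

lemma pair_conf_pred:
  assumes conf: "pair_conf m1 n1 m2 n2 \<C>" and m2: "m2 > 0"
    and K: "\<And>e. e \<in> Q \<Longrightarrow> e \<in> K e \<and> K e \<subseteq> {..<m1} \<and> union_of_components \<C> (K e)"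
    and conn: "\<And>e U. e \<in> Q \<Longrightarrow> union_of_components \<C> U \<Longrightarrow> K e \<inter> U \<noteq> {} \<Longrightarrow> K e \<subseteq> U"
    and Zfree: "\<And>e D. e \<in> Q \<Longrightarrow> (D, {}) \<in> \<C> \<Longrightarrow> D \<noteq> {} \<Longrightarrow> D \<inter> K e = {}"
    and big: "\<And>e. e \<in> Q \<Longrightarrow> ({e}, {..<m2}) \<in> \<C>"
    and card: "card {c \<in> \<C>. fst c \<noteq> {} \<and> snd c = {}} * fact m2 < card Q"
  shows "\<exists>\<C>'. pair_conf m1 n1 m2 (n2 - 1) \<C>'"
proof (rule ccontr)
  assume no: "\<not> ?thesis"
  have fin: "finite \<C>" using conf by (rule pair_conf_finite)
  have deg1: "\<And>e. e < m1 \<Longrightarrow> card {c \<in> \<C>. e \<in> fst c} = n1"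
    and deg2: "\<And>i. i < m2 \<Longrightarrow> card {c \<in> \<C>. i \<in> snd c} = n2"
    using conf unfolding pair_conf_def by auto
  define N where "N e = insert ({e}, {}) (\<C> - {({e}, {..<m2})})" for e
  have emp: "({e}, {}) \<notin> \<C>" if "e \<in> Q" for e
    using Zfree[OF that, of "{e}"] K[OF that] by auto
  have em1: "e < m1" if "e \<in> Q" for e using K[OF that] by auto
  have NE: "c \<in> N e \<longleftrightarrow> c = ({e}, {}) \<or> c \<in> \<C> \<and> c \<noteq> ({e}, {..<m2})" for c e
    by (auto simp: N_def)
  have "\<exists>\<sigma> \<pi>. \<sigma> permutes {..<m1} \<and> \<pi> permutes {..<m2} \<and>
      map_prod ((`) \<sigma>) ((`) \<pi>) ` N e = N e \<and> \<not> (\<sigma> = id \<and> \<pi> = id)" if e: "e \<in> Q" for e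
  proof -
    have "\<not> pair_conf m1 n1 m2 (n2 - 1) (N e)" using no by blast
    moreover have "N e \<subseteq> Pow {..<m1} \<times> Pow {..<m2}"
      using conf em1[OF e] unfolding pair_conf_def N_def by auto
    moreover have "card {c \<in> N e. x \<in> fst c} = n1" if "x < m1" for x
    proof (cases "x = e")
      case True
      have "{c \<in> N e. x \<in> fst c} = insert ({e}, {}) ({c \<in> \<C>. x \<in> fst c} - {({e}, {..<m2})})"
        using True by (auto simp: N_def)
      also have "card \<dots> = Suc (card ({c \<in> \<C>. x \<in> fst c} - {({e}, {..<m2})}))"
        using emp[OF e] fin by (subst card_insert_disjoint) auto
      also have "\<dots> = card {c \<in> \<C>. x \<in> fst c}"
        using big[OF e] True fin by (intro card_Suc_Diff1) auto
      finally show ?thesis using deg1[OF that] by simp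
    next
      case False
      then have "{c \<in> N e. x \<in> fst c} = {c \<in> \<C>. x \<in> fst c}" by (auto simp: N_def)
      then show ?thesis using deg1[OF that] by simp
    qed
    moreover have "card {c \<in> N e. i \<in> snd c} = n2 - 1" if "i < m2" for i
    proof -
      have "{c \<in> N e. i \<in> snd c} = {c \<in> \<C>. i \<in> snd c} - {({e}, {..<m2})}"
        by (auto simp: N_def)
      then show ?thesis using big[OF e] that deg2[OF that] by simp
    qed
    ultimately show ?thesis unfolding pair_conf_def by blast
  qed
  then obtain S \<rho> where S: "\<And>e. e \<in> Q \<Longrightarrow> S e permutes {..<m1}"
    and \<rho>: "\<And>e. e \<in> Q \<Longrightarrow> \<rho> e permutes {..<m2}"
    and img: "\<And>e. e \<in> Q \<Longrightarrow> map_prod ((`) (S e)) ((`) (\<rho> e)) ` N e = N e"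
    and nontriv: "\<And>e. e \<in> Q \<Longrightarrow> \<not> (S e = id \<and> \<rho> e = id)"
    by metis
  have iff: "(S e ` D, \<rho> e ` T) \<in> N e \<longleftrightarrow> (D, T) \<in> N e" if e: "e \<in> Q" for e D T
  proof -
    have "map_prod ((`) (S e)) ((`) (\<rho> e)) (D, T) \<in> map_prod ((`) (S e)) ((`) (\<rho> e)) ` N e \<longleftrightarrow> (D, T) \<in> N e"
      by (rule inj_image_mem_iff[OF inj_map_prod_image[OF permutes_inj[OF S[OF e]] permutes_inj[OF \<rho>[OF e]]]])
    then show ?thesis unfolding img[OF e] by simp
  qed
  have Sinj: "S e ` D = S e ` D' \<longleftrightarrow> D = D'" if "e \<in> Q" for e D D'
    using permutes_inj[OF S[OF that]] by (rule inj_image_eq_iff)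
  \<comment> \<open>If \<open>e\<close> were fixed, undoing the replacement would leave the symmetry
    intact, contrary to the rigidity of \<open>\<C>\<close>.\<close>
  have moved: "S e e \<noteq> e" if e: "e \<in> Q" for e
  proof
    assume fixed: "S e e = e"
    have "(S e ` fst c, \<rho> e ` snd c) \<in> \<C>" if c: "c \<in> \<C>" for c
    proof (cases "c = ({e}, {..<m2})")
      case True
      then show ?thesis using big[OF e] fixed permutes_image[OF \<rho>[OF e]] by simp
    next
      case False
      then have "(fst c, snd c) \<in> N e" using c by (simp add: NE)
      then have "(S e ` fst c, \<rho> e ` snd c) \<in> N e" using iff[OF e] by blast
      moreover have "(S e ` fst c, \<rho> e ` snd c) \<noteq> ({e}, {})"
      proof
        assume "(S e ` fst c, \<rho> e ` snd c) = ({e}, {})"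
        then have "S e ` fst c = S e ` {e}" "snd c = {}" using fixed by auto
        then have "c = ({e}, {})" using Sinj[OF e] by (metis prod.collapse)
        then show False using emp[OF e] c by simp
      qed
      ultimately show ?thesis unfolding NE by blast
    qed
    from pair_conf_rigid[OF conf S[OF e] \<rho>[OF e] this] nontriv[OF e] show False by blast
  qed
  have zC: "({S e e}, {}) \<in> \<C>" if e: "e \<in> Q" for e
  proof -
    have "(S e ` {e}, \<rho> e ` {}) \<in> N e" unfolding iff[OF e] by (simp add: N_def)
    then show ?thesis using moved[OF e] by (simp add: NE)
  qed
  \<comment> \<open>Replacing a label does not change which sets of small parts occur, so the new
    family has the same components.\<close>
  have D_iff: "(\<exists>T. (D, T) \<in> N e) \<longleftrightarrow> (\<exists>T. (D, T) \<in> \<C>)" if "e \<in> Q" for e D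
    using big[OF that] by (auto simp: NE)
  have S_D: "(\<exists>T. (S e ` D, T) \<in> \<C>) \<longleftrightarrow> (\<exists>T. (D, T) \<in> \<C>)" if e: "e \<in> Q" for e D
  proof -
    have "(\<exists>T. (S e ` D, T) \<in> N e) \<longleftrightarrow> (\<exists>T. (D, T) \<in> N e)"
    proof
      assume "\<exists>T. (S e ` D, T) \<in> N e"
      then obtain T where T: "(S e ` D, T) \<in> N e" by blast
      then have "(S e ` D, T) \<in> map_prod ((`) (S e)) ((`) (\<rho> e)) ` N e" by (simp only: img[OF e])
      then obtain c where c: "(S e ` D, T) = map_prod ((`) (S e)) ((`) (\<rho> e)) c" "c \<in> N e"
        by (rule imageE)
      then have "S e ` D = S e ` fst c" by (cases c) simp
      then have "(D, snd c) \<in> N e" using Sinj[OF e] c(2) by simp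
      then show "\<exists>T. (D, T) \<in> N e" by blast
    next
      assume "\<exists>T. (D, T) \<in> N e"
      then show "\<exists>T. (S e ` D, T) \<in> N e" using iff[OF e] by blast
    qed
    then show ?thesis using D_iff[OF e] by simp
  qed
  \<comment> \<open>This stands in for the fact that a symmetry permutes components: preimages of
    unions of components are again unions of components.\<close>
  have comp_vimage: "union_of_components \<C> {x. h x \<in> U}"
    if h: "\<And>D. \<exists>T. (D, T) \<in> \<C> \<Longrightarrow> \<exists>T. (h ` D, T) \<in> \<C>" and U: "union_of_components \<C> U" for h U
    unfolding union_of_components_def
  proof
    fix c assume "c \<in> \<C>"
    then have "\<exists>T. (fst c, T) \<in> \<C>" by (metis prod.collapse)
    from h[OF this] obtain T where "(h ` fst c, T) \<in> \<C>" by blast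
    then have "h ` fst c \<inter> U = {} \<or> h ` fst c \<subseteq> U"
      using U by (fastforce simp: union_of_components_def)
    then show "fst c \<inter> {x. h x \<in> U} = {} \<or> fst c \<subseteq> {x. h x \<in> U}" by blast
  qed
  have zK: "S e e \<notin> K f" if "e \<in> Q" "f \<in> Q" for e f
    using Zfree[OF that(2) zC[OF that(1)]] by auto
  \<comment> \<open>The image of \<open>K e\<close> contains \<open>S e e\<close>, which has a block
    of empty label, while no \<open>K f\<close> meets such a block; connectedness keeps the whole
    image apart from \<open>K f\<close>.\<close>
  have away: "S e x \<notin> K f" if e: "e \<in> Q" and f: "f \<in> Q" and x: "x \<in> K e" for e f x
  proof
    assume "S e x \<in> K f"
    have "union_of_components \<C> {x. S e x \<in> K f}"
      using S_D[OF e] K[OF f] by (intro comp_vimage) auto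
    then have "K e \<subseteq> {x. S e x \<in> K f}"
      using conn[OF e] x \<open>S e x \<in> K f\<close> by blast
    then show False using zK[OF e f] K[OF e] by blast
  qed
  \<comment> \<open>If \<open>e\<close> and \<open>f\<close> have the same target and the same
    action on large parts, one symmetry followed by the inverse of the other carries the original
    blocks on \<open>K e\<close> to original blocks. The intermediate images avoid both altered
    points; the replaced block itself is treated separately.\<close>
  have transfer: "(inv (S f) ` S e ` D, T) \<in> \<C>"
    if e: "e \<in> Q" and f: "f \<in> Q" and eq: "S e e = S f f" "\<rho> e = \<rho> f"
      and D: "(D, T) \<in> \<C>" "D \<noteq> {}" "D \<subseteq> K e" for e f D T
  proof -
    have invS: "S f (inv (S f) x) = x" "inv (S f) (S f x) = x" for x
      using permutes_inverses[OF S[OF f]] by auto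
    let ?D = "inv (S f) ` S e ` D"
    have SfD: "S f ` ?D = S e ` D" by (simp only: image_image invS)
    show ?thesis
    proof (cases "(D, T) = ({e}, {..<m2})")
      case True
      then have "?D = {f}" using eq(1) invS(2)[of f] by simp
      then show ?thesis using True big[OF f] by simp
    next
      case False
      then have "(D, T) \<in> N e" using D(1) by (simp add: NE)
      then have "(S e ` D, \<rho> e ` T) \<in> N e" using iff[OF e] by blast
      moreover have ne: "g \<notin> S e ` D" if g: "g \<in> Q" "g = e \<or> g = f" for g
      proof
        assume "g \<in> S e ` D"
        then obtain y where y: "g = S e y" "y \<in> D" by (rule imageE)
        have "y \<in> K e" using y(2) D(3) by (rule subsetD[rotated])
        then have "S e y \<notin> K g" by (rule away[OF e g(1)])
        then show False using K[OF g(1)] y(1) by simp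
      qed
      have "S e ` D \<noteq> {e}" "S e ` D \<noteq> {f}" using ne[OF e] ne[OF f] by auto
      ultimately have "(S e ` D, \<rho> e ` T) \<in> \<C>" "S e ` D \<noteq> {f}" by (simp_all add: NE)
      then have "(S f ` ?D, \<rho> f ` T) \<in> N f" unfolding SfD using eq(2) by (simp add: NE)
      then have "(?D, T) \<in> N f" using iff[OF f] by blast
      moreover have "T \<noteq> {}" using Zfree[OF e, of D] D by blast
      ultimately show ?thesis by (simp add: NE)
    qed
  qed
  let ?Z = "{c \<in> \<C>. fst c \<noteq> {} \<and> snd c = {}}"
  \<comment> \<open>Each \<open>e\<close> is assigned a block of empty label and a permutation of
    the large parts. Injectivity of this assignment contradicts the size of
    \<open>Q\<close>.\<close>
  let ?F = "\<lambda>e. (({S e e}, {} :: nat set), \<rho> e)"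
  have "inj_on ?F Q"
  proof (rule inj_onI, rule ccontr)
    fix e f assume e: "e \<in> Q" and f: "f \<in> Q" and F: "?F e = ?F f" and ef: "e \<noteq> f"
    have eq: "S e e = S f f" "\<rho> e = \<rho> f" using F by auto
    have inve: "S e (inv (S e) x) = x" "inv (S e) (S e x) = x" for x
      using permutes_inverses[OF S[OF e]] by auto
    have invf: "S f (inv (S f) x) = x" "inv (S f) (S f x) = x" for x
      using permutes_inverses[OF S[OF f]] by auto
    have Dh: "\<exists>T. (inv (S b) ` S a ` D, T) \<in> \<C>" if a: "a \<in> Q" and b: "b \<in> Q" and D: "\<exists>T. (D, T) \<in> \<C>" for a b D
    proof -
      have "S b (inv (S b) x) = x" for x using permutes_inverses[OF S[OF b]] by auto
      then have "S b ` (inv (S b) ` S a ` D) = S a ` D" by (simp only: image_image)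
      then show ?thesis using S_D[OF a, of D] S_D[OF b, of "inv (S b) ` S a ` D"] D by simp
    qed
    have into: "inv (S b) (S a x) \<in> K b" if a: "a \<in> Q" and b: "b \<in> Q" and ab: "S a a = S b b"
      and x: "x \<in> K a" for a b x
    proof -
      have "union_of_components \<C> {x. inv (S b) (S a x) \<in> K b}"
        using Dh[OF a b] K[OF b] by (intro comp_vimage) (auto simp: image_image)
      moreover have "a \<in> {x. inv (S b) (S a x) \<in> K b}"
        using ab K[OF b] permutes_inverses(2)[OF S[OF b], of b] by simp
      ultimately have "K a \<subseteq> {x. inv (S b) (S a x) \<in> K b}" using conn[OF a] K[OF a] by blast
      then show ?thesis using x by blast
    qed
    define \<psi> where "\<psi> x = inv (S f) (S e x)" for x
    have bij: "bij_betw \<psi> (K e) (K f)"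
    proof (rule bij_betw_byWitness[where f' = "\<lambda>y. inv (S e) (S f y)"])
      show "\<forall>a\<in>K e. inv (S e) (S f (\<psi> a)) = a" by (simp add: \<psi>_def inve invf)
      show "\<forall>a\<in>K f. \<psi> (inv (S e) (S f a)) = a" by (simp add: \<psi>_def inve invf)
      show "\<psi> ` K e \<subseteq> K f" using into[OF e f eq(1)] by (auto simp: \<psi>_def)
      show "(\<lambda>y. inv (S e) (S f y)) ` K f \<subseteq> K e" using into[OF f e eq(1)[symmetric]] by auto
    qed
    have Kdisj: "K e = K f \<or> K e \<inter> K f = {}"
      using conn[OF e, of "K f"] conn[OF f, of "K e"] K[OF e] K[OF f] by blast
    have "\<psi> e = e"
    proof (rule component_iso_trivial[OF conf _ _ _ _ Kdisj bij])
      fix D T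
      { assume "(D, T) \<in> \<C>" "D \<noteq> {}" "D \<subseteq> K e"
        from transfer[OF e f eq this] show "(\<psi> ` D, T) \<in> \<C>" by (simp add: \<psi>_def image_image) }
      { assume D: "(\<psi> ` D, T) \<in> \<C>" "D \<noteq> {}" "D \<subseteq> K e"
        have "\<psi> ` D \<noteq> {}" "\<psi> ` D \<subseteq> K f" using D bij by (auto simp: bij_betw_def)
        from transfer[OF f e eq(1)[symmetric] eq(2)[symmetric] D(1) this]
        have "(inv (S e) ` S f ` \<psi> ` D, T) \<in> \<C>" .
        moreover have "inv (S e) ` S f ` \<psi> ` D = D" by (simp add: \<psi>_def image_image inve invf)
        ultimately show "(D, T) \<in> \<C>" by simp }
    qed (use K[OF e] K[OF f] in auto)
    moreover have "\<psi> e = f" using eq(1) invf(2)[of f] by (simp add: \<psi>_def)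
    ultimately show False using ef by simp
  qed
  moreover have "?F ` Q \<subseteq> ?Z \<times> {\<pi>. \<pi> permutes {..<m2}}"
    using zC \<rho> by auto
  moreover have "finite (?Z \<times> {\<pi>. \<pi> permutes {..<m2}})"
    using fin by (auto intro: finite_permutations)
  ultimately have "card Q \<le> card (?Z \<times> {\<pi>. \<pi> permutes {..<m2}})"
    by (rule card_inj_on_le)
  also have "\<dots> = card ?Z * fact m2"
    by (simp add: card_cartesian_product card_permutations[of "{..<m2}" m2])
  finally show False using card by simp
qed

section \<open>A rigid path forest\<close>

text \<open>The points below \<open>x\<close> form an anchor path, made rigid by the blocks \<open>[0, m2 + 3 + l)\<close> and
  \<open>[m2 + 3 + l, x)\<close>; it spends no weight apart from that of its edges and its edge labels pin down the
  large parts. The other points form \<open>np\<close> paths of \<open>s\<close> points each, told apart by the families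
  \<open>Lab e\<close> of labels of the blocks that meet only the small part \<open>e\<close>. The labels of the edges in \<open>R\<close>
  are free, which tunes the size of the large parts.\<close>

locale path_forest =
  fixes m1 n1 m2 x s np :: nat and Lab :: "nat \<Rightarrow> nat set set" and E R :: "nat set"
  assumes n1: "n1 \<ge> 3" and m1: "m1 = x + np * s" and x: "x \<ge> 2 * (m2 + 3) + n1" and s: "s \<ge> 3"
    and E: "E = {e. e + 1 < x} \<union> {e. x \<le> e \<and> e < m1 \<and> (e - x) mod s \<noteq> s - 1}"
    and R: "R \<subseteq> E - {..<m2}"
    and Lab_sub: "\<And>e. Lab e \<subseteq> Pow {..<m2}"
    and Lab_anchor: "\<And>e. e < x \<Longrightarrow> Lab e = (if e = 0 \<or> e + 1 = x then {{}} else {})"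
    and Lab_card: "\<And>t i. t < np \<Longrightarrow> i < s \<Longrightarrow>
      card (Lab (x + t * s + i)) = n1 - 2 + (if i = 0 \<or> i = s - 1 then 1 else 0)"
    and Lab_code: "\<And>t t'. t < np \<Longrightarrow> t' < np \<Longrightarrow>
      (\<And>i. i < s \<Longrightarrow> Lab (x + t * s + i) = Lab (x + t' * s + i)) \<Longrightarrow> t = t'"
    and Lab_no_reversal: "\<And>t t'. t < np \<Longrightarrow> t' < np \<Longrightarrow>
      Lab (x + t * s + 1) \<noteq> Lab (x + t' * s + (s - 2))"
begin

definition edge_label :: "nat \<Rightarrow> nat set" where
  "edge_label e = (if e < m2 then {e} else if e \<in> R then {..<m2} else {})"

definition edge_blocks :: "(nat set \<times> nat set) set" where
  "edge_blocks = (\<lambda>e. ({e, e + 1}, edge_label e)) ` E"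

definition single_blocks :: "(nat set \<times> nat set) set" where
  "single_blocks = (\<lambda>(e, T). ({e}, T)) ` (SIGMA e:{..<m1}. Lab e)"

text \<open>For each \<open>l\<close> the two blocks are complementary in the anchor, so every
  anchor point gains exactly \<open>n1 - 2\<close> incidences. All these blocks have at least
  \<open>m2 + 3\<close> points, more than an edge block has parts in all, and the lower bound on
  \<open>x\<close> makes the initial segment of length \<open>m2 + 3\<close> the only one of that
  size.\<close>

definition anchor_blocks :: "(nat set \<times> nat set) set" where
  "anchor_blocks = (\<lambda>l. ({..<m2 + 3 + l}, {})) ` {..<n1 - 2} \<union>
     (\<lambda>l. ({m2 + 3 + l..<x}, {})) ` {..<n1 - 2}"

definition conf :: "(nat set \<times> nat set) set" where
  "conf = edge_blocks \<union> single_blocks \<union> anchor_blocks"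

lemma E_less: "e \<in> E \<Longrightarrow> e + 1 < m1"
proof -
  assume e: "e \<in> E"
  show "e + 1 < m1"
  proof (cases "e + 1 < x")
    case False
    then have e': "x \<le> e" "e < m1" "(e - x) mod s \<noteq> s - 1" using e E by auto
    then have "(e - x) div s < np" using m1 s by (simp add: less_mult_imp_div_less)
    have "(e - x) mod s < s" using s by simp
    then have "(e - x) mod s < s - 1" using e'(3) by linarith
    moreover have "q * s + r + 1 < (q + 1) * s" if "r < s - 1" for q r using that by simp
    ultimately have "(e - x) div s * s + (e - x) mod s + 1 < ((e - x) div s + 1) * s" by blast
    then have "e - x + 1 < ((e - x) div s + 1) * s" by (simp only: div_mult_mod_eq)
    also have "\<dots> \<le> np * s" using \<open>(e - x) div s < np\<close> by (intro mult_le_mono1) simp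
    finally show ?thesis using m1 e'(1) by simp
  qed (use m1 in simp)
qed

lemma path_point:
  assumes "x \<le> e" "e < m1"
  shows "\<exists>t<np. \<exists>i<s. e = x + t * s + i"
proof (intro exI conjI)
  show "(e - x) div s < np" using assms m1 by (simp add: less_mult_imp_div_less)
  show "(e - x) mod s < s" using s by simp
  show "e = x + (e - x) div s * s + (e - x) mod s" using assms by simp
qed

lemma path_less: "t < np \<Longrightarrow> i < s \<Longrightarrow> x + t * s + i < m1"
proof -
  assume "t < np" "i < s"
  then have "t * s + i < (t + 1) * s" by simp
  also have "\<dots> \<le> np * s" using \<open>t < np\<close> by (intro mult_le_mono1) simp
  finally show ?thesis using m1 by simp
qed

lemma path_E: "t < np \<Longrightarrow> i < s \<Longrightarrow> x + t * s + i \<in> E \<longleftrightarrow> i \<noteq> s - 1"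
  using path_less[of t i] by (auto simp: E add.assoc)

lemma path_pred_E:
  assumes "t < np" "i < s"
  shows "(\<exists>e\<in>E. x + t * s + i = e + 1) \<longleftrightarrow> i \<noteq> 0"
proof
  assume "\<exists>e\<in>E. x + t * s + i = e + 1"
  then obtain e where e: "e \<in> E" "x + t * s + i = e + 1" by blast
  show "i \<noteq> 0"
  proof
    assume i: "i = 0"
    show False
    proof (cases t)
      case 0
      then show False using e i by (auto simp: E)
    next
      case (Suc u)
      then have "e = x + u * s + (s - 1)" using e(2) i s by simp
      then show False using path_E[of u "s - 1"] e(1) Suc assms(1) s by simp
    qed
  qed
next
  assume "i \<noteq> 0"
  then have "x + t * s + i = (x + t * s + (i - 1)) + 1" "x + t * s + (i - 1) \<in> E"
    using path_E[of t "i - 1"] assms by auto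
  then show "\<exists>e\<in>E. x + t * s + i = e + 1" by blast
qed

lemma anchor_E: "e < x \<Longrightarrow> e \<in> E \<longleftrightarrow> e + 1 < x"
  by (auto simp: E)

lemma edge_blocks_card: "c \<in> edge_blocks \<Longrightarrow> card (fst c) = 2"
  by (auto simp: edge_blocks_def)

lemma single_blocks_card: "c \<in> single_blocks \<Longrightarrow> card (fst c) = 1"
  by (auto simp: single_blocks_def)

lemma anchor_blocks_cases:
  assumes "c \<in> anchor_blocks"
  shows "snd c = {}" "fst c \<subseteq> {..<x}" "m2 + 3 \<le> card (fst c)"
    "card (fst c) = m2 + 3 \<Longrightarrow> fst c = {..<m2 + 3}"
proof -
  obtain l where l: "l < n1 - 2" and c: "c = ({..<m2 + 3 + l}, {}) \<or> c = ({m2 + 3 + l..<x}, {})"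
    using assms by (auto simp: anchor_blocks_def)
  show "snd c = {}" "fst c \<subseteq> {..<x}" "m2 + 3 \<le> card (fst c)"
    "card (fst c) = m2 + 3 \<Longrightarrow> fst c = {..<m2 + 3}"
    using c l x by auto
qed

lemma blocks_disjoint:
  "edge_blocks \<inter> single_blocks = {}" "edge_blocks \<inter> anchor_blocks = {}"
  "single_blocks \<inter> anchor_blocks = {}"
  using edge_blocks_card single_blocks_card anchor_blocks_cases(3) by fastforce+

lemma conf_card2: "c \<in> conf \<Longrightarrow> card (fst c) = 2 \<Longrightarrow> c \<in> edge_blocks"
  using single_blocks_card[of c] anchor_blocks_cases(3)[of c] by (auto simp: conf_def)

lemma conf_card1: "c \<in> conf \<Longrightarrow> card (fst c) = 1 \<Longrightarrow> c \<in> single_blocks"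
  using edge_blocks_card[of c] anchor_blocks_cases(3)[of c] by (auto simp: conf_def)

lemma conf_first_anchor: "c \<in> conf \<Longrightarrow> card (fst c) = m2 + 3 \<Longrightarrow> fst c = {..<m2 + 3}"
  using edge_blocks_card[of c] single_blocks_card[of c] anchor_blocks_cases(4)[of c]
  by (auto simp: conf_def)

lemma single_mem_conf: "({e}, T) \<in> conf \<longleftrightarrow> e < m1 \<and> T \<in> Lab e"
proof
  assume "({e}, T) \<in> conf"
  then have "({e}, T) \<in> single_blocks" by (rule conf_card1) simp
  then show "e < m1 \<and> T \<in> Lab e" by (auto simp: single_blocks_def)
next
  assume "e < m1 \<and> T \<in> Lab e"
  then have "({e}, T) \<in> single_blocks" unfolding single_blocks_def by force
  then show "({e}, T) \<in> conf" by (simp add: conf_def)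
qed

lemma finite_E: "finite E"
  using E_less by (intro finite_subset[of E "{..<m1}"]) fastforce+

lemma finite_Lab: "finite (Lab e)"
  using Lab_sub[of e] finite_subset by auto

lemma finite_blocks: "finite edge_blocks" "finite single_blocks" "finite anchor_blocks" "finite conf"
proof -
  show "finite edge_blocks" "finite single_blocks" "finite anchor_blocks"
    using finite_E finite_Lab by (auto simp: edge_blocks_def single_blocks_def anchor_blocks_def)
  then show "finite conf" by (simp add: conf_def)
qed

section \<open>Degrees of the small and the large parts\<close>

lemma card_conf_filter:
  "card {c \<in> conf. P c} =
     card {c \<in> edge_blocks. P c} + card {c \<in> single_blocks. P c} + card {c \<in> anchor_blocks. P c}"
proof -
  let ?f = "\<lambda>A. {c \<in> A. P c}"
  have "card (?f (edge_blocks \<union> single_blocks) \<union> ?f anchor_blocks) =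
      card (?f (edge_blocks \<union> single_blocks)) + card (?f anchor_blocks)"
    using blocks_disjoint finite_blocks by (intro card_Un_disjoint) auto
  moreover have "card (?f edge_blocks \<union> ?f single_blocks) = card (?f edge_blocks) + card (?f single_blocks)"
    using blocks_disjoint finite_blocks by (intro card_Un_disjoint) auto
  moreover have "?f (edge_blocks \<union> single_blocks) = ?f edge_blocks \<union> ?f single_blocks"
    "{c \<in> conf. P c} = ?f (edge_blocks \<union> single_blocks) \<union> ?f anchor_blocks"
    by (auto simp: conf_def)
  ultimately show ?thesis by simp
qed

lemma inj_edge: "inj_on (\<lambda>e. ({e, e + 1}, edge_label e)) A"
  by (auto simp: inj_on_def doubleton_eq_iff)

lemma card_edge_blocks_filter:
  "card {c \<in> edge_blocks. P c} = card {e \<in> E. P ({e, e + 1}, edge_label e)}"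
proof -
  have "{c \<in> edge_blocks. P c} = (\<lambda>e. ({e, e + 1}, edge_label e)) ` {e \<in> E. P ({e, e + 1}, edge_label e)}"
    unfolding edge_blocks_def by blast
  then show ?thesis using inj_edge by (simp add: card_image)
qed

lemma card_single_blocks_filter:
  "card {c \<in> single_blocks. P c} = (\<Sum>e<m1. card {T \<in> Lab e. P ({e}, T)})"
proof -
  let ?S = "SIGMA e:{..<m1}. {T \<in> Lab e. P ({e}, T)}"
  have "{c \<in> single_blocks. P c} = (\<lambda>(e, T). ({e}, T)) ` ?S"
    unfolding single_blocks_def by fastforce
  moreover have "inj_on (\<lambda>(e, T). ({e}, T)) ?S"
    by (auto simp: inj_on_def)
  ultimately have "card {c \<in> single_blocks. P c} = card ?S"
    by (simp add: card_image)
  then show ?thesis using finite_Lab by (simp add: card_SigmaI)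
qed

text \<open>Exactly one block of each complementary pair contains \<open>p\<close>. An initial
  segment contains 0 and its complement does not, so blocks chosen for different \<open>l\<close>
  differ.\<close>

lemma card_anchor_blocks_point:
  assumes "p < m1"
  shows "card {c \<in> anchor_blocks. p \<in> fst c} = (if p < x then n1 - 2 else 0)"
proof (cases "p < x")
  case True
  define f where "f l = (if p < m2 + 3 + l then ({..<m2 + 3 + l}, {} :: nat set)
    else ({m2 + 3 + l..<x}, {}))" for l
  have "{c \<in> anchor_blocks. p \<in> fst c} = f ` {..<n1 - 2}"
    using True by (auto simp: anchor_blocks_def f_def image_iff) 
  moreover have "inj_on f {..<n1 - 2}"
  proof (rule inj_onI)
    fix l l' assume l: "l \<in> {..<n1 - 2}" "l' \<in> {..<n1 - 2}" "f l = f l'"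
    have ne: "{..<m2 + 3 + a} \<noteq> {m2 + 3 + b..<x}" for a b
    proof
      assume "{..<m2 + 3 + a} = {m2 + 3 + b..<x}"
      moreover have "0 \<in> {..<m2 + 3 + a}" by simp
      moreover have "0 \<notin> {m2 + 3 + b..<x}" by simp
      ultimately show False by blast
    qed
    have "m2 + 3 + l < x" "m2 + 3 + l' < x" using l x by auto
    then show "l = l'"
      using l(3) ne ne[symmetric] by (auto simp: f_def atLeastLessThan_eq_iff split: if_splits)
  qed
  ultimately show ?thesis using True by (simp add: card_image)
next
  case False
  then have "{c \<in> anchor_blocks. p \<in> fst c} = {}" using anchor_blocks_cases(2) by fastforce
  then have "card {c \<in> anchor_blocks. p \<in> fst c} = 0" by (simp only: card.empty)
  then show ?thesis using False by (simp only: if_False)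
qed

lemma card_edge_blocks_point:
  "card {e \<in> E. p = e \<or> p = e + 1} = (if p \<in> E then 1 else 0) + (if \<exists>e\<in>E. p = e + 1 then 1 else 0)"
proof -
  have "{e \<in> E. p = e \<or> p = e + 1} = {e \<in> E. p = e} \<union> {e \<in> E. p = e + 1}" by blast
  also have "card \<dots> = card {e \<in> E. p = e} + card {e \<in> E. p = e + 1}"
    using finite_E by (intro card_Un_disjoint) auto
  also have "{e \<in> E. p = e} = (if p \<in> E then {p} else {})" by auto
  also have "{e \<in> E. p = e + 1} = (if \<exists>e\<in>E. p = e + 1 then {p - 1} else {})" by auto
  finally show ?thesis by auto
qed

lemma conf_degree:
  assumes p: "p < m1"
  shows "card {c \<in> conf. p \<in> fst c} = n1"
proof -
  have "{e \<in> E. p \<in> fst ({e, e + 1}, edge_label e)} = {e \<in> E. p = e \<or> p = e + 1}" by auto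
  then have ed: "card {c \<in> edge_blocks. p \<in> fst c} =
      (if p \<in> E then 1 else 0) + (if \<exists>e\<in>E. p = e + 1 then 1 else 0)"
    using card_edge_blocks_filter[of "\<lambda>c. p \<in> fst c"] card_edge_blocks_point by simp
  have "card {T \<in> Lab e. p \<in> fst ({e}, T)} = (if e = p then card (Lab p) else 0)" for e
    by auto
  then have si: "card {c \<in> single_blocks. p \<in> fst c} = card (Lab p)"
    using card_single_blocks_filter[of "\<lambda>c. p \<in> fst c"] p by simp
  have eq: "card {c \<in> conf. p \<in> fst c} = (if p \<in> E then 1 else 0) + (if \<exists>e\<in>E. p = e + 1 then 1 else 0)
      + card (Lab p) + (if p < x then n1 - 2 else 0)"
    unfolding card_conf_filter ed si card_anchor_blocks_point[OF p] by simp
  show ?thesis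
  proof (cases "p < x")
    case True
    have "(\<exists>e\<in>E. p = e + 1) \<longleftrightarrow> p \<noteq> 0"
    proof
      assume "p \<noteq> 0"
      then have "p - 1 \<in> E" "p = (p - 1) + 1" using True by (auto simp: E)
      then show "\<exists>e\<in>E. p = e + 1" by blast
    qed auto
    then show ?thesis unfolding eq using True anchor_E[OF True] Lab_anchor[OF True] n1 x by auto
  next
    case False
    then obtain t i where ti: "t < np" "i < s" "p = x + t * s + i" using path_point p by (meson not_less)
    have "p \<in> E \<longleftrightarrow> i \<noteq> s - 1" "(\<exists>e\<in>E. p = e + 1) \<longleftrightarrow> i \<noteq> 0"
      unfolding ti(3) by (rule path_E[OF ti(1,2)], rule path_pred_E[OF ti(1,2)])
    then show ?thesis unfolding eq using False Lab_card[OF ti(1,2)] ti(3) n1 s by auto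
  qed
qed

text \<open>The 1 comes from the edge \<open>i\<close>, whose label is \<open>{i}\<close>; every
  edge in \<open>R\<close> carries the full label.\<close>

lemma conf_colour_degree:
  assumes i: "i < m2"
  shows "card {c \<in> conf. i \<in> snd c} = 1 + card R + (\<Sum>e<m1. card {T \<in> Lab e. i \<in> T})"
proof -
  have iE: "i \<in> E" using i x by (auto simp: E)
  have "{e \<in> E. i \<in> snd ({e, e + 1}, edge_label e)} = insert i R"
    using iE R i by (auto simp: edge_label_def split: if_splits)
  moreover have "i \<notin> R" "finite R" using R i finite_E by (auto intro: finite_subset)
  ultimately have "card {c \<in> edge_blocks. i \<in> snd c} = 1 + card R"
    using card_edge_blocks_filter[of "\<lambda>c. i \<in> snd c"] by simp
  moreover have "card {c \<in> anchor_blocks. i \<in> snd c} = card ({} :: nat set set)"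
  proof -
    have "{c \<in> anchor_blocks. i \<in> snd c} = {}" using anchor_blocks_cases(1) by blast
    then show ?thesis by (simp only: card.empty)
  qed
  ultimately show ?thesis
    unfolding card_conf_filter card_single_blocks_filter by simp
qed

lemma conf_sub: "conf \<subseteq> Pow {..<m1} \<times> Pow {..<m2}"
proof -
  have "edge_blocks \<subseteq> Pow {..<m1} \<times> Pow {..<m2}"
  proof
    fix c assume "c \<in> edge_blocks"
    then obtain e where e: "c = ({e, e + 1}, edge_label e)" "e \<in> E"
      unfolding edge_blocks_def by (rule imageE)
    then show "c \<in> Pow {..<m1} \<times> Pow {..<m2}"
      using E_less[OF e(2)] by (auto simp: edge_label_def)
  qed
  moreover have "single_blocks \<subseteq> Pow {..<m1} \<times> Pow {..<m2}"
    using Lab_sub by (fastforce simp: single_blocks_def)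
  moreover have "anchor_blocks \<subseteq> Pow {..<m1} \<times> Pow {..<m2}"
  proof
    fix c assume "c \<in> anchor_blocks"
    from anchor_blocks_cases(1,2)[OF this] show "c \<in> Pow {..<m1} \<times> Pow {..<m2}"
      using m1 by (auto simp: mem_Times_iff)
  qed
  ultimately show ?thesis by (simp add: conf_def)
qed

section \<open>Symmetries of the path forest\<close>

definition adj :: "nat \<Rightarrow> nat \<Rightarrow> bool" where
  "adj u v \<longleftrightarrow> u \<in> E \<and> v = u + 1 \<or> v \<in> E \<and> u = v + 1"

lemma adj_anchor:
  assumes "u < x"
  shows "adj u v \<longleftrightarrow> u + 1 < x \<and> v = u + 1 \<or> u = v + 1"
  using assms anchor_E by (auto simp: adj_def)

lemma adj_path:
  assumes "t < np" "i < s"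
  shows "adj (x + t * s + i) v \<longleftrightarrow>
    i \<noteq> s - 1 \<and> v = x + t * s + i + 1 \<or> i \<noteq> 0 \<and> x + t * s + i = v + 1"
  using path_E[OF assms] path_pred_E[OF assms] by (auto simp: adj_def)

definition preserving :: "(nat \<Rightarrow> nat) \<Rightarrow> (nat \<Rightarrow> nat) \<Rightarrow> bool" where
  "preserving \<sigma> \<pi> \<longleftrightarrow> \<sigma> permutes {..<m1} \<and> \<pi> permutes {..<m2} \<and>
     (\<forall>D T. (\<sigma> ` D, \<pi> ` T) \<in> conf \<longleftrightarrow> (D, T) \<in> conf)"

lemma preserving_inv:
  assumes "preserving \<sigma> \<pi>"
  shows "preserving (inv \<sigma>) (inv \<pi>)"
proof -
  have p: "\<sigma> permutes {..<m1}" "\<pi> permutes {..<m2}"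
    using assms by (auto simp: preserving_def)
  have "\<sigma> ` inv \<sigma> ` D = D" "\<pi> ` inv \<pi> ` T = T" for D T
    unfolding image_image permutes_inverses[OF p(1)] permutes_inverses[OF p(2)] by simp_all
  then have "(inv \<sigma> ` D, inv \<pi> ` T) \<in> conf \<longleftrightarrow> (D, T) \<in> conf" for D T
    using assms unfolding preserving_def by metis
  then show ?thesis
    using permutes_inv[OF p(1)] permutes_inv[OF p(2)] by (simp add: preserving_def)
qed

text \<open>Edge blocks are the only blocks with exactly two small parts, so a symmetry permutes
  them together with their labels.\<close>

lemma preserving_edge:
  assumes "preserving \<sigma> \<pi>" "e \<in> E"
  shows "\<exists>e'\<in>E. \<sigma> ` {e, e + 1} = {e', e' + 1} \<and> \<pi> ` edge_label e = edge_label e'"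
proof -
  have "({e, e + 1}, edge_label e) \<in> conf"
    using assms(2) by (simp add: conf_def edge_blocks_def)
  then have m: "(\<sigma> ` {e, e + 1}, \<pi> ` edge_label e) \<in> conf"
    using assms(1) unfolding preserving_def by blast
  have "inj \<sigma>" using assms(1) permutes_inj by (auto simp: preserving_def)
  then have "card (\<sigma> ` {e, e + 1}) = card {e, e + 1}"
    by (rule card_image[OF inj_on_subset[OF _ subset_UNIV]])
  then have "(\<sigma> ` {e, e + 1}, \<pi> ` edge_label e) \<in> edge_blocks"
    using conf_card2[OF m] by simp
  then show ?thesis unfolding edge_blocks_def by blast
qed

lemma preserving_adj:
  assumes "preserving \<sigma> \<pi>" "adj u v"
  shows "adj (\<sigma> u) (\<sigma> v)"
proof -
  have inj: "inj \<sigma>" using assms(1) permutes_inj by (auto simp: preserving_def)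
  have *: "adj (\<sigma> e) (\<sigma> (e + 1)) \<and> adj (\<sigma> (e + 1)) (\<sigma> e)" if e: "e \<in> E" for e
  proof -
    obtain e' where e': "e' \<in> E" "\<sigma> ` {e, e + 1} = {e', e' + 1}"
      using preserving_edge[OF assms(1) e] by blast
    then have "{\<sigma> e, \<sigma> (e + 1)} = {e', e' + 1}" by simp
    then have "\<sigma> e = e' \<and> \<sigma> (e + 1) = e' + 1 \<or> \<sigma> e = e' + 1 \<and> \<sigma> (e + 1) = e'"
      by (simp only: doubleton_eq_iff)
    then show ?thesis using e'(1) unfolding adj_def by auto
  qed
  from assms(2) show ?thesis unfolding adj_def[of u v] using * by auto
qed

text \<open>The only neighbour of \<open>v 0\<close> is \<open>v 1\<close>, and the inner
  \<open>v (i + 1)\<close> has no neighbours except those next to it in the sequence. So the image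
  of a walk that never turns back has no choice: injectivity excludes the step back to
  \<open>v i\<close>.\<close>

lemma walk:
  fixes u v :: "nat \<Rightarrow> nat"
  assumes pres: "preserving \<sigma> \<pi>"
    and u: "\<And>i. i + 1 < n \<Longrightarrow> adj (u i) (u (i + 1))" "\<And>i. i + 2 < n \<Longrightarrow> u i \<noteq> u (i + 2)"
    and v: "\<And>w. 1 < n \<Longrightarrow> adj (v 0) w \<Longrightarrow> w = v 1"
      "\<And>i w. i + 2 < n \<Longrightarrow> adj (v (i + 1)) w \<Longrightarrow> w = v i \<or> w = v (i + 2)"
    and start: "\<sigma> (u 0) = v 0" and i: "i < n"
  shows "\<sigma> (u i) = v i"
  using i
proof (induction i rule: less_induct)
  case (less i)
  have inj: "inj \<sigma>" using pres permutes_inj by (auto simp: preserving_def)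
  consider "i = 0" | "i = 1" | h where "i = h + 2"
    by (metis One_nat_def Suc_1 add_2_eq_Suc' not0_implies_Suc)
  then show ?case
  proof cases
    case 2
    have "adj (\<sigma> (u 0)) (\<sigma> (u 1))"
      using preserving_adj[OF pres u(1)[of 0]] less.prems 2 by simp
    then show ?thesis using v(1) start less.prems 2 by simp
  next
    case 3
    have IH: "\<sigma> (u h) = v h" "\<sigma> (u (h + 1)) = v (h + 1)"
      using less.IH[of h] less.IH[of "h + 1"] less.prems 3 by auto
    have "adj (\<sigma> (u (h + 1))) (\<sigma> (u (h + 2)))"
      using preserving_adj[OF pres u(1)[of "h + 1"]] less.prems 3 by simp
    then have "\<sigma> (u (h + 2)) = v h \<or> \<sigma> (u (h + 2)) = v (h + 2)"
      using v(2)[of h] IH less.prems 3 by simp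
    moreover have "\<sigma> (u (h + 2)) \<noteq> v h"
      using IH(1) u(2)[of h] injD[OF inj, of "u h" "u (h + 2)"] less.prems 3 by metis
    ultimately show ?thesis using 3 by simp
  qed (use start in simp)
qed

text \<open>The smallest anchor block singles out the end 0 of the anchor, from which the walk lemma
  fixes the whole anchor, and its singleton edge labels fix the large parts. Hence symmetries
  preserve \<open>Lab\<close> exactly, and \<open>Lab\<close> identifies every path together with
  its direction.\<close>

lemma preserving_trivial:
  assumes pres: "preserving \<sigma> \<pi>"
  shows "\<sigma> = id \<and> \<pi> = id"
proof -
  have perm: "\<sigma> permutes {..<m1}" "\<pi> permutes {..<m2}"
    and iff: "\<And>D T. (\<sigma> ` D, \<pi> ` T) \<in> conf \<longleftrightarrow> (D, T) \<in> conf"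
    using pres by (auto simp: preserving_def)
  have inj: "inj \<sigma>" using perm(1) by (rule permutes_inj)
  have inv: "inv \<sigma> (\<sigma> u) = u" for u using permutes_inverses[OF perm(1)] by simp
  have anchor0: "({..<m2 + 3}, {}) \<in> conf"
    unfolding conf_def anchor_blocks_def using n1 by (intro UnI2 UnI1 image_eqI[of _ _ 0]) auto
  then have "(\<sigma> ` {..<m2 + 3}, {}) \<in> conf" using iff[of "{..<m2 + 3}" "{}"] by simp
  moreover have "card (\<sigma> ` {..<m2 + 3}) = m2 + 3"
    using card_image[OF inj_on_subset[OF inj subset_UNIV], of "{..<m2 + 3}"] by simp
  ultimately have first: "\<sigma> ` {..<m2 + 3} = {..<m2 + 3}"
    using conf_first_anchor[of "(\<sigma> ` {..<m2 + 3}, {})"] by simp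
  have "\<sigma> 0 = 0"
  proof (rule ccontr)
    \<comment> \<open>Every other point of the initial block has two neighbours, whereas 0 has only
      one.\<close>
    assume ne: "\<sigma> 0 \<noteq> 0"
    have "\<sigma> 0 \<in> {..<m2 + 3}" using first by (metis image_eqI lessThan_iff zero_less_numeral add_pos_nonneg add.commute zero_le)
    then have lt: "\<sigma> 0 + 1 < x" using x by simp
    then have "adj (\<sigma> 0) (\<sigma> 0 + 1)" "adj (\<sigma> 0) (\<sigma> 0 - 1)"
      using ne by (auto simp: adj_anchor)
    from preserving_adj[OF preserving_inv[OF pres] this(1)]
      preserving_adj[OF preserving_inv[OF pres] this(2)]
    have "inv \<sigma> (\<sigma> 0 + 1) = 1" "inv \<sigma> (\<sigma> 0 - 1) = 1"
      unfolding inv using x by (auto simp: adj_anchor)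
    then have "\<sigma> 0 + 1 = \<sigma> 0 - 1"
      using permutes_inj[OF permutes_inv[OF perm(1)]] by (metis injD)
    then show False by simp
  qed
  have fix_anchor: "\<sigma> e = e" if "e < x" for e
  proof (rule walk[OF pres, where u = "\<lambda>i. i" and v = "\<lambda>i. i" and n = x])
    show "adj i (i + 1)" if "i + 1 < x" for i using that by (simp add: adj_anchor)
    show "w = 1" if "1 < x" "adj 0 w" for w using that by (simp add: adj_anchor)
    show "w = i \<or> w = i + 2" if "i + 2 < x" "adj (i + 1) w" for i w
      using that by (auto simp: adj_anchor)
  qed (use \<open>\<sigma> 0 = 0\<close> that in auto)
  have "\<pi> i = i" if i: "i < m2" for i
  proof -
    have iE: "i \<in> E" "i + 1 < x" using i x by (auto simp: E)
    obtain e' where e': "\<sigma> ` {i, i + 1} = {e', e' + 1}" "\<pi> ` edge_label i = edge_label e'"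
      using preserving_edge[OF pres iE(1)] by blast
    have "{i, i + 1} = {e', e' + 1}" using e'(1) fix_anchor iE(2) by simp
    then have "e' = i" by (auto simp: doubleton_eq_iff)
    then show ?thesis using e'(2) i by (simp add: edge_label_def)
  qed
  then have \<pi>: "\<pi> = id" using perm(2) by (metis eq_id_iff lessThan_iff permutes_not_in)
  have \<sigma>_lt: "\<sigma> e < m1 \<longleftrightarrow> e < m1" for e using permutes_in_image[OF perm(1), of e] by simp
  have lab: "Lab (\<sigma> e) = Lab e" if "e < m1" for e
    using iff[of "{e}"] \<sigma>_lt[of e] that by (auto simp: single_mem_conf \<pi>)
  have \<sigma>_ge: "x \<le> \<sigma> e" if "x \<le> e" for e
  proof (rule ccontr)
    assume "\<not> x \<le> \<sigma> e"
    then have "\<sigma> (\<sigma> e) = \<sigma> e" by (intro fix_anchor) simp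
    then have "\<sigma> e = e" using inj by (simp add: inj_eq)
    then show False using that \<open>\<not> x \<le> \<sigma> e\<close> by simp
  qed
  have fix_path: "\<sigma> (x + t * s + i) = x + t * s + i" if t: "t < np" and "i < s" for t i
  proof -
    have fwd: "adj (x + t * s + i) (x + t * s + (i + 1))" if "i + 1 < s" for i
      using that adj_path[OF t, of i] by simp
    have st: "x + t * s < m1" using path_less[OF t, of 0] s by simp
    then obtain t' i' where ti: "t' < np" "i' < s" "\<sigma> (x + t * s) = x + t' * s + i'"
      using path_point[of "\<sigma> (x + t * s)"] \<sigma>_lt \<sigma>_ge by auto
    \<comment> \<open>Path ends carry one label more than inner points, so an end is mapped to an
      end.\<close>
    have "card (Lab (x + t' * s + i')) = card (Lab (x + t * s + 0))"
      using lab[OF st] ti(3) by simp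
    moreover have "card (Lab (x + t * s + 0)) = n1 - 2 + 1"
      using Lab_card[OF t, of 0] s by (simp only: simp_thms if_True)
    moreover have "card (Lab (x + t' * s + i')) = n1 - 2" if "\<not> (i' = 0 \<or> i' = s - 1)"
      using Lab_card[OF ti(1,2)] that by (simp only: if_False add_0_right)
    ultimately have "i' = 0 \<or> i' = s - 1" by linarith
    then show ?thesis
    proof
      assume i': "i' = 0"
      have follow: "\<sigma> (x + t * s + i) = x + t' * s + i" if "i < s" for i
      proof (rule walk[OF pres, where u = "\<lambda>i. x + t * s + i" and v = "\<lambda>i. x + t' * s + i" and n = s])
        show "w = x + t' * s + 1" if "1 < s" "adj (x + t' * s + 0) w" for w
          using that adj_path[OF ti(1), of 0] by simp
        show "w = x + t' * s + i \<or> w = x + t' * s + (i + 2)"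
          if "i + 2 < s" "adj (x + t' * s + (i + 1)) w" for i w
          using that adj_path[OF ti(1), of "i + 1"] by auto
      qed (use fwd ti(3) i' that in auto)
      have "t = t'"
      proof (rule Lab_code[OF t ti(1)])
        fix i assume "i < s"
        then show "Lab (x + t * s + i) = Lab (x + t' * s + i)"
          using lab[OF path_less[OF t \<open>i < s\<close>]] follow by simp
      qed
      then show ?thesis using follow[OF \<open>i < s\<close>] by simp
    next
      assume i': "i' = s - 1"
      have "\<sigma> (x + t * s + 1) = x + t' * s + (s - 1 - 1)"
      proof (rule walk[OF pres, where u = "\<lambda>i. x + t * s + i" and v = "\<lambda>i. x + t' * s + (s - 1 - i)" and n = s])
        show "w = x + t' * s + (s - 1 - 1)" if "1 < s" "adj (x + t' * s + (s - 1 - 0)) w" for w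
          using that adj_path[OF ti(1), of "s - 1"] by auto
        show "w = x + t' * s + (s - 1 - i) \<or> w = x + t' * s + (s - 1 - (i + 2))"
          if "i + 2 < s" "adj (x + t' * s + (s - 1 - (i + 1))) w" for i w
          using that adj_path[OF ti(1), of "s - 1 - (i + 1)"] by auto
      qed (use fwd ti(3) i' s in auto)
      then have "Lab (x + t * s + 1) = Lab (x + t' * s + (s - 2))"
        using lab[OF path_less[OF t, of 1]] s by (simp add: numeral_2_eq_2)
      then show ?thesis using Lab_no_reversal[OF t ti(1)] by simp
    qed
  qed
  have "\<sigma> e = e" for e
  proof (cases "e < m1")
    case True
    then show ?thesis
      using fix_anchor fix_path path_point[of e] by (cases "e < x") auto
  qed (use perm(1) in \<open>simp add: permutes_not_in\<close>)
  then show ?thesis using \<pi> by auto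
qed

lemma pair_conf_conf:
  assumes "\<And>i. i < m2 \<Longrightarrow> (\<Sum>e<m1. card {T \<in> Lab e. i \<in> T}) = w"
  shows "pair_conf m1 n1 m2 (1 + card R + w) conf"
  unfolding pair_conf_def
proof (intro conjI allI impI)
  fix \<sigma> \<pi>
  assume p: "\<sigma> permutes {..<m1}" "\<pi> permutes {..<m2}"
    and img: "map_prod ((`) \<sigma>) ((`) \<pi>) ` conf = conf"
  have "(\<sigma> ` D, \<pi> ` T) \<in> conf \<longleftrightarrow> (D, T) \<in> conf" for D T
  proof -
    have "map_prod ((`) \<sigma>) ((`) \<pi>) (D, T) \<in> map_prod ((`) \<sigma>) ((`) \<pi>) ` conf \<longleftrightarrow> (D, T) \<in> conf"
      by (rule inj_image_mem_iff[OF inj_map_prod_image[OF permutes_inj[OF p(1)] permutes_inj[OF p(2)]]])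
    then show ?thesis unfolding img by simp
  qed
  then have "preserving \<sigma> \<pi>" using p by (simp add: preserving_def)
  then show "\<sigma> = id" "\<pi> = id" using preserving_trivial by blast+
qed (use conf_sub conf_degree conf_colour_degree assms in auto)

text \<open>Without paths all points lie in the anchor, where every point belongs to one of two
  complementary blocks of at least \<open>m2 + 3\<close> points, while nonempty labels occur only on
  edges, of total size at most \<open>m2 + 2\<close>. This separates small from large parts when
  \<open>n1 = n2\<close>.\<close>

lemma conf_large_blocks:
  assumes "np = 0"
  shows "\<forall>e<m1. \<exists>c\<in>conf. e \<in> fst c \<and> m2 + 2 < card (fst c) + card (snd c)"
    and "\<forall>c\<in>conf. snd c \<noteq> {} \<longrightarrow> card (fst c) + card (snd c) \<le> m2 + 2"
proof -
  have mx: "m1 = x" using assms m1 by simp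
  have mem: "({..<m2 + 3}, {}) \<in> conf" "({m2 + 3..<x}, {}) \<in> conf"
    unfolding conf_def anchor_blocks_def using n1 by (auto intro!: image_eqI[of _ _ 0])
  show "\<forall>e<m1. \<exists>c\<in>conf. e \<in> fst c \<and> m2 + 2 < card (fst c) + card (snd c)"
  proof (intro allI impI)
    fix e assume e: "e < m1"
    show "\<exists>c\<in>conf. e \<in> fst c \<and> m2 + 2 < card (fst c) + card (snd c)"
    proof (cases "e < m2 + 3")
      case True
      then show ?thesis by (intro bexI[OF _ mem(1)]) auto
    next
      case False
      then show ?thesis using x e mx by (intro bexI[OF _ mem(2)]) auto
    qed
  qed
  show "\<forall>c\<in>conf. snd c \<noteq> {} \<longrightarrow> card (fst c) + card (snd c) \<le> m2 + 2"
  proof (intro ballI impI)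
    fix c assume c: "c \<in> conf" "snd c \<noteq> {}"
    have "c \<notin> anchor_blocks" using anchor_blocks_cases(1) c(2) by blast
    moreover have "c \<notin> single_blocks"
    proof
      assume "c \<in> single_blocks"
      then obtain e T where "c = ({e}, T)" "e < m1" "T \<in> Lab e"
        unfolding single_blocks_def by auto
      then show False using c(2) Lab_anchor[of e] mx by (simp split: if_splits)
    qed
    ultimately have ce: "c \<in> edge_blocks" using c(1) by (simp add: conf_def)
    have "c \<in> Pow {..<m1} \<times> Pow {..<m2}" using conf_sub c(1) by blast
    then have "snd c \<subseteq> {..<m2}" by (simp add: mem_Times_iff)
    then have "card (snd c) \<le> m2" using card_mono[of "{..<m2}" "snd c"] by simp
    then show "card (fst c) + card (snd c) \<le> m2 + 2" using edge_blocks_card[OF ce] by simp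
  qed
qed

end

section \<open>Rotated families of large subsets\<close>

definition rot :: "nat \<Rightarrow> nat \<Rightarrow> nat set \<Rightarrow> nat set" where
  "rot m l T = (\<lambda>i. (i + l) mod m) ` T"

lemma rot_sub: "m > 0 \<Longrightarrow> rot m l T \<subseteq> {..<m}"
  by (auto simp: rot_def)

lemma rot_0: "T \<subseteq> {..<m} \<Longrightarrow> rot m 0 T = T"
  by (force simp: rot_def image_iff subset_iff)

lemma rot_rot: "rot m a (rot m b T) = rot m (a + b) T"
  unfolding rot_def image_image by (intro image_cong refl) (simp only: mod_add_left_eq add.assoc add.commute[of b a])

lemma rot_mod: "rot m (l mod m) T = rot m l T"
  by (simp add: rot_def mod_add_right_eq)

lemma rot_inverse:
  assumes "T \<subseteq> {..<m}" "m > 0"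
  shows "rot m (m - l mod m) (rot m l T) = T"
proof -
  have "l mod m < m" using assms(2) by simp
  then have "rot m (m - l mod m) (rot m (l mod m) T) = rot m m T"
    unfolding rot_rot by simp
  also have "\<dots> = rot m (m mod m) T" by (rule rot_mod[symmetric])
  also have "\<dots> = T" using rot_0[OF assms(1)] by simp
  finally show ?thesis by (simp only: rot_mod)
qed

lemma inj_on_rot:
  assumes "m > 0"
  shows "inj_on (rot m l) (Pow {..<m})"
  by (rule inj_on_inverseI[where g = "rot m (m - l mod m)"]) (use assms in \<open>simp add: rot_inverse\<close>)

text \<open>Membership means that \<open>i - u - a\<close> lies in \<open>T\<close> modulo
  \<open>m\<close>, and this residue runs through all of \<open>{..<m}\<close> as \<open>u\<close>
  does. Integers avoid truncated subtraction.\<close>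

lemma card_rotations_containing:
  assumes T: "T \<subseteq> {..<m}" and i: "i < m"
  shows "card {u. u < m \<and> i \<in> rot m (u + a) T} = card T"
proof -
  define v where "v u = nat ((int i - int u - int a) mod int m)" for u
  have m: "m > 0" using i by simp
  have iv: "int (v u) = (int i - int u - int a) mod int m" for u
    using m by (simp add: v_def)
  have inj: "inj_on v {..<m}"
  proof (rule inj_onI)
    fix u u' assume u: "u \<in> {..<m}" "u' \<in> {..<m}" "v u = v u'"
    then have "(int i - int u - int a) mod int m = (int i - int u' - int a) mod int m"
      using iv by metis
    then have "int m dvd (int i - int u - int a) - (int i - int u' - int a)"
      by (simp only: mod_eq_dvd_iff)
    then have "int m dvd int u' - int u" by simp
    then have "int u' mod int m = int u mod int m" by (simp only: mod_eq_dvd_iff)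
    then show "u = u'" using u by simp
  qed
  have v_less: "v u < m" for u
  proof -
    have "int (v u) < int m" unfolding iv using m by simp
    then show ?thesis by simp
  qed
  have surj: "v ` {..<m} = {..<m}"
    using inj v_less by (intro endo_inj_surj) auto
  have iff: "i \<in> rot m (u + a) T \<longleftrightarrow> v u \<in> T" for u
  proof
    assume "i \<in> rot m (u + a) T"
    then obtain w where w: "w \<in> T" "i = (w + (u + a)) mod m" by (auto simp: rot_def)
    have "int (v u) = (int i - (int u + int a)) mod int m"
      unfolding iv by (simp add: algebra_simps)
    also have "\<dots> = ((int w + (int u + int a)) mod int m - (int u + int a)) mod int m"
      using w(2) by (simp only: of_nat_mod of_nat_add)
    also have "\<dots> = (int w + (int u + int a) - (int u + int a)) mod int m"
      by (rule mod_diff_left_eq)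
    also have "\<dots> = int w" using w(1) T by auto
    finally show "v u \<in> T" using w(1) by simp
  next
    assume vT: "v u \<in> T"
    have "int ((v u + (u + a)) mod m) = (int (v u) + (int u + int a)) mod int m"
      by (simp add: of_nat_mod)
    also have "\<dots> = (int i - int u - int a + (int u + int a)) mod int m"
      unfolding iv by (rule mod_add_left_eq)
    also have "\<dots> = int i" using i by simp
    finally have "i = (v u + (u + a)) mod m" by simp
    then show "i \<in> rot m (u + a) T" using vT by (auto simp: rot_def)
  qed
  have "{u. u < m \<and> i \<in> rot m (u + a) T} = {u \<in> {..<m}. v u \<in> T}" using iff by auto
  moreover have "v ` {u \<in> {..<m}. v u \<in> T} = T"
  proof
    show "v ` {u \<in> {..<m}. v u \<in> T} \<subseteq> T" by (rule image_subsetI) simp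
    show "T \<subseteq> v ` {u \<in> {..<m}. v u \<in> T}"
    proof
      fix t assume t: "t \<in> T"
      then have "t \<in> v ` {..<m}" unfolding surj by (rule subsetD[OF T])
      then obtain u where "t = v u" "u \<in> {..<m}" by (rule imageE)
      then show "t \<in> v ` {u \<in> {..<m}. v u \<in> T}" using t by (intro image_eqI[of _ _ u]) simp_all
    qed
  qed
  moreover have "inj_on v {u \<in> {..<m}. v u \<in> T}" using inj by (rule inj_on_subset) auto
  ultimately show ?thesis by (metis card_image)
qed

text \<open>Over a full period of rotations all large parts receive the same weight, whatever the
  family; this is how the construction gives them equal size without a divisibility condition on the
  labels.\<close>

lemma sum_card_rotated:
  assumes S: "\<S> \<subseteq> Pow {..<m}" and i: "i < m"
  shows "(\<Sum>u<m. card {T \<in> rot m (u + a) ` \<S>. i \<in> T}) = (\<Sum>T\<in>\<S>. card T)"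
proof -
  have m: "m > 0" using i by simp
  have fin: "finite \<S>" using S finite_subset by auto
  have "card {T \<in> rot m l ` \<S>. i \<in> T} = card {T \<in> \<S>. i \<in> rot m l T}" for l
  proof -
    have "{T \<in> rot m l ` \<S>. i \<in> T} = rot m l ` {T \<in> \<S>. i \<in> rot m l T}" by blast
    moreover have "inj_on (rot m l) {T \<in> \<S>. i \<in> rot m l T}"
      using inj_on_rot[OF m] by (rule inj_on_subset) (use S in auto)
    ultimately show ?thesis by (simp add: card_image)
  qed
  then have "(\<Sum>u<m. card {T \<in> rot m (u + a) ` \<S>. i \<in> T}) =
      (\<Sum>u<m. card {T \<in> \<S>. i \<in> rot m (u + a) T})" by simp
  also have "\<dots> = (\<Sum>T\<in>\<S>. card {u \<in> {..<m}. i \<in> rot m (u + a) T})"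
    using fin by (intro sum_multicount_gen[symmetric]) auto
  also have "\<dots> = (\<Sum>T\<in>\<S>. card T)"
    using card_rotations_containing[OF _ i] S by (intro sum.cong refl) (auto simp: subset_iff)
  finally show ?thesis .
qed

text \<open>The set \<open>y\<close> serves twice: as the extra label at path ends, where it must
  not repeat a label, and as a witness that rotating the labels by one changes them. With
  \<open>{..<m - Suc j}\<close> in \<open>\<K>\<close> and its rotation as \<open>y\<close>, the
  bounds on \<open>k\<close> leave room for the other \<open>k - 1\<close> sets.\<close>

lemma label_family_exists:
  assumes k: "k \<ge> 1" "k < m choose (j + 1)" and j: "2 * j + 3 \<le> m"
  shows "\<exists>\<K> y. \<K> \<subseteq> {T \<in> Pow {..<m}. card T = m - Suc j} \<and> card \<K> = k \<and> y \<notin> \<K> \<and>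
    y \<subseteq> {..<m} \<and> card y = m - Suc j \<and> y \<in> rot m 1 ` \<K>"
proof -
  let ?d = "m - Suc j"
  let ?A = "{T \<in> Pow {..<m}. card T = ?d}"
  define x where "x = {..<?d}"
  define y where "y = rot m 1 x"
  have d: "0 < ?d" "?d < m" using j by auto
  have xA: "x \<in> ?A" by (auto simp: x_def)
  have y_eq: "y = {1..?d}"
  proof -
    have "(i + 1) mod m = i + 1" if "i < ?d" for i using that d by simp
    then have "y = Suc ` {..<?d}" unfolding y_def rot_def x_def by (intro image_cong) auto
    then show ?thesis by (simp only: image_Suc_lessThan)
  qed
  have "{1..?d} \<subseteq> {..<m}"
    using le_less_trans[OF _ d(2)] by (intro subsetI) (simp only: atLeastAtMost_iff lessThan_iff)
  then have yA: "y \<in> ?A" by (simp only: y_eq) simp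
  have "0 \<in> x" "0 \<notin> y" using d(1) by (simp_all add: x_def y_eq)
  then have xy: "x \<noteq> y" by metis
  have finA: "finite ?A" by simp
  have cardA: "card ?A = m choose (j + 1)"
  proof -
    have "card ?A = m choose ?d" using n_subsets[of "{..<m}" ?d] by simp
    also have "\<dots> = m choose (j + 1)" using j by (subst binomial_symmetric) auto
    finally show ?thesis .
  qed
  have "k - 1 \<le> card (?A - {x, y})"
    using xA yA xy k cardA finA by (simp add: card_Diff_subset)
  then obtain B where B: "B \<subseteq> ?A - {x, y}" "card B = k - 1" "finite B"
    by (rule obtain_subset_with_card_n)
  have "card (insert x B) = k" using B k by (subst card_insert_disjoint) auto
  moreover have "y \<notin> insert x B" using B xy by auto
  moreover have "y \<in> rot m 1 ` insert x B" by (simp add: y_def)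
  ultimately show ?thesis using B xA yA by (intro exI[of _ "insert x B"] exI[of _ y]) auto
qed

section \<open>Realising a given size of the large parts\<close>

lemma sum_mult_lessThan:
  fixes f :: "nat \<Rightarrow> 'a :: comm_monoid_add"
  shows "(\<Sum>q<n * m. f q) = (\<Sum>g<n. \<Sum>u<m. f (g * m + u))"
proof -
  have "(\<Sum>g<n. \<Sum>u<m. f (g * m + u)) = (\<Sum>g<n. sum f {g * m..<g * m + m})"
    by (intro sum.cong refl sum.reindex_bij_witness[of _ "\<lambda>q. q - g * m" "\<lambda>u. g * m + u" for g]) auto
  then show ?thesis by (simp add: sum.nat_group)
qed

lemma sum_add_lessThan:
  fixes f :: "nat \<Rightarrow> 'a :: comm_monoid_add"
  shows "(\<Sum>e<x + n. f e) = (\<Sum>e<x. f e) + (\<Sum>q<n. f (x + q))"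
  by (induction n) (simp_all add: add.assoc)

text \<open>There are \<open>m2 * Y\<close> paths, each with \<open>L\<close> windows of
  \<open>m2\<close> points between two ends. A window contributes \<open>G\<close> to each large
  part, and the ends of \<open>m2\<close> consecutive paths contribute \<open>2 * (G + d)\<close>,
  in total \<open>Y * (s * G + 2 * d)\<close>. The rest \<open>a\<close> consists of 1 from the
  anchor and of \<open>a - 1\<close> free edges with full label, which exist by the bound on
  \<open>a\<close>.\<close>

lemma distinguishing_partition_exists:
  fixes n1 m2 j k L Y x a :: nat
  defines "s \<equiv> m2 * L + 2" and "d \<equiv> m2 - Suc j"
  defines "G \<equiv> (\<Sum>i=0..j. (m2 - i) * (m2 choose i)) + d * k"
  assumes n1: "n1 = 2 + (\<Sum>i=0..j. m2 choose i) + k" and j: "2 * j + 3 \<le> m2"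
    and k: "k \<ge> 1" "k < m2 choose (j + 1)"
    and L: "L \<ge> 2" and Y: "m2 * Y \<le> 2 ^ (L - 2)"
    and m1: "m1 = x + m2 * Y * s" and x: "x \<ge> 2 * (m2 + 3) + n1"
    and a: "1 \<le> a" "a + m2 \<le> x + m2 * Y * (s - 1)"
    and n2: "n2 = a + Y * (s * G + 2 * d)" and n12: "n1 \<noteq> n2 \<or> Y = 0"
  shows "\<exists>P. distinguishing_partition (K_mult m1 n1 m2 n2) P"
proof -
  have m2: "m2 \<ge> 3" using j by simp
  have s4: "s \<ge> 4" using m2 L mult_le_mono[of 3 m2 2 L] by (simp add: s_def)
  define \<H> where "\<H> = {T \<in> Pow {..<m2}. d < card T}"
  obtain \<K> y where K: "\<K> \<subseteq> {T \<in> Pow {..<m2}. card T = d}" "card \<K> = k" "y \<notin> \<K>"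
    and y: "y \<subseteq> {..<m2}" "card y = d" "y \<in> rot m2 1 ` \<K>"
    using label_family_exists[OF k j] unfolding d_def by blast
  define \<T> where "\<T> = \<H> \<union> \<K>"
  have finP: "finite (Pow {..<m2})" by simp
  have \<T>_sub: "\<T> \<subseteq> Pow {..<m2}" using K by (auto simp: \<T>_def \<H>_def)
  have fin: "finite \<H>" "finite \<K>" "finite \<T>"
    using \<T>_sub finP finite_subset by (auto simp: \<T>_def)
  have HK: "\<H> \<inter> \<K> = {}" using K(1) by (auto simp: \<H>_def)
  have y\<T>: "y \<notin> \<T>" using K(3) y(2) by (auto simp: \<T>_def \<H>_def)
  have card\<H>: "card \<H> = (\<Sum>i=0..j. m2 choose i)"
    using sum_large_subsets[of j m2 "\<lambda>_. 1::nat"] j by (simp add: \<H>_def d_def)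
  have card\<T>: "card \<T> = n1 - 2"
    unfolding \<T>_def using fin HK K(2) card\<H> n1 by (simp add: card_Un_disjoint)
  have sum\<T>: "(\<Sum>T\<in>\<T>. card T) = G"
  proof -
    have "(\<Sum>T\<in>\<H>. card T) = (\<Sum>i=0..j. (m2 - i) * (m2 choose i))"
      using sum_large_subsets[of j m2 "\<lambda>s. s"] j by (simp add: \<H>_def d_def mult.commute)
    moreover have "(\<Sum>T\<in>\<K>. card T) = (\<Sum>T\<in>\<K>. d)" using K(1) by (intro sum.cong) auto
    ultimately show ?thesis
      unfolding \<T>_def G_def using fin HK K(2) by (simp add: sum.union_disjoint mult.commute)
  qed
  define F where "F l = rot m2 l ` \<T>" for l
  define F' where "F' l = rot m2 l ` insert y \<T>" for l
  have F_sub: "F l \<subseteq> Pow {..<m2}" "F' l \<subseteq> Pow {..<m2}" for l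
    using rot_sub[of m2] m2 by (auto simp: F_def F'_def)
  have card_F: "card (F l) = n1 - 2" "card (F' l) = n1 - 2 + 1" for l
  proof -
    have inj: "inj_on (rot m2 l) (insert y \<T>)"
      by (rule inj_on_subset[OF inj_on_rot]) (use m2 \<T>_sub y in auto)
    then show "card (F' l) = n1 - 2 + 1"
      unfolding F'_def using fin y\<T> card\<T> by (simp add: card_image)
    show "card (F l) = n1 - 2"
      unfolding F_def using card\<T> inj_on_subset[OF inj, of \<T>] by (simp add: card_image subset_insertI)
  qed
  have F_mod: "F (l mod m2) = F l" for l
    unfolding F_def using rot_mod by simp
  have F0: "F 0 = \<T>"
  proof -
    have "F 0 = id ` \<T>" unfolding F_def using \<T>_sub rot_0 by (intro image_cong) auto
    then show ?thesis by simp
  qed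
  have F01: "F 0 \<noteq> F 1"
  proof -
    have "y \<in> F 1" using y(3) by (auto simp: F_def \<T>_def)
    then show ?thesis using y\<T> F0 by auto
  qed
  have F0_last: "F 0 \<noteq> F (m2 - 1)"
  proof
    assume "F 0 = F (m2 - 1)"
    then have eq: "rot m2 1 ` F 0 = rot m2 1 ` F (m2 - 1)" by simp
    have step: "rot m2 1 ` F l = F (1 + l)" for l
      unfolding F_def image_image rot_rot ..
    have "F 1 = F (1 + (m2 - 1))" using eq unfolding step by simp
    also have "\<dots> = F 0" using F_mod[of m2] m2 by simp
    finally show False using F01 by simp
  qed
  \<comment> \<open>The \<open>g\<close>-th window of \<open>m2\<close> inner points of the path \<open>t\<close> carries one binary digit of \<open>t\<close>, written as
    a rotation offset. Each window runs through all rotations, so every large part gains the same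
    weight. The digit of the last window is \<open>0\<close>, which tells the two ends of the path apart.\<close>
  define bt where "bt t g = (if 1 \<le> g \<and> g + 1 < L \<and> bit t (g - 1) then 1 else 0 :: nat)" for t g :: nat
  define inner where "inner t i = F (i + bt t (i div m2))" for t i
  \<comment> \<open>The ends are rotated by the path number \<open>t\<close>, so that their weight
    also evens out over \<open>m2\<close> consecutive paths.\<close>
  define pos where "pos t i = (if i = 0 \<or> i = s - 1 then F' t else inner t (i - 1))" for t i
  define Lab where "Lab e = (if e < x then if e = 0 \<or> e + 1 = x then {{}} else {}
    else pos ((e - x) div s) ((e - x) mod s))" for e
  have Lab_path: "Lab (x + t * s + i) = pos t i" if "i < s" for t i
    using that by (simp add: Lab_def add.assoc)
  define E where "E = {e. e + 1 < x} \<union> {e. x \<le> e \<and> e < m1 \<and> (e - x) mod s \<noteq> s - 1}"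
  have cardE: "a - 1 \<le> card (E - {..<m2})"
  proof -
    have finE: "finite E"
      by (rule finite_subset[of _ "{..<m1}"]) (use m1 in \<open>auto simp: E_def\<close>)
    have sub: "{..<x - 1} \<union> (\<lambda>(t, i). x + t * s + i) ` ({..<m2 * Y} \<times> {..<s - 1}) \<subseteq> E"
    proof -
      have "x + t * s + i \<in> E" if "t < m2 * Y" "i < s - 1" for t i
      proof -
        have "t * s + i < (t + 1) * s" using that by simp
        also have "\<dots> \<le> m2 * Y * s" using that(1) by (intro mult_le_mono1) simp
        finally show ?thesis using that m1 by (simp add: E_def add.assoc)
      qed
      then show ?thesis using x by (auto simp: E_def)
    qed
    have inj: "inj_on (\<lambda>(t, i). x + t * s + i) ({..<m2 * Y} \<times> {..<s - 1})"
    proof (rule inj_onI)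
      fix p q assume p: "p \<in> {..<m2 * Y} \<times> {..<s - 1}" and q: "q \<in> {..<m2 * Y} \<times> {..<s - 1}"
        and pq: "(\<lambda>(t, i). x + t * s + i) p = (\<lambda>(t, i). x + t * s + i) q"
      obtain t i t' i' where ti: "p = (t, i)" "q = (t', i')" by (cases p, cases q) auto
      have eq: "x + t * s + i = x + t' * s + i'" using pq ti by simp
      have "i < s" "i' < s" using p q ti by auto
      then have "(t * s + i) div s = t" "(t' * s + i') div s = t'" "(t * s + i) mod s = i" "(t' * s + i') mod s = i'"
        by auto
      moreover have "t * s + i = t' * s + i'" using eq by simp
      ultimately show "p = q" using ti by metis
    qed
    have "card ({..<x - 1} \<union> (\<lambda>(t, i). x + t * s + i) ` ({..<m2 * Y} \<times> {..<s - 1})) =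
        card {..<x - 1} + card ((\<lambda>(t, i). x + t * s + i) ` ({..<m2 * Y} \<times> {..<s - 1}))"
      by (rule card_Un_disjoint) auto
    then have "x - 1 + m2 * Y * (s - 1) \<le> card E"
      using card_mono[OF finE sub] inj by (simp add: card_image card_cartesian_product)
    moreover have "card E - card {..<m2} \<le> card (E - {..<m2})" by (rule diff_card_le_card_Diff) simp
    ultimately show ?thesis using a x by simp
  qed
  then obtain R where Rc: "R \<subseteq> E - {..<m2}" "card R = a - 1" by (rule obtain_subset_with_card_n)
  interpret path_forest m1 n1 m2 x s "m2 * Y" Lab E R
  proof
    show "n1 \<ge> 3"
    proof -
      have "(\<Sum>i=0..j. m2 choose i) \<ge> m2 choose 0" by (rule member_le_sum) auto
      then show ?thesis using n1 k by simp
    qed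
    show "Lab e \<subseteq> Pow {..<m2}" for e
      unfolding Lab_def pos_def inner_def using F_sub by auto
    show "Lab e = (if e = 0 \<or> e + 1 = x then {{}} else {})" if "e < x" for e
      using that by (simp add: Lab_def)
    show "card (Lab (x + t * s + i)) = n1 - 2 + (if i = 0 \<or> i = s - 1 then 1 else 0)" if "i < s" for t i
      unfolding Lab_path[OF that] pos_def inner_def by (simp add: card_F)
    show "t = t'" if t: "t < m2 * Y" "t' < m2 * Y"
      and eq: "\<And>i. i < s \<Longrightarrow> Lab (x + t * s + i) = Lab (x + t' * s + i)" for t t'
    proof (rule bit_eqI)
      have bnd: "t < 2 ^ (L - 2)" "t' < 2 ^ (L - 2)" using t Y by auto
      fix b
      show "bit t b \<longleftrightarrow> bit t' b"
      proof (cases "b < L - 2")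
        case True
        \<comment> \<open>The digit is read off at the first point of window \<open>g\<close>, which
          is point \<open>1 + m2 * g\<close> of the path.\<close>
        define g where "g = b + 1"
        have g: "1 \<le> g" "g + 1 < L" using True by (auto simp: g_def)
        have "g + 1 \<le> L" using g by simp
        then have "m2 * g + m2 \<le> m2 * L" using mult_le_mono2[of "g + 1" L m2] by simp
        then have lt: "1 + m2 * g < s - 1" using m2 g by (simp add: s_def)
        have "pos t (1 + m2 * g) = pos t' (1 + m2 * g)"
          using eq[of "1 + m2 * g"] Lab_path[of "1 + m2 * g"] lt by simp
        then have "F (m2 * g + bt t g) = F (m2 * g + bt t' g)"
          using lt m2 by (simp add: pos_def inner_def)
        then have "F (bt t g mod m2) = F (bt t' g mod m2)"
          using F_mod[of "m2 * g + bt t g"] F_mod[of "m2 * g + bt t' g"] by simp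
        then have "F (bt t g) = F (bt t' g)" by (simp add: F_mod)
        then show ?thesis using g F01 by (auto simp: bt_def g_def split: if_splits)
      next
        case False
        have "\<not> bit w b" if w: "w < 2 ^ (L - 2)" for w :: nat
        proof -
          have "take_bit (L - 2) w = w" using w by (simp add: take_bit_nat_eq_self)
          then show ?thesis using False by (metis bit_take_bit_iff)
        qed
        then show ?thesis using bnd by blast
      qed
    qed
    \<comment> \<open>Windows 0 and \<open>L - 1\<close> carry the digit 0, so the families compared
      are \<open>F 0\<close> and \<open>F (m2 - 1)\<close>; these differ since one more rotation
      would give \<open>F 1 = F 0\<close>.\<close>
    show "Lab (x + t * s + 1) \<noteq> Lab (x + t' * s + (s - 2))" for t t'
    proof -
      have "\<not> (1 = (0::nat) \<or> 1 = s - 1)" using s4 by linarith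
      then have "pos t 1 = inner t 0" unfolding pos_def by (simp only: if_False diff_self_eq_0)
      moreover have "inner t 0 = F 0" by (simp add: inner_def bt_def)
      ultimately have "Lab (x + t * s + 1) = F 0" using Lab_path[of 1 t] s4 by simp
      moreover have "Lab (x + t' * s + (s - 2)) = F (m2 - 1)"
      proof -
        have i: "s - 2 - 1 = m2 * (L - 1) + (m2 - 1)"
        proof -
          obtain M where "L = Suc M" using L by (cases L) auto
          then show ?thesis using m2 by (simp add: s_def algebra_simps)
        qed
        define w where "w = m2 - 1"
        have w: "w < m2" using m2 by (simp add: w_def)
        have i': "s - 2 - 1 = m2 * (L - 1) + w" using i by (simp only: w_def)
        have "(m2 * (L - 1) + w) div m2 = L - 1" "(m2 * (L - 1) + w) mod m2 = w" using w by simp_all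
        then have "(s - 2 - 1) div m2 = L - 1" and Fw: "F (m2 * (L - 1) + w) = F w"
          using F_mod[of "m2 * (L - 1) + w"] i' by simp_all
        then have "bt t' ((s - 2 - 1) div m2) = 0" using L by (simp add: bt_def)
        moreover have "\<not> (s - 2 = 0 \<or> s - 2 = s - 1)" using s4 by linarith
        then have "pos t' (s - 2) = inner t' (s - 2 - 1)" unfolding pos_def by (simp only: if_False)
        ultimately have "pos t' (s - 2) = F (m2 * (L - 1) + w)"
          by (simp only: inner_def i' add_0_right)
        then show ?thesis using Lab_path[of "s - 2" t'] s4 Fw by (simp add: w_def)
      qed
      ultimately show ?thesis using F0_last by simp
    qed
  qed (use m1 x s4 E_def Rc in auto)
  have weight: "(\<Sum>e<m1. card {T \<in> Lab e. i \<in> T}) = Y * (s * G + 2 * d)" if i: "i < m2" for i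
  proof -
    let ?c = "\<lambda>\<S>. card {T \<in> \<S>. i \<in> T}"
    have "(\<Sum>e<m1. ?c (Lab e)) = (\<Sum>e<x. ?c (Lab e)) + (\<Sum>q<m2 * Y * s. ?c (Lab (x + q)))"
      unfolding m1 by (rule sum_add_lessThan)
    also have "(\<Sum>e<x. ?c (Lab e)) = 0"
      by (rule sum.neutral) (auto simp: Lab_def)
    also have "(\<Sum>q<m2 * Y * s. ?c (Lab (x + q))) = (\<Sum>t<m2 * Y. \<Sum>u<s. ?c (pos t u))"
      unfolding sum_mult_lessThan using Lab_path by (intro sum.cong refl) (simp add: add.assoc)
    also have "\<dots> = (\<Sum>t<m2 * Y. 2 * ?c (F' t) + L * G)"
    proof (rule sum.cong[OF refl])
      fix t
      have "(\<Sum>u<s. ?c (pos t u)) = ?c (pos t 0) + (\<Sum>u<s - 1. ?c (pos t (Suc u)))"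
        using sum.lessThan_Suc_shift[of "\<lambda>u. ?c (pos t u)" "s - 1"] s4 by simp
      also have "(\<Sum>u<s - 1. ?c (pos t (Suc u))) = (\<Sum>u<s - 2. ?c (pos t (Suc u))) + ?c (pos t (s - 1))"
        using sum.lessThan_Suc[of "\<lambda>u. ?c (pos t (Suc u))" "s - 2"] s4 by (simp add: Suc_diff_Suc numeral_2_eq_2)
      also have "(\<Sum>u<s - 2. ?c (pos t (Suc u))) = (\<Sum>u<L * m2. ?c (inner t u))"
        by (intro sum.cong) (auto simp: pos_def s_def mult.commute)
      also have "\<dots> = (\<Sum>g<L. \<Sum>u<m2. ?c (inner t (g * m2 + u)))"
        by (rule sum_mult_lessThan)
      also have "\<dots> = (\<Sum>g<L. G)"
      proof (rule sum.cong[OF refl])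
        fix g
        have "(\<Sum>u<m2. ?c (inner t (g * m2 + u))) = (\<Sum>u<m2. ?c (rot m2 (u + (g * m2 + bt t g)) ` \<T>))"
          by (intro sum.cong refl) (simp add: inner_def F_def algebra_simps)
        also have "\<dots> = G" unfolding sum_card_rotated[OF \<T>_sub i] by (rule sum\<T>)
        finally show "(\<Sum>u<m2. ?c (inner t (g * m2 + u))) = G" .
      qed
      finally show "(\<Sum>u<s. ?c (pos t u)) = 2 * ?c (F' t) + L * G" by (simp add: pos_def)
    qed
    also have "\<dots> = 2 * (\<Sum>t<Y * m2. ?c (F' t)) + m2 * Y * (L * G)"
      by (simp add: sum.distrib sum_distrib_left mult.commute)
    also have "(\<Sum>t<Y * m2. ?c (F' t)) = (\<Sum>g<Y. \<Sum>u<m2. ?c (F' (g * m2 + u)))"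
      by (rule sum_mult_lessThan)
    also have "\<dots> = (\<Sum>g<Y. G + d)"
    proof (rule sum.cong[OF refl])
      fix g
      have "(\<Sum>u<m2. ?c (F' (g * m2 + u))) = (\<Sum>u<m2. ?c (rot m2 (u + g * m2) ` insert y \<T>))"
        by (intro sum.cong refl) (simp add: F'_def add.commute)
      also have "\<dots> = (\<Sum>T\<in>insert y \<T>. card T)"
        by (rule sum_card_rotated) (use \<T>_sub y i in auto)
      also have "\<dots> = G + d" using fin y\<T> sum\<T> y(2) by simp
      finally show "(\<Sum>u<m2. ?c (F' (g * m2 + u))) = G + d" .
    qed
    finally show ?thesis by (simp add: s_def algebra_simps)
  qed
  have n2': "n2 = 1 + card R + Y * (s * G + 2 * d)" using n2 Rc(2) a by simp
  have conf: "pair_conf m1 n1 m2 n2 conf"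
    unfolding n2' by (rule pair_conf_conf[OF weight])
  show ?thesis
  proof (rule distinguishing_partition_of_pair_conf[OF _ _ conf, where q = "m2 + 2"])
    show "n1 > 0" "n2 > 0" using n1 n2' by auto
    show "n1 \<noteq> n2 \<or> (\<forall>e<m1. \<exists>c\<in>conf. e \<in> fst c \<and> m2 + 2 < card (fst c) + card (snd c)) \<and>
      (\<forall>c\<in>conf. snd c \<noteq> {} \<longrightarrow> card (fst c) + card (snd c) \<le> m2 + 2)"
      using n12 conf_large_blocks by auto
  qed
qed

section \<open>Counting components\<close>

text \<open>A member with more than \<open>n\<close> elements occupies at least \<open>n + 1\<close>
  elements of the union.\<close>

lemma card_times_le_card_Union:
  assumes "finite \<G>" "disjoint \<G>" "\<And>K. K \<in> \<G> \<Longrightarrow> finite K"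
  shows "(n + 1) * card \<G> \<le> (n + 1) * card {K \<in> \<G>. card K \<le> n} + card (\<Union>\<G>)"
proof -
  let ?S = "{K \<in> \<G>. card K \<le> n}" and ?B = "{K \<in> \<G>. \<not> card K \<le> n}"
  have "(n + 1) * card ?B = (\<Sum>K\<in>?B. n + 1)" by simp
  also have "\<dots> \<le> (\<Sum>K\<in>?B. card K)" by (intro sum_mono) simp
  also have "\<dots> \<le> (\<Sum>K\<in>\<G>. card K)" using assms(1) by (intro sum_mono2) auto
  also have "\<dots> = card (\<Union>\<G>)"
    using assms by (intro card_Union_disjoint[symmetric]) auto
  finally have "(n + 1) * card ?B \<le> card (\<Union>\<G>)" .
  moreover have "card \<G> = card ?S + card ?B"
  proof -
    have "\<G> = ?S \<union> ?B" by blast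
    moreover have "card (?S \<union> ?B) = card ?S + card ?B"
      using assms(1) by (intro card_Un_disjoint) auto
    ultimately show ?thesis by simp
  qed
  ultimately show ?thesis by (simp add: distrib_left)
qed

text \<open>All that the asymptotic part needs is condensed into four numbers: \<open>g\<close> tree
  components, \<open>z\<close> blocks with small parts but empty label, \<open>y\<close> points
  without a full block of their own, and \<open>q\<close> points in tree components that avoid all
  those \<open>z\<close> blocks. For the third bound, each other tree component contains one of the
  \<open>z\<close> blocks, and different components contain different ones.\<close>

lemma component_counts:
  fixes d mu R :: int
  assumes conf: "pair_conf m1 n1 m2 n2 \<C>"
    and n1: "n1 = 2 + (\<Sum>i=0..j. m2 choose i) + k" and j: "2 * j + 3 \<le> m2"
    and d: "d = int m2 - int j - 1" and mu: "mu = int m2 - 2 * int j - 2"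
    and R: "R = int m2 + (\<Sum>i=0..j. (int m2 - int i) * int (m2 choose i)) + d * int k"
  shows "\<exists>g z y q :: nat.
    int m2 * int n2 + d * int z + int y \<le> R * int m1 + mu * int g + int m2 * 2 ^ m2 \<and>
    (\<forall>n. (n + 1) * g \<le> (n + 1) * tree_base n1 m2 ^ n + m1) \<and>
    (\<forall>n. (n + 1) * g \<le> (n + 1) * tree_base n1 m2 ^ n + (n + 1) * z + q) \<and>
    ((\<exists>\<C>'. pair_conf m1 n1 m2 (n2 - 1) \<C>') \<or> q \<le> y + z * fact m2)"
proof -
  have fin: "finite \<C>" using conf by (rule pair_conf_finite)
  have "\<exists>\<G>. disjoint \<G> \<and> finite \<G> \<and>
    (\<forall>K\<in>\<G>. K \<subseteq> {..<m1} \<and> K \<noteq> {} \<and> union_of_components \<C> K \<and>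
      (\<forall>U. union_of_components \<C> U \<longrightarrow> K \<inter> U \<noteq> {} \<longrightarrow> K \<subseteq> U)) \<and>
    (\<forall>n. card {K \<in> \<G>. card K \<le> n} \<le> tree_base n1 m2 ^ n) \<and>
    m1 + card {c \<in> \<C>. fst c \<noteq> {}} \<le> card \<G> + m1 * n1"
    by (rule tree_components[OF conf])
  then obtain \<G> where disj: "disjoint \<G>" and finG: "finite \<G>"
    and G: "\<And>K. K \<in> \<G> \<Longrightarrow> K \<subseteq> {..<m1} \<and> K \<noteq> {} \<and> union_of_components \<C> K"
    and conn: "\<And>K U. K \<in> \<G> \<Longrightarrow> union_of_components \<C> U \<Longrightarrow> K \<inter> U \<noteq> {} \<Longrightarrow> K \<subseteq> U"
    and count: "\<And>n. card {K \<in> \<G>. card K \<le> n} \<le> tree_base n1 m2 ^ n"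
    and euler: "m1 + card {c \<in> \<C>. fst c \<noteq> {}} \<le> card \<G> + m1 * n1"
    by (elim exE conjE) simp
  define Z where "Z = {c \<in> \<C>. fst c \<noteq> {} \<and> snd c = {}}"
  define Y where "Y = {e. e < m1 \<and> ({e}, {..<m2}) \<notin> \<C>}"
  have finZ: "finite Z" using fin by (simp add: Z_def)
  have finY: "finite Y" by (rule finite_subset[of _ "{..<m1}"]) (auto simp: Y_def)
  define \<G>' where "\<G>' = {K \<in> \<G>. \<forall>c\<in>Z. fst c \<inter> K = {}}"
  have finK: "finite K" if "K \<in> \<G>" for K using G[OF that] finite_subset by blast
  have dis: "K = K'" if "K \<in> \<G>" "K' \<in> \<G>" "e \<in> K" "e \<in> K'" for K K' e
    using disj that by (auto simp: disjoint_def)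
  have ineq: "int m2 * int n2 + d * int (card Z) + int (card Y)
      \<le> R * int m1 + mu * int (card \<G>) + int m2 * 2 ^ m2"
  proof -
    have "int m1 + int (card {c \<in> \<C>. fst c \<noteq> {}}) - int m1 * int n1 \<le> int (card \<G>)"
    proof -
      have "int (m1 + card {c \<in> \<C>. fst c \<noteq> {}}) \<le> int (card \<G> + m1 * n1)"
        using euler by (simp only: of_nat_le_iff)
      then show ?thesis by simp
    qed
    moreover have "mu \<ge> 0" using j mu by simp
    ultimately have "mu * (int m1 + int (card {c \<in> \<C>. fst c \<noteq> {}}) - int m1 * int n1) \<le> mu * int (card \<G>)"
      by (intro mult_left_mono)
    then show ?thesis
      using weight_inequality[OF conf n1 _ d mu R] j unfolding Z_def Y_def by linarith
  qed
  have bound: "(n + 1) * card \<G> \<le> (n + 1) * tree_base n1 m2 ^ n + m1" for n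
  proof -
    have "\<Union>\<G> \<subseteq> {..<m1}" using G by blast
    then have "card (\<Union>\<G>) \<le> m1" using card_mono[of "{..<m1}" "\<Union>\<G>"] by simp
    moreover have "(n + 1) * card {K \<in> \<G>. card K \<le> n} \<le> (n + 1) * tree_base n1 m2 ^ n"
      using count by (rule mult_le_mono2)
    ultimately show ?thesis
      using card_times_le_card_Union[OF finG disj finK, of n] by linarith
  qed
  have bound': "(n + 1) * card \<G> \<le> (n + 1) * tree_base n1 m2 ^ n + (n + 1) * card Z + card (\<Union>\<G>')" for n
  proof -
    have sub: "\<G>' \<subseteq> \<G>" by (auto simp: \<G>'_def)
    then have fin': "finite \<G>'" and disj': "disjoint \<G>'"
      using finG disj by (auto intro: finite_subset simp: disjoint_def)
    have "\<exists>c\<in>Z. fst c \<subseteq> K" if K: "K \<in> \<G> - \<G>'" for K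
    proof -
      have "\<not> (\<forall>c\<in>Z. fst c \<inter> K = {})" using K unfolding \<G>'_def by blast
      then obtain c where c: "c \<in> Z" "fst c \<inter> K \<noteq> {}" by blast
      have "c \<in> \<C>" using c(1) by (simp add: Z_def)
      moreover have "union_of_components \<C> K" using G K by blast
      ultimately have "fst c \<inter> K = {} \<or> fst c \<subseteq> K" unfolding union_of_components_def by blast
      then show ?thesis using c by blast
    qed
    then have "\<forall>K\<in>\<G> - \<G>'. \<exists>c. c \<in> Z \<and> fst c \<subseteq> K" by blast
    from bchoice[OF this] obtain f where f: "\<And>K. K \<in> \<G> - \<G>' \<Longrightarrow> f K \<in> Z \<and> fst (f K) \<subseteq> K" by auto
    have "inj_on f (\<G> - \<G>')"
    proof (rule inj_onI)
      fix K K' assume K: "K \<in> \<G> - \<G>'" "K' \<in> \<G> - \<G>'" "f K = f K'"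
      have "fst (f K) \<noteq> {}" using f[OF K(1)] by (simp add: Z_def)
      then obtain e where "e \<in> fst (f K)" by blast
      then have "e \<in> K" "e \<in> K'" using f[OF K(1)] f[OF K(2)] K(3) by auto
      then show "K = K'" using dis K by blast
    qed
    moreover have "f ` (\<G> - \<G>') \<subseteq> Z" using f by blast
    ultimately have "card (\<G> - \<G>') \<le> card Z" using finZ by (rule card_inj_on_le)
    then have "card \<G> \<le> card \<G>' + card Z"
      using sub finG by (simp add: card_Diff_subset fin')
    then have "(n + 1) * card \<G> \<le> (n + 1) * (card \<G>' + card Z)" by (rule mult_le_mono2)
    moreover have "(n + 1) * card \<G>' \<le> (n + 1) * card {K \<in> \<G>'. card K \<le> n} + card (\<Union>\<G>')"
      by (rule card_times_le_card_Union[OF fin' disj']) (use finK sub in blast)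
    moreover have "card {K \<in> \<G>'. card K \<le> n} \<le> card {K \<in> \<G>. card K \<le> n}"
      using finG sub by (intro card_mono) auto
    then have "(n + 1) * card {K \<in> \<G>'. card K \<le> n} \<le> (n + 1) * tree_base n1 m2 ^ n"
      using count[of n] by (intro mult_le_mono2) linarith
    ultimately show ?thesis unfolding distrib_left by linarith
  qed
  have last: "(\<exists>\<C>'. pair_conf m1 n1 m2 (n2 - 1) \<C>') \<or> card (\<Union>\<G>') \<le> card Y + card Z * fact m2"
  proof (rule disjCI)
    assume no: "\<not> card (\<Union>\<G>') \<le> card Y + card Z * fact m2"
    \<comment> \<open>These points have a full block of their own and lie in tree components without
      empty labels.\<close>
    define Q where "Q = \<Union>\<G>' - Y"
    have "\<exists>K\<in>\<G>'. e \<in> K" if "e \<in> Q" for e using that by (auto simp: Q_def)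
    then obtain K where K: "\<And>e. e \<in> Q \<Longrightarrow> K e \<in> \<G>' \<and> e \<in> K e" by metis
    have KG: "K e \<in> \<G>" if "e \<in> Q" for e using K[OF that] by (auto simp: \<G>'_def)
    have "\<Union>\<G>' \<subseteq> {..<m1}" using G by (auto simp: \<G>'_def)
    then have finU: "finite (\<Union>\<G>')" using finite_subset by blast
    have "card (\<Union>\<G>') \<le> card (Q \<union> Y)" using finU finY by (intro card_mono) (auto simp: Q_def)
    also have "\<dots> \<le> card Q + card Y" by (rule card_Un_le)
    finally have "card Z * fact m2 < card Q" using no by simp
    then have card: "card {c \<in> \<C>. fst c \<noteq> {} \<and> snd c = {}} * fact m2 < card Q" by (simp only: Z_def)
    show "\<exists>\<C>'. pair_conf m1 n1 m2 (n2 - 1) \<C>'"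
    proof (rule pair_conf_pred[OF conf, where Q = Q and K = K])
      show "m2 > 0" using j by simp
      fix e assume e: "e \<in> Q"
      show "e \<in> K e \<and> K e \<subseteq> {..<m1} \<and> union_of_components \<C> (K e)" using K[OF e] G[OF KG[OF e]] by simp
      show "K e \<subseteq> U" if "union_of_components \<C> U" "K e \<inter> U \<noteq> {}" for U
        using conn[OF KG[OF e] that] .
      show "D \<inter> K e = {}" if "(D, {}) \<in> \<C>" "D \<noteq> {}" for D
      proof -
        have "(D, {}) \<in> Z" using that by (simp add: Z_def)
        moreover have "\<forall>c\<in>Z. fst c \<inter> K e = {}" using K[OF e] by (simp add: \<G>'_def)
        ultimately have "fst (D, {} :: nat set) \<inter> K e = {}" by (rule bspec[rotated])
        then show ?thesis by (simp only: fst_conv)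
      qed
      have "e < m1" using K[OF e] G[OF KG[OF e]] by blast
      then show "({e}, {..<m2}) \<in> \<C>" using e by (simp add: Q_def Y_def)
    qed (rule card)
  qed
  show ?thesis using ineq bound bound' last by blast
qed

section \<open>Asymptotics\<close>

lemma eventually_le_ln: "\<forall>\<^sub>F m in sequentially. K \<le> ln (real m)"
  by (rule eventually_compose_filterlim[OF eventually_ge_at_top filterlim_compose[OF ln_at_top filterlim_real_sequentially]])

lemma eventually_ln_sq_le:
  assumes "\<eta> > 0"
  shows "\<forall>\<^sub>F m in sequentially. K * ln (real m) ^ 2 \<le> \<eta> * real m"
proof -
  have "((\<lambda>m. ln (real m) ^ 2 / real m) \<longlongrightarrow> 0) sequentially" by real_asymp
  then have "((\<lambda>m. K * (ln (real m) ^ 2 / real m)) \<longlongrightarrow> K * 0) sequentially" by (rule tendsto_mult_left)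
  then have "\<forall>\<^sub>F m in sequentially. K * (ln (real m) ^ 2 / real m) < \<eta>"
    using assms by (intro order_tendstoD(2)) auto
  then show ?thesis
    using eventually_gt_at_top[of "0::nat"]
    by eventually_elim (simp add: field_simps)
qed

lemma eventually_sqrt_ln_le:
  assumes "\<eta> > 0"
  shows "\<forall>\<^sub>F m in sequentially. sqrt (real m) * ln (real m) \<le> \<eta> * real m"
proof -
  have "((\<lambda>m. sqrt (real m) * ln (real m) / real m) \<longlongrightarrow> 0) sequentially" by real_asymp
  then have "\<forall>\<^sub>F m in sequentially. sqrt (real m) * ln (real m) / real m < \<eta>"
    using assms by (intro order_tendstoD(2)) auto
  then show ?thesis
    using eventually_gt_at_top[of "0::nat"]
    by eventually_elim (simp add: field_simps)
qed

text \<open>With \<open>M m\<close> the largest positive \<open>n\<close> that satisfies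
  \<open>F m\<close>, the function is \<open>M m - r * m\<close>. Everything positive below
  \<open>M m\<close> satisfies \<open>F m\<close>: \<open>lower\<close> reaches up to
  \<open>N\<close>, and \<open>pred\<close> descends from \<open>M m\<close> to
  \<open>N\<close>.\<close>

lemma theta_threshold:
  fixes F :: "nat \<Rightarrow> nat \<Rightarrow> bool" and r c1 c2 :: real
  assumes r: "r \<ge> 0" and c: "c1 > 0" "c2 > 0"
    and lower: "\<forall>\<^sub>F m in sequentially. \<forall>n>0. real n \<le> r * real m + c1 * (real m / ln (real m)) \<longrightarrow> F m n"
    and upper: "\<forall>\<^sub>F m in sequentially. \<forall>n>0. F m n \<longrightarrow> real n \<le> r * real m + c2 * (real m / ln (real m))"
    and pred: "\<forall>\<^sub>F m in sequentially. \<forall>n>0. F m n \<longrightarrow>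
      r * real m + c1 * (real m / ln (real m)) < real n \<longrightarrow> F m (n - 1)"
  shows "\<exists>\<epsilon> :: nat \<Rightarrow> real.
    \<epsilon> \<in> \<Theta>(\<lambda>m. real m / ln (real m)) \<and> (\<forall>\<^sub>F m in sequentially. \<epsilon> m \<ge> 0) \<and>
    (\<forall>\<^sub>F m in sequentially. \<forall>n::nat. n > 0 \<longrightarrow> (F m n \<longleftrightarrow> real n \<le> r * real m + \<epsilon> m))"
proof -
  define M where "M m = Max {n. n > 0 \<and> F m n}" for m
  define \<epsilon> where "\<epsilon> m = real (M m) - r * real m" for m
  define \<phi> where "\<phi> m = real m / ln (real m)" for m :: nat
  \<comment> \<open>Rounding down to the integer \<open>N\<close> loses less than 1, which is at
    most \<open>c1 / 2 * \<phi> m\<close> by this bound.\<close>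
  have big: "\<forall>\<^sub>F m in sequentially. 2 \<le> c1 * \<phi> m"
  proof -
    have "filterlim (\<lambda>m. \<phi> m) at_top sequentially" unfolding \<phi>_def by real_asymp
    then have "\<forall>\<^sub>F m in sequentially. 2 / c1 \<le> \<phi> m" by (simp add: filterlim_at_top)
    then show ?thesis by eventually_elim (use c in \<open>simp add: field_simps\<close>)
  qed
  have main: "\<forall>\<^sub>F m in sequentially. c1 / 2 * \<phi> m \<le> \<epsilon> m \<and> \<epsilon> m \<le> c2 * \<phi> m \<and>
      (\<forall>n>0. F m n \<longleftrightarrow> n \<le> M m)"
    using lower upper pred big
  proof eventually_elim
    case (elim m)
    note low = elim(1)[folded \<phi>_def] and up = elim(2)[folded \<phi>_def] and pre = elim(3)[folded \<phi>_def]
    let ?S = "{n. n > 0 \<and> F m n}"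
    define N where "N = nat \<lfloor>r * real m + c1 * \<phi> m\<rfloor>"
    have pos: "r * real m + c1 * \<phi> m \<ge> 2" using r elim(4) by (simp add: add_increasing)
    have N: "real N \<le> r * real m + c1 * \<phi> m" "r * real m + c1 * \<phi> m < real N + 1"
      using pos unfolding N_def by linarith+
    have "N > 0" using N pos by linarith
    then have NS: "N \<in> ?S" using low N(1) by blast
    have fin: "finite ?S"
    proof (rule finite_subset)
      show "?S \<subseteq> {..nat \<lfloor>r * real m + c2 * \<phi> m\<rfloor>}"
        using up by (auto simp: le_nat_floor)
    qed simp
    have MS: "M m \<in> ?S" unfolding M_def by (rule Max_in[OF fin]) (use NS in blast)
    have Mge: "N \<le> M m" unfolding M_def by (rule Max_ge[OF fin NS])
    have down: "F m (M m - i)" if "N \<le> M m - i" for i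
      using that
    proof (induction i)
      case 0
      then show ?case using MS by simp
    next
      case (Suc i)
      have "F m (M m - i)" using Suc by simp
      moreover have "N + 1 \<le> M m - i" using Suc.prems \<open>N > 0\<close> by linarith
      then have "real (N + 1) \<le> real (M m - i)" by (simp only: of_nat_le_iff)
      then have "r * real m + c1 * \<phi> m < real (M m - i)" using N(2) by simp
      moreover have "0 < M m - i" using \<open>N + 1 \<le> M m - i\<close> by linarith
      ultimately have "F m (M m - i - 1)" using pre by blast
      then show ?case by simp
    qed
    have iff: "F m n \<longleftrightarrow> n \<le> M m" if n: "n > 0" for n
    proof
      assume "F m n"
      then show "n \<le> M m" unfolding M_def using n by (intro Max_ge[OF fin]) simp
    next
      assume "n \<le> M m"
      show "F m n"
      proof (cases "N \<le> n")
        case True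
        then show ?thesis using down[of "M m - n"] \<open>n \<le> M m\<close> by simp
      next
        case False
        then have "real n \<le> r * real m + c1 * \<phi> m" using N(1) by linarith
        then show ?thesis using low n by blast
      qed
    qed
    have "c1 / 2 * \<phi> m \<le> \<epsilon> m" using Mge N(2) elim(4) unfolding \<epsilon>_def by linarith
    moreover have "0 < M m" "F m (M m)" using MS by simp_all
    then have "real (M m) \<le> r * real m + c2 * \<phi> m" using up by blast
    then have "\<epsilon> m \<le> c2 * \<phi> m" unfolding \<epsilon>_def by linarith
    ultimately show ?case using iff by blast
  qed
  have pos: "\<forall>\<^sub>F m in sequentially. \<phi> m \<ge> 0"
    using eventually_ge_at_top[of "1::nat"] by eventually_elim (simp add: \<phi>_def)
  have nonneg: "\<forall>\<^sub>F m in sequentially. \<epsilon> m \<ge> 0"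
    using main big by eventually_elim simp
  have "\<epsilon> \<in> O(\<phi>)"
  proof (rule bigoI[of _ c2])
    show "\<forall>\<^sub>F m in sequentially. norm (\<epsilon> m) \<le> c2 * norm (\<phi> m)"
      using main nonneg pos by eventually_elim simp
  qed
  moreover have "\<epsilon> \<in> \<Omega>(\<phi>)"
  proof (rule landau_omega.bigI[of "c1 / 2"])
    show "\<forall>\<^sub>F m in sequentially. norm (\<epsilon> m) \<ge> c1 / 2 * norm (\<phi> m)"
      using main nonneg pos by eventually_elim simp
  qed (use c in simp)
  ultimately have "\<epsilon> \<in> \<Theta>(\<phi>)" by (rule bigthetaI)
  moreover have "\<forall>\<^sub>F m in sequentially. \<forall>n::nat. n > 0 \<longrightarrow> (F m n \<longleftrightarrow> real n \<le> r * real m + \<epsilon> m)"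
    using main by eventually_elim (simp add: \<epsilon>_def)
  ultimately show ?thesis using nonneg unfolding \<phi>_def by blast
qed

text \<open>With \<open>B = tree_base n1 m2\<close> this \<open>n\<close> is a compromise: at most
  \<open>sqrt m\<close> tree components have up to \<open>n\<close> points, far fewer than
  \<open>m / ln m\<close>, while every other one takes up at least a constant times
  \<open>ln m\<close> points.\<close>

lemma geometric_scale:
  fixes B m :: nat
  assumes "B \<ge> 2" "m \<ge> 1"
  defines "n \<equiv> nat \<lfloor>ln (real m) / (2 * ln (real B))\<rfloor>"
  shows "real B ^ n \<le> sqrt (real m)" and "ln (real m) / (2 * ln (real B)) \<le> real n + 1"
proof -
  have lnB: "ln (real B) > 0" using assms by simp
  have nn: "0 \<le> ln (real m) / (2 * ln (real B))" using assms lnB by simp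
  then have n: "real n \<le> ln (real m) / (2 * ln (real B))" "ln (real m) / (2 * ln (real B)) \<le> real n + 1"
    unfolding n_def by linarith+
  show "ln (real m) / (2 * ln (real B)) \<le> real n + 1" by (rule n)
  have "real B ^ n = exp (real n * ln (real B))"
    using assms(1) by (simp add: exp_of_nat_mult)
  also have "real n * ln (real B) \<le> ln (real m) / 2"
    using n(1) lnB by (simp add: field_simps)
  also have "ln (real m) / 2 = ln (sqrt (real m))"
    using assms by (simp add: ln_sqrt)
  also have "exp (ln (sqrt (real m))) = sqrt (real m)"
    using assms by simp
  finally show "real B ^ n \<le> sqrt (real m)" by simp
qed

section \<open>Upper bound, descent and lower bound for fixed parameters\<close>

context
  fixes n1 m2 j k :: nat
  assumes n1: "n1 = 2 + (\<Sum>i=0..j. m2 choose i) + k" and j: "j < (m2 - 1) div 2"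
    and k: "k \<ge> 1" "k < m2 choose (j + 1)"
begin

text \<open>This is the total size of the labels at an inner point of a path, called
  \<open>G\<close> in the construction; adding \<open>m2\<close> for one full edge label gives
  \<open>m2 * r\<close>.\<close>

definition label_weight :: nat where "label_weight = (\<Sum>i=0..j. (m2 - i) * (m2 choose i)) + (m2 - Suc j) * k"

lemma n1_pos: "n1 > 0"
  using n1 by simp

lemma j3: "2 * j + 3 \<le> m2"
  using j by linarith

lemma m2_r_param: "real m2 * r_param m2 j k = real m2 + real label_weight"
proof -
  have m2: "real m2 > 0" using j3 by simp
  have "real m2 * (\<Sum>i=0..j. (real m2 - real i) / real m2 * real (m2 choose i)) =
      real (\<Sum>i=0..j. (m2 - i) * (m2 choose i))"
    unfolding sum_distrib_left of_nat_sum using m2 j3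
    by (intro sum.cong refl) (auto simp: of_nat_diff)
  moreover have "real m2 * ((real m2 - real j - 1) / real m2 * real k) = real ((m2 - Suc j) * k)"
    using m2 j3 by (simp add: of_nat_diff)
  ultimately show ?thesis
    using j unfolding r_param_def label_weight_def by (simp add: distrib_left)
qed

lemma r_param_ge_1: "r_param m2 j k \<ge> 1"
proof -
  have "real m2 * 1 \<le> real m2 * r_param m2 j k" unfolding m2_r_param by simp
  then show ?thesis using j3 by (simp del: mult_1_right)
qed

lemma component_counts_real:
  fixes d mu M r :: real
  assumes conf: "pair_conf m1 n1 m2 n2 \<C>"
  defines "d \<equiv> real m2 - real j - 1" and "mu \<equiv> real m2 - 2 * real j - 2"
    and "M \<equiv> real m2" and "r \<equiv> r_param m2 j k" and "B \<equiv> tree_base n1 m2"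
  shows "\<exists>g z y q :: nat.
    M * real n2 + d * real z + real y \<le> M * r * real m1 + mu * real g + M * 2 ^ m2 \<and>
    (\<forall>n. (real n + 1) * real g \<le> (real n + 1) * real B ^ n + real m1) \<and>
    (\<forall>n. (real n + 1) * real g \<le> (real n + 1) * real B ^ n + (real n + 1) * real z + real q) \<and>
    ((\<exists>\<C>'. pair_conf m1 n1 m2 (n2 - 1) \<C>') \<or> real q \<le> real y + real z * fact m2)"
proof -
  let ?d = "int m2 - int j - 1" and ?mu = "int m2 - 2 * int j - 2"
  let ?R = "int m2 + (\<Sum>i=0..j. (int m2 - int i) * int (m2 choose i)) + ?d * int k"
  have R: "?R = int m2 + int label_weight"
  proof -
    have "(\<Sum>i=0..j. (int m2 - int i) * int (m2 choose i)) = int (\<Sum>i=0..j. (m2 - i) * (m2 choose i))"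
      unfolding of_nat_sum using j3 by (intro sum.cong refl) (auto simp: of_nat_diff)
    moreover have "?d * int k = int ((m2 - Suc j) * k)" using j3 by (simp add: of_nat_diff)
    ultimately show ?thesis unfolding label_weight_def by simp
  qed
  obtain g z y q :: nat where
    1: "int m2 * int n2 + ?d * int z + int y \<le> ?R * int m1 + ?mu * int g + int m2 * 2 ^ m2"
    and 2: "\<And>n. (n + 1) * g \<le> (n + 1) * B ^ n + m1"
    and 3: "\<And>n. (n + 1) * g \<le> (n + 1) * B ^ n + (n + 1) * z + q"
    and 4: "(\<exists>\<C>'. pair_conf m1 n1 m2 (n2 - 1) \<C>') \<or> q \<le> y + z * fact m2"
    using component_counts[OF conf n1 j3 refl refl refl] unfolding B_def by blast
  have "real_of_int (int m2 * int n2 + ?d * int z + int y) \<le>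
      real_of_int ((int m2 + int label_weight) * int m1 + ?mu * int g + int m2 * 2 ^ m2)"
    using 1 unfolding R by (simp only: of_int_le_iff)
  then have "M * real n2 + d * real z + real y \<le> M * r * real m1 + mu * real g + M * 2 ^ m2"
    unfolding M_def r_def m2_r_param d_def mu_def by simp
  moreover have "(real n + 1) * real g \<le> (real n + 1) * real B ^ n + real m1" for n
  proof -
    have "real ((n + 1) * g) \<le> real ((n + 1) * B ^ n + m1)" using 2[of n] by (simp only: of_nat_le_iff)
    then show ?thesis by (simp add: algebra_simps)
  qed
  moreover have "(real n + 1) * real g \<le> (real n + 1) * real B ^ n + (real n + 1) * real z + real q" for n
  proof -
    have "real ((n + 1) * g) \<le> real ((n + 1) * B ^ n + (n + 1) * z + q)"
      using 3[of n] by (simp only: of_nat_le_iff)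
    then show ?thesis by (simp add: algebra_simps)
  qed
  moreover have "(\<exists>\<C>'. pair_conf m1 n1 m2 (n2 - 1) \<C>') \<or> real q \<le> real y + real z * fact m2"
  proof (rule disjE[OF 4])
    assume "q \<le> y + z * fact m2"
    then have "real q \<le> real (y + z * fact m2)" by (simp only: of_nat_le_iff)
    then show ?thesis by simp
  qed blast
  ultimately show ?thesis by blast
qed

lemma tree_base_ge_2: "tree_base n1 m2 \<ge> 2"
proof -
  have "(2::nat) \<le> 2 ^ 1" by simp
  also have "\<dots> \<le> (2 ^ m2 + 3) ^ 1" by simp
  also have "\<dots> \<le> (2 ^ m2 + 3) ^ (2 * (n1 + 1))" by (rule power_increasing) auto
  finally show ?thesis by (simp add: tree_base_def)
qed

text \<open>At the scale of \<open>geometric_scale\<close>, the small components number at most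
  \<open>m / ln m\<close>, and the larger ones at most \<open>m / (n + 1)\<close>.\<close>

lemma component_number_bound:
  fixes g m B :: nat
  assumes g: "\<And>n. (real n + 1) * real g \<le> (real n + 1) * real B ^ n + real m"
    and B: "B \<ge> 2" and m: "m \<ge> 2" and sq: "sqrt (real m) * ln (real m) \<le> 1 * real m"
  shows "real g \<le> (1 + 2 * ln (real B)) * (real m / ln (real m))"
proof -
  define n where "n = nat \<lfloor>ln (real m) / (2 * ln (real B))\<rfloor>"
  have s: "real B ^ n \<le> sqrt (real m)" "ln (real m) / (2 * ln (real B)) \<le> real n + 1"
    unfolding n_def using geometric_scale[OF B, of m] m by auto
  have l: "ln (real m) > 0" "ln (real B) > 0" using m B by auto
  have "real g \<le> real B ^ n + real m / (real n + 1)"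
    using g[of n] by (simp add: field_simps)
  also have "real B ^ n \<le> real m / ln (real m)"
  proof -
    have "real B ^ n * ln (real m) \<le> sqrt (real m) * ln (real m)"
      using s(1) l by (intro mult_right_mono) auto
    then have "real B ^ n * ln (real m) \<le> real m" using sq by linarith
    then show ?thesis using l(1) by (simp only: pos_le_divide_eq)
  qed
  also have "real m / (real n + 1) \<le> real m / (ln (real m) / (2 * ln (real B)))"
    using s(2) l m by (intro divide_left_mono) auto
  also have "\<dots> = 2 * ln (real B) * (real m / ln (real m))" by simp
  finally show ?thesis by (simp add: distrib_right add_divide_distrib)
qed

text \<open>In the weight inequality \<open>mu * C\<close> accounts for the tree components, and the
  additional 1 in the constant absorbs \<open>m2 * 2 ^ m2\<close>.\<close>

lemma eventually_upper_bound:
  "\<exists>c2>0. \<forall>\<^sub>F m1 in sequentially. \<forall>n2>0.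
     (\<exists>P. distinguishing_partition (K_mult m1 n1 m2 n2) P) \<longrightarrow>
     real n2 \<le> r_param m2 j k * real m1 + c2 * (real m1 / ln (real m1))"
proof -
  define B where "B = tree_base n1 m2"
  define M where "M = real m2"
  define mu where "mu = real m2 - 2 * real j - 2"
  define C where "C = 1 + 2 * ln (real B)"
  define r where "r = r_param m2 j k"
  have B2: "B \<ge> 2" unfolding B_def by (rule tree_base_ge_2)
  have M3: "M \<ge> 3" and mu1: "mu \<ge> 1" and d: "real m2 - real j - 1 \<ge> 0" using j3 unfolding M_def mu_def by linarith+
  have C1: "C \<ge> 1" using B2 by (simp add: C_def)
  have "\<forall>\<^sub>F m1 in sequentially. \<forall>n2>0.
     (\<exists>P. distinguishing_partition (K_mult m1 n1 m2 n2) P) \<longrightarrow>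
     real n2 \<le> r * real m1 + (mu * C + 1) * (real m1 / ln (real m1))"
    using eventually_sqrt_ln_le[of 1, OF zero_less_one] eventually_ge_at_top[of "3::nat"]
      eventually_ln_sq_le[of 1 "M * 2 ^ m2", OF zero_less_one] eventually_le_ln[of 1]
  proof eventually_elim
    case (elim m)
    let ?\<phi> = "real m / ln (real m)"
    show ?case
    proof (intro allI impI)
      fix n2 :: nat assume n2: "n2 > 0" and "\<exists>P. distinguishing_partition (K_mult m n1 m2 n2) P"
      then obtain \<C> where conf: "pair_conf m n1 m2 n2 \<C>"
        using pair_conf_of_distinguishing_partition[OF n1_pos n2] by blast
      obtain g z y q :: nat where
        g: "M * real n2 + (real m2 - real j - 1) * real z + real y \<le> M * r * real m + mu * real g + M * 2 ^ m2"
        "\<And>n. (real n + 1) * real g \<le> (real n + 1) * real B ^ n + real m"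
        using component_counts_real[OF conf] unfolding B_def M_def mu_def r_def by blast
      have "real g \<le> C * ?\<phi>"
        unfolding C_def by (rule component_number_bound[OF g(2) B2 _ elim(1)]) (use elim(2) in simp)
      then have "mu * real g \<le> mu * (C * ?\<phi>)" using mu1 by (intro mult_left_mono) auto
      then have "mu * real g \<le> mu * C * ?\<phi>" by (simp only: mult.assoc)
      moreover have "M * 2 ^ m2 \<le> ?\<phi>"
      proof -
        have "M * 2 ^ m2 * ln (real m) \<le> M * 2 ^ m2 * ln (real m) ^ 2"
          using elim(4) M3 by (intro mult_left_mono) (auto simp: power2_eq_square)
        also have "\<dots> \<le> real m" using elim(3) by simp
        finally show ?thesis using elim(4) by (simp add: field_simps)
      qed
      moreover have "(real m2 - real j - 1) * real z \<ge> 0" using d by simp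
      moreover have "(mu * C + 1) * ?\<phi> = mu * C * ?\<phi> + ?\<phi>" by (simp only: distrib_right mult_1_left)
      ultimately have "M * real n2 \<le> M * r * real m + (mu * C + 1) * ?\<phi>"
        using g(1) of_nat_0_le_iff[of y, where 'a = real] by linarith
      also have "(mu * C + 1) * ?\<phi> \<le> M * ((mu * C + 1) * ?\<phi>)"
      proof -
        have "0 \<le> (mu * C + 1) * ?\<phi>" using mu1 C1 elim(4) by simp
        then show ?thesis using M3 mult_right_mono[of 1 M "(mu * C + 1) * ?\<phi>"] by simp
      qed
      finally have "M * real n2 \<le> M * (r * real m + (mu * C + 1) * ?\<phi>)" by (simp add: algebra_simps)
      then show "real n2 \<le> r * real m + (mu * C + 1) * ?\<phi>" using M3 by (simp only: mult_le_cancel_left_pos)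
    qed
  qed
  moreover have "mu * C + 1 > 0" using mu1 C1 by (simp add: add_nonneg_pos)
  ultimately show ?thesis unfolding r_def by blast
qed

text \<open>For such \<open>n2\<close> the weight inequality gives
  \<open>d * z + y + c1 * \<phi> \<le> mu * g\<close> with \<open>\<phi> = m / ln m\<close>. So
  \<open>y\<close> and \<open>z\<close> are \<open>O(\<phi>)\<close>, and \<open>g - z\<close> is at
  least a constant times \<open>\<phi>\<close>. Apart from at most \<open>B ^ n\<close> small ones,
  the components counted by \<open>g - z\<close> have at least a constant times \<open>ln m\<close>
  points each, so \<open>q\<close> grows linearly in \<open>m\<close> and finally exceeds
  \<open>y + z * fact m2\<close>.\<close>

lemma eventually_downward:
  assumes c1: "c1 > 0"
  shows "\<forall>\<^sub>F m1 in sequentially. \<forall>n2>0.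
     (\<exists>P. distinguishing_partition (K_mult m1 n1 m2 n2) P) \<longrightarrow>
     r_param m2 j k * real m1 + c1 * (real m1 / ln (real m1)) < real n2 \<longrightarrow>
     (\<exists>P. distinguishing_partition (K_mult m1 n1 m2 (n2 - 1)) P)"
proof -
  define B where "B = tree_base n1 m2"
  define M where "M = real m2"
  define d where "d = real m2 - real j - 1"
  define mu where "mu = real m2 - 2 * real j - 2"
  define C where "C = 1 + 2 * ln (real B)"
  define r where "r = r_param m2 j k"
  define A where "A = mu * C * (1 + fact m2)"
  have B2: "B \<ge> 2" unfolding B_def by (rule tree_base_ge_2)
  have lB: "ln (real B) > 0" using B2 by simp
  have M3: "M \<ge> 3" and mu1: "mu \<ge> 1" and d1: "d \<ge> 1" and mud: "mu \<le> d"
    using j3 unfolding M_def mu_def d_def by linarith+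
  have r1: "r \<ge> 1" unfolding r_def by (rule r_param_ge_1)
  have eta: "c1 / (2 * d) > 0" using c1 d1 by simp
  show ?thesis
    using eventually_sqrt_ln_le[of 1, OF zero_less_one] eventually_sqrt_ln_le[OF eta]
      eventually_ge_at_top[of "n1 + 2"] eventually_ln_sq_le[OF c1, of "M * 2 ^ m2"]
      eventually_le_ln[of 1] eventually_le_ln[of "A * (4 * d * ln (real B)) / c1 + 1"]
  proof eventually_elim
    case (elim m)
    define l where "l = ln (real m)"
    define \<phi> where "\<phi> = real m / l"
    have l1: "l \<ge> 1" using elim(5) by (simp add: l_def)
    have m_eq: "real m = l * \<phi>" using l1 by (simp add: \<phi>_def)
    have \<phi>0: "\<phi> > 0" using l1 elim(3) by (simp add: \<phi>_def)
    show ?case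
    proof (intro allI impI, fold l_def, fold \<phi>_def)
      fix n2 :: nat assume n2: "n2 > 0" and P: "\<exists>P. distinguishing_partition (K_mult m n1 m2 n2) P"
        and large: "r_param m2 j k * real m + c1 * \<phi> < real n2"
      \<comment> \<open>Returning from pairs to a partition requires \<open>n2 - 1\<close> to be
        positive and different from \<open>n1\<close>; this holds as \<open>n2\<close> exceeds
        \<open>m\<close>, which is at least \<open>n1 + 2\<close>.\<close>
      have n1n2: "n1 < n2 - 1"
      proof -
        have "real m \<le> r * real m" using r1 by (simp add: mult_le_cancel_right1)
        moreover have "c1 * \<phi> > 0" using c1 \<phi>0 by simp
        ultimately have "real m < real n2" using large unfolding r_def by linarith
        then show ?thesis using elim(3) by simp
      qed
      obtain \<C> where conf: "pair_conf m n1 m2 n2 \<C>"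
        using pair_conf_of_distinguishing_partition[OF n1_pos n2] P by blast
      obtain g z y q :: nat where
        g: "M * real n2 + d * real z + real y \<le> M * r * real m + mu * real g + M * 2 ^ m2"
        "\<And>n. (real n + 1) * real g \<le> (real n + 1) * real B ^ n + real m"
        "\<And>n. (real n + 1) * real g \<le> (real n + 1) * real B ^ n + (real n + 1) * real z + real q"
        "(\<exists>\<C>'. pair_conf m n1 m2 (n2 - 1) \<C>') \<or> real q \<le> real y + real z * fact m2"
        using component_counts_real[OF conf] unfolding B_def M_def mu_def r_def d_def by blast
      have gC: "real g \<le> C * \<phi>"
        unfolding C_def \<phi>_def l_def by (rule component_number_bound[OF g(2) B2 _ elim(1)]) (use elim(3) in simp)
      have "M * (r * real m + c1 * \<phi>) \<le> M * real n2"
        using large M3 unfolding r_def by (intro mult_left_mono) auto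
      then have Mn: "M * r * real m + M * (c1 * \<phi>) \<le> M * real n2" by (simp add: algebra_simps)
      have Mc: "3 * (c1 * \<phi>) \<le> M * (c1 * \<phi>)" using M3 c1 \<phi>0 by (intro mult_right_mono) auto
      have pow: "M * 2 ^ m2 \<le> c1 * \<phi>"
      proof -
        have "M * 2 ^ m2 * l \<le> M * 2 ^ m2 * l ^ 2"
          using l1 M3 by (intro mult_left_mono) (auto simp: power2_eq_square)
        also have "\<dots> \<le> c1 * real m" using elim(4) by (simp add: l_def)
        finally show ?thesis using l1 by (simp add: \<phi>_def field_simps)
      qed
      have key: "d * real z + real y + c1 * \<phi> \<le> mu * real g"
        using g(1) Mn Mc pow c1 \<phi>0 mult_pos_pos[OF c1 \<phi>0] by linarith
      have gm: "mu * real g \<le> mu * C * \<phi>" using gC mu1 by (simp add: mult.assoc mult_left_mono)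
      have "real z \<le> d * real z" using d1 by (simp add: mult_le_cancel_right1)
      then have z: "real z \<le> mu * C * \<phi>" and y: "real y \<le> mu * C * \<phi>"
        using key gm mult_pos_pos[OF c1 \<phi>0] of_nat_0_le_iff[of y, where 'a = real]
          of_nat_0_le_iff[of z, where 'a = real] by linarith+
      \<comment> \<open>An empty label costs \<open>d\<close>, at least as much as a tree component
        gains; hence empty labels cannot use up the components and \<open>g - z\<close> stays
        large.\<close>
      have "mu * real g \<le> d * real g" using mud by (intro mult_right_mono) auto
      then have "d * real z + c1 * \<phi> \<le> d * real g"
        using key of_nat_0_le_iff[of y, where 'a = real] by linarith
      then have gz: "c1 / d * \<phi> \<le> real g - real z" using d1 by (simp add: field_simps)
      have sq: "sqrt (real m) \<le> c1 / (2 * d) * \<phi>"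
      proof -
        have eq: "c1 / (2 * d) * \<phi> * l = c1 / (2 * d) * real m"
          by (simp only: m_eq mult.assoc mult.commute[of \<phi> l])
        have "sqrt (real m) * l \<le> c1 / (2 * d) * \<phi> * l"
          unfolding eq using elim(2) by (simp only: l_def)
        moreover have "l > 0" using l1 by linarith
        ultimately show ?thesis by (simp only: mult_le_cancel_right_pos)
      qed
      define n where "n = nat \<lfloor>ln (real m) / (2 * ln (real B))\<rfloor>"
      have s: "real B ^ n \<le> sqrt (real m)" "l / (2 * ln (real B)) \<le> real n + 1"
        unfolding n_def l_def using geometric_scale[OF B2, of m] elim(3) by auto
      \<comment> \<open>One half of the surplus is reserved for the components with at most
        \<open>n\<close> points.\<close>
      have half: "c1 / d * \<phi> = c1 / (2 * d) * \<phi> + c1 / (2 * d) * \<phi>" using d1 by (simp add: field_simps)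
      have "real B ^ n \<le> c1 / (2 * d) * \<phi>" using s(1) sq by (rule order_trans)
      with gz[unfolded half] have "c1 / (2 * d) * \<phi> + c1 / (2 * d) * \<phi> + real B ^ n \<le>
          real g - real z + c1 / (2 * d) * \<phi>" by (rule add_mono)
      then have "c1 / (2 * d) * \<phi> \<le> real g - real z - real B ^ n" by (simp only: algebra_simps add_le_cancel_left add_le_cancel_right)
      then have "l / (2 * ln (real B)) * (c1 / (2 * d) * \<phi>) \<le> (real n + 1) * (real g - real z - real B ^ n)"
      proof (rule mult_mono[OF s(2)])
        show "0 \<le> c1 / (2 * d) * \<phi>" using eta \<phi>0 by (intro mult_nonneg_nonneg) auto
      qed auto
      also have "\<dots> \<le> real q" using g(3)[of n] by (simp add: algebra_simps)
      finally have q: "c1 / (4 * d * ln (real B)) * (l * \<phi>) \<le> real q"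
        using d1 lB by (simp add: field_simps)
      have "\<exists>\<C>'. pair_conf m n1 m2 (n2 - 1) \<C>'"
      proof (rule ccontr)
        assume "\<not> ?thesis"
        then have "real q \<le> real y + real z * fact m2" using g(4) by blast
        also have "\<dots> \<le> mu * C * \<phi> + mu * C * \<phi> * fact m2"
          using y z by (intro add_mono mult_right_mono) auto
        also have "\<dots> = A * \<phi>" by (simp add: A_def algebra_simps)
        finally have "c1 / (4 * d * ln (real B)) * l * \<phi> \<le> A * \<phi>" using q by (simp add: mult.assoc)
        then have "c1 / (4 * d * ln (real B)) * l \<le> A" using \<phi>0 by (simp only: mult_le_cancel_right_pos)
        then have "l \<le> A * (4 * d * ln (real B)) / c1" using c1 d1 lB by (simp add: field_simps)
        then show False using elim(6) unfolding l_def by simp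
      qed
      then obtain \<C>' where "pair_conf m n1 m2 (n2 - 1) \<C>'" by blast
      then show "\<exists>P. distinguishing_partition (K_mult m n1 m2 (n2 - 1)) P"
        by (rule distinguishing_partition_of_pair_conf[rotated 2]) (use n1 n1n2 in auto)
    qed
  qed
qed

text \<open>\<open>Y\<close> groups of \<open>m2\<close> paths are used, as many as fit next to an
  anchor of at least \<open>X\<close> points and as \<open>n2\<close> permits; free edges supply the
  rest \<open>a\<close>. If room is the limit, the bound on \<open>n2\<close> controls
  \<open>a\<close>; if \<open>n2\<close> is the limit, \<open>a\<close> is at most the weight
  \<open>W\<close> of one group and \<open>fits\<close> suffices.\<close>

lemma distinguishing_partition_range:
  fixes m1 n2 L :: nat
  defines "s \<equiv> m2 * L + 2" and "d \<equiv> m2 - Suc j" and "X \<equiv> 2 * (m2 + 3) + n1"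
  defines "Ym \<equiv> (m1 - X) div (m2 * s)"
  assumes L: "L \<ge> 2" "L \<ge> n1" "m1 \<le> 2 ^ (L - 2)" and X: "X \<le> m1"
    and fits: "s * label_weight + 2 * d + m2 + m2 * Ym \<le> m1"
    and n2: "n2 > 0" "n2 + m2 + m2 * Ym \<le> m1 + Ym * (s * label_weight + 2 * d)"
  shows "\<exists>P. distinguishing_partition (K_mult m1 n1 m2 n2) P"
proof -
  define W where "W = s * label_weight + 2 * d"
  define Y where "Y = min Ym ((n2 - 1) div W)"
  define a where "a = n2 - Y * W"
  define x where "x = m1 - m2 * Y * s"
  have m2: "m2 \<ge> 3" using j3 by simp
  have s: "s \<ge> n1" "s \<ge> 1" using L m2 mult_le_mono[of 1 m2 n1 L] by (auto simp: s_def)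
  have "label_weight > 0" using k j3 by (auto simp: label_weight_def)
  then have W: "n1 < W" "W > 0"
  proof -
    have "d > 0" using j3 by (simp add: d_def)
    moreover have "s * 1 \<le> s * label_weight" using \<open>label_weight > 0\<close> by (intro mult_le_mono2) simp
    ultimately show "n1 < W" "W > 0" using s unfolding W_def mult_1_right by linarith+
  qed
  have YW: "Y * W \<le> n2 - 1"
    by (rule order_trans[OF mult_le_mono1[of Y "(n2 - 1) div W"]]) (auto simp: Y_def)
  have "m2 * Y * s \<le> m1 - X"
  proof -
    have "m2 * Y * s \<le> Ym * (m2 * s)" using mult_le_mono1[of Y Ym "m2 * s"] by (simp add: Y_def mult.assoc mult.left_commute)
    also have "\<dots> \<le> m1 - X" unfolding Ym_def by (rule div_times_less_eq_dividend)
    finally show ?thesis .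
  qed
  then have x: "x \<ge> X" "m1 = x + m2 * Y * s" using X by (auto simp: x_def)
  have mY: "m2 * Y * s = m2 * Y * (s - 1) + m2 * Y"
    using s(2) by (metis add.commute mult_Suc_right Suc_diff_1 less_eq_Suc_le One_nat_def)
  have bound: "a + m2 \<le> x + m2 * Y * (s - 1)"
  proof -
    have "a + m2 + m2 * Y \<le> m1"
    proof (cases "Y = Ym")
      case True
      then show ?thesis using n2 YW by (simp add: a_def W_def)
    next
      case False
      then have Y: "Y = (n2 - 1) div W" "Y \<le> Ym" by (auto simp: Y_def)
      have "n2 - 1 < W + Y * W" unfolding Y(1) using W(2) by (simp add: dividend_less_div_times add.commute)
      then have "a \<le> W" using n2 by (simp add: a_def)
      moreover have "m2 * Y \<le> m2 * Ym" using Y(2) by (rule mult_le_mono2)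
      ultimately show ?thesis using fits unfolding W_def by linarith
    qed
    then show ?thesis using x(2) mY by linarith
  qed
  show ?thesis
  proof (rule distinguishing_partition_exists[OF n1 j3 k L(1), of Y m1 x a n2, folded s_def d_def label_weight_def, folded W_def])
    have "m2 * Y \<le> m2 * Y * s" using s(2) by simp
    also have "\<dots> \<le> m1" using x(2) by simp
    finally show "m2 * Y \<le> 2 ^ (L - 2)" using L(3) by simp
    show "1 \<le> a" "n2 = a + Y * W" using YW n2(1) by (auto simp: a_def)
    \<comment> \<open>With at least one group, \<open>n2\<close> exceeds \<open>W\<close>, which
      exceeds \<open>n1\<close> because \<open>L \<ge> n1\<close>.\<close>
    show "n1 \<noteq> n2 \<or> Y = 0" using W by (auto simp: Y_def)
  qed (use x bound in \<open>auto simp: X_def\<close>)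
qed

text \<open>Each group of \<open>m2\<close> paths adds \<open>2 * d - m2 \<ge> 1\<close> to every
  large part beyond the rate \<open>r\<close>, and about \<open>m / (m2 * s)\<close> groups fit,
  with \<open>s\<close> of order \<open>ln m\<close>.\<close>

lemma eventually_lower_bound:
  "\<exists>c1>0. \<forall>\<^sub>F m1 in sequentially. \<forall>n2>0.
     real n2 \<le> r_param m2 j k * real m1 + c1 * (real m1 / ln (real m1)) \<longrightarrow>
     (\<exists>P. distinguishing_partition (K_mult m1 n1 m2 n2) P)"
proof -
  define M where "M = real m2"
  define g where "g = real label_weight"
  define dn where "dn = m2 - Suc j"
  define d where "d = real dn"
  define X where "X = 2 * (m2 + 3) + n1"
  define r where "r = r_param m2 j k"
  \<comment> \<open>Since \<open>S \<le> 3 * M * l\<close>, the gain is about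
    \<open>m / (3 * M ^ 2 * l)\<close> at least; \<open>c1\<close> keeps half of it and the other
    half covers the lower-order terms.\<close>
  define c1 where "c1 = 1 / (6 * M ^ 2)"
  have M3: "M \<ge> 3" and d2: "2 * d \<ge> M + 1" using j3 unfolding M_def d_def dn_def by linarith+
  have c1: "c1 > 0" using M3 by (simp add: c1_def)
  have g0: "g \<ge> 0" by (simp add: g_def)
  have half: "(0::real) < 1 / 2" by simp
  have Mr: "M * r = M + g" unfolding M_def r_def g_def by (rule m2_r_param)
  have "\<forall>\<^sub>F m1 in sequentially. \<forall>n2>0.
     real n2 \<le> r * real m1 + c1 * (real m1 / ln (real m1)) \<longrightarrow>
     (\<exists>P. distinguishing_partition (K_mult m1 n1 m2 n2) P)"
    using eventually_ge_at_top[of X] eventually_ge_at_top[of 1] eventually_le_ln[of "real n1 + 6"]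
      eventually_ln_sq_le[OF half, of "3 * M * g + 2 * d + M"]
      eventually_ln_sq_le[OF c1, of "M + real X * g + real X + 3 * M * g + 1"]
  proof eventually_elim
    case (elim m)
    define l where "l = ln (real m)"
    \<comment> \<open>About \<open>log 2 m\<close> digits suffice to number all paths; the summand 2
      provides the windows at the two ends, whose digit is 0, and \<open>n1\<close> makes every
      group weigh more than \<open>n1\<close>.\<close>
    define L where "L = n1 + 2 + nat \<lceil>log 2 (real m)\<rceil>"
    define s where "s = m2 * L + 2"
    define Ym where "Ym = (m - X) div (m2 * s)"
    define S where "S = real s"
    have l6: "l \<ge> real n1 + 6" using elim(3) by (simp add: l_def)
    then have l1: "l \<ge> 1" by linarith
    have log0: "log 2 (real m) \<ge> 0" using elim(2) by simp
    have log_le: "log 2 (real m) \<le> 2 * l"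
    proof -
      have "ln (2::real) \<ge> 1 / 2" using ln_le_minus_one[of "1 / 2"] by (simp add: ln_div)
      then have "l * 1 \<le> l * (2 * ln 2)" using l1 by (intro mult_left_mono) auto
      then show ?thesis by (simp add: log_def l_def field_simps)
    qed
    have Lr: "real L \<le> real n1 + 3 + 2 * l" using log0 log_le unfolding L_def by simp linarith
    have L: "L \<ge> 2" "L \<ge> n1" by (auto simp: L_def)
    have pow: "m \<le> 2 ^ (L - 2)"
    proof -
      have "real m = 2 powr log 2 (real m)" using elim(2) by simp
      also have "\<dots> \<le> 2 powr real (L - 2)"
        using log0 by (intro powr_mono) (auto simp: L_def, linarith)
      also have "\<dots> = real (2 ^ (L - 2))" by (simp add: powr_realpow)
      finally show ?thesis by (simp only: of_nat_le_iff)
    qed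
    have S_le: "S \<le> 3 * M * l"
    proof -
      have "S = M * real L + 2" by (simp add: S_def s_def M_def)
      also have "\<dots> \<le> M * (real n1 + 3 + 2 * l) + M" using Lr M3 by (intro add_mono mult_left_mono) auto
      also have "\<dots> = M * (real n1 + 4 + 2 * l)" by (simp add: algebra_simps)
      also have "\<dots> \<le> M * (3 * l)" using l6 M3 by (intro mult_left_mono) auto
      finally show ?thesis by simp
    qed
    have S4: "S \<ge> 4"
    proof -
      have "3 * 2 \<le> m2 * L" using j3 L by (intro mult_le_mono) auto
      then have "4 \<le> s" unfolding s_def by linarith
      then show ?thesis by (simp add: S_def)
    qed
    have MS: "M * S > 0" using M3 S4 by simp
    have Ym_le: "real Ym * (M * S) \<le> real m"
    proof -
      have "Ym * (m2 * s) \<le> m" unfolding Ym_def by (rule order_trans[OF div_times_less_eq_dividend]) simp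
      then have "real (Ym * (m2 * s)) \<le> real m" by (simp only: of_nat_le_iff)
      then show ?thesis by (simp add: M_def S_def)
    qed
    have Ym_ge: "(real m - real X) / (M * S) - 1 \<le> real Ym"
    proof -
      have "m - X < Ym * (m2 * s) + m2 * s"
        unfolding Ym_def using j3 by (simp add: s_def dividend_less_div_times add.commute)
      then have "real (m - X) < real (Ym * (m2 * s) + m2 * s)" by (simp only: of_nat_less_iff)
      then have "real m - real X < (real Ym + 1) * (M * S)"
        using elim(1) by (simp add: M_def S_def of_nat_diff algebra_simps)
      then show ?thesis using MS by (simp add: field_simps)
    qed
    have fits: "s * label_weight + 2 * dn + m2 + m2 * Ym \<le> m"
    proof -
      have "M * real Ym * 4 \<le> M * real Ym * S" using M3 S4 by (intro mult_left_mono) auto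
      then have 1: "M * real Ym \<le> real m / 4" using Ym_le by (simp add: algebra_simps)
      have "S * g + 2 * d + M \<le> 3 * M * l * g + (2 * d + M) * l"
      proof -
        have "(2 * d + M) * 1 \<le> (2 * d + M) * l" using l1 d2 M3 by (intro mult_left_mono) auto
        from add_mono[OF mult_right_mono[OF S_le g0] this] show ?thesis
          by (simp only: mult_1_right add.assoc)
      qed
      also have "\<dots> = (3 * M * g + 2 * d + M) * l" by (simp add: algebra_simps)
      also have "\<dots> \<le> (3 * M * g + 2 * d + M) * l ^ 2"
        using g0 l1 d2 M3 by (intro mult_left_mono) (auto simp: power2_eq_square)
      also have "\<dots> \<le> 1 / 2 * real m" using elim(4) by (simp add: l_def)
      finally have "S * g + 2 * d + M + M * real Ym \<le> real m" using 1 by simp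
      then have "real (s * label_weight + 2 * dn + m2 + m2 * Ym) \<le> real m" by (simp add: S_def g_def d_def M_def)
      then show ?thesis by (simp only: of_nat_le_iff)
    qed
    have range: "r * real m + c1 * (real m / l) + M + M * real Ym \<le> real m + real Ym * (S * g + 2 * d)"
    proof -
      have "((real m - real X) / (M * S) - 1) * (S * g + 1) \<le> real Ym * (S * g + 1)"
        using Ym_ge S4 g0 by (intro mult_right_mono) auto
      also have "\<dots> \<le> real Ym * (S * g + (2 * d - M))" using d2 by (intro mult_left_mono) auto
      finally have 1: "((real m - real X) / (M * S) - 1) * (S * g + 1) + M * real Ym
          \<le> real Ym * (S * g + 2 * d)" by (simp add: algebra_simps)
      have "((real m - real X) / (M * S) - 1) * (S * g + 1) =
          real m * g / M - real X * g / M + real m / (M * S) - real X / (M * S) - S * g - 1"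
        using M3 S4 by (simp add: field_simps)
      moreover have "r * real m = real m + real m * g / M"
        using Mr M3 by (simp add: field_simps) (metis distrib_left mult.commute mult.left_commute)
      moreover have "real X * g / M \<le> real X * g"
      proof -
        have "0 \<le> real X * g" using g0 by (intro mult_nonneg_nonneg) auto
        moreover have "1 \<le> M" using M3 by linarith
        ultimately have "real X * g / M \<le> real X * g / 1" by (intro divide_left_mono) auto
        then show ?thesis by simp
      qed
      moreover have "real X / (M * S) \<le> real X"
      proof -
        have "1 * 1 \<le> M * S" using M3 S4 by (intro mult_mono) auto
        then show ?thesis by (simp add: divide_le_eq mult_le_cancel_left1)
      qed
      moreover have "S * g \<le> 3 * M * g * l" using mult_right_mono[OF S_le g0] by (simp add: algebra_simps)
      moreover have "2 * (c1 * (real m / l)) \<le> real m / (M * S)"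
      proof -
        have "M * S \<le> M * (3 * M * l)" using S_le M3 by (intro mult_left_mono) auto
        then have "real m / (M * (3 * M * l)) \<le> real m / (M * S)"
          using MS l1 M3 by (intro divide_left_mono) auto
        moreover have "real m / (M * (3 * M * l)) = 2 * (c1 * (real m / l))"
          using M3 l1 by (simp add: c1_def power2_eq_square field_simps)
        ultimately show ?thesis by simp
      qed
      moreover have "M + real X * g + real X + 3 * M * g * l + 1 \<le> c1 * (real m / l)"
      proof -
        let ?K = "M + real X * g + real X + 3 * M * g + 1"
        have K: "(M + real X * g + real X + 1) * 1 \<le> (M + real X * g + real X + 1) * l"
          using l1 M3 g0 by (intro mult_left_mono) auto
        then have "M + real X * g + real X + 3 * M * g * l + 1 \<le> ?K * l" by (simp add: algebra_simps)
        also have "\<dots> \<le> c1 * (real m / l)"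
          using elim(5) l1 by (simp add: l_def[symmetric] field_simps power2_eq_square)
        finally show ?thesis .
      qed
      ultimately show ?thesis using 1 by linarith
    qed
    show ?case
    proof (intro allI impI)
      fix n2 :: nat assume n2: "n2 > 0" "real n2 \<le> r * real m + c1 * (real m / ln (real m))"
      have "real n2 + M + M * real Ym \<le> real m + real Ym * (S * g + 2 * d)"
        using n2(2) range unfolding l_def by linarith
      then have "real (n2 + m2 + m2 * Ym) \<le> real (m + Ym * (s * label_weight + 2 * dn))"
        by (simp add: M_def S_def g_def d_def)
      then have "n2 + m2 + m2 * Ym \<le> m + Ym * (s * label_weight + 2 * dn)" by (simp only: of_nat_le_iff)
      then show "\<exists>P. distinguishing_partition (K_mult m n1 m2 n2) P"
        using distinguishing_partition_range[OF L pow, of n2] elim(1) fits n2(1)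
        unfolding s_def Ym_def X_def dn_def by blast
    qed
  qed
  then show ?thesis using c1 unfolding r_def by blast
qed

end

theorem theorem1p4:
  fixes n1 m2 j k :: nat
  assumes "n1 \<ge> 3" and "m2 \<ge> 1"
    and "jk_params n1 m2 j k"
    and "k \<ge> 1" and "j < (m2 - 1) div 2"
  shows "\<exists>\<epsilon> :: nat \<Rightarrow> real.
    \<epsilon> \<in> \<Theta>(\<lambda>m. real m / ln (real m)) \<and> (\<forall>\<^sub>F m in sequentially. \<epsilon> m \<ge> 0) \<and>
    (\<forall>\<^sub>F m1 in sequentially. \<forall>n2::nat. n2 > 0 \<longrightarrow>
       ((\<exists>P. distinguishing_partition (K_mult m1 n1 m2 n2) P) \<longleftrightarrow>
        real n2 \<le> r_param m2 j k * real m1 + \<epsilon> m1))"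
proof -
  have params: "n1 = 2 + (\<Sum>i=0..j. m2 choose i) + k" "k < m2 choose (j + 1)"
    using assms(3,5) unfolding jk_params_def by auto
  note ctx = params(1) assms(5,4) params(2)
  \<comment> \<open>The descent works for every positive constant, so the one supplied by the
    construction can be used and no gap remains between the constructed values and those reached by
    the descent.\<close>
  obtain c1 where c1: "c1 > 0" "\<forall>\<^sub>F m1 in sequentially. \<forall>n2>0.
      real n2 \<le> r_param m2 j k * real m1 + c1 * (real m1 / ln (real m1)) \<longrightarrow>
      (\<exists>P. distinguishing_partition (K_mult m1 n1 m2 n2) P)"
    using eventually_lower_bound[OF ctx] by blast
  obtain c2 where c2: "c2 > 0" "\<forall>\<^sub>F m1 in sequentially. \<forall>n2>0.
      (\<exists>P. distinguishing_partition (K_mult m1 n1 m2 n2) P) \<longrightarrow>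
      real n2 \<le> r_param m2 j k * real m1 + c2 * (real m1 / ln (real m1))"
    using eventually_upper_bound[OF ctx] by blast
  have "0 \<le> r_param m2 j k" using r_param_ge_1[OF ctx] by simp
  from theta_threshold[OF this c1(1) c2(1) c1(2) c2(2) eventually_downward[OF ctx c1(1)]]
  show ?thesis .
qed

end
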